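(* Let $\mathcal{H}$ be an infinite dimensional real Hilbert space with a fixed complex structure $J$, and let ${\rm Sp}_2(\mathcal{H})$ be the restricted symplectic group endowed with the left invariant metric $\mathcal{I}(g,v)=\|g^{-1}v\|_2$ for $g\in{\rm Sp}_2(\mathcal{H})$ and $v\in T_g{\rm Sp}_2(\mathcal{H})$. Let $d_{\mathcal{I}}$ be the associated geodesic distance. Then the metric space $({\rm Sp}_2(\mathcal{H}),d_{\mathcal{I}})$ is complete.
   Context: $\mathcal{B}(\mathcal{H})$ is the algebra of bounded operators on $\mathcal{H}$, $\mathcal{B}_2(\mathcal{H})$ is the ideal of Hilbert-Schmidt operators, and $\|a\|_2=Tr(a^*a)^{1/2}$. A complex structure is a linear isometry $J\in\mathcal{B}(\mathcal{H})$ with $J^2=-1$ and $J^*=-J$. ${\rm Sp}(\mathcal{H})=\{g\in\mathcal{B}(\mathcal{H}) : g \text{ invertible},\ g^*Jg=J\}$ and ${\rm Sp}_2(\mathcal{H})=\{g\in{\rm Sp}(\mathcal{H}): g-1\in\mathcal{B}_2(\mathcal{H})\}$. With the topology given by $\|g_1-g_2\|_2$ it is a Banach-Lie group (a submanifold of $1+\mathcal{B}_2(\mathcal{H})$) with Lie algebra $\mathfrak{sp}_2(\mathcal{H})=\{x\in\mathcal{B}_2(\mathcal{H}): xJ=-Jx^*\}$, and $T_g{\rm Sp}_2(\mathcal{H})=g\cdot\mathfrak{sp}_2(\mathcal{H})$. The length of a piecewise smooth curve $\alpha:[0,1]\to{\rm Sp}_2(\mathcal{H})$ is $L_{\mathcal{I}}(\alpha)=\int_0^1\mathcal{I}(\alpha(t),\dot\alpha(t))\,dt=\int_0^1\|\alpha(t)^{-1}\dot\alpha(t)\|_2\,dt$,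 and $d_{\mathcal{I}}(p,q)$ is the infimum of $L_{\mathcal{I}}(\alpha)$ over all piecewise smooth curves $\alpha$ in ${\rm Sp}_2(\mathcal{H})$ with $\alpha(0)=p$, $\alpha(1)=q$. *)

theory Defs
  imports "HOL-Analysis.Analysis"
begin

text \<open>A real Hilbert space is a type of sort \<open>{real_inner, banach}\<close>; bounded operators on it
  are the elements of \<open>'a \<Rightarrow>\<^sub>L 'a\<close>.\<close>

definition blinfun_adjoint ::
  "('a::{real_inner,banach} \<Rightarrow>\<^sub>L 'a) \<Rightarrow> ('a \<Rightarrow>\<^sub>L 'a)"
  where "blinfun_adjoint a = Blinfun (adjoint (blinfun_apply a))"

definition blinfun_invertible :: "('a::real_normed_vector \<Rightarrow>\<^sub>L 'a) \<Rightarrow> bool"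
  where "blinfun_invertible g \<longleftrightarrow>
    (\<exists>h. g o\<^sub>L h = id_blinfun \<and> h o\<^sub>L g = id_blinfun)"

definition blinfun_inverse ::
  "('a::real_normed_vector \<Rightarrow>\<^sub>L 'a) \<Rightarrow> ('a \<Rightarrow>\<^sub>L 'a)"
  where "blinfun_inverse g =
    (THE h. g o\<^sub>L h = id_blinfun \<and> h o\<^sub>L g = id_blinfun)"

definition orthonormal_basis :: "'a::{real_inner,banach} set \<Rightarrow> bool"
  where "orthonormal_basis B \<longleftrightarrow>
    pairwise orthogonal B \<and> (\<forall>e\<in>B. norm e = 1) \<and> closure (span B) = UNIV"

text \<open>The trace of \<open>a\<^sup>* a\<close>, and its finiteness, do not depend on the orthonormal
  basis, so one is fixed here once and for all. The space need not be separable, hence the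
  unordered sum.\<close>

definition the_basis :: "'a::{real_inner,banach} set"
  where "the_basis = (SOME B. orthonormal_basis B)"

definition op_trace :: "('a::{real_inner,banach} \<Rightarrow>\<^sub>L 'a) \<Rightarrow> real"
  where "op_trace a = (\<Sum>\<^sub>\<infinity>e\<in>the_basis. blinfun_apply a e \<bullet> e)"

definition hilbert_schmidt :: "('a::{real_inner,banach} \<Rightarrow>\<^sub>L 'a) set"
  where "hilbert_schmidt =
    {a. (\<lambda>e. blinfun_apply (blinfun_adjoint a o\<^sub>L a) e \<bullet> e) summable_on the_basis}"

text \<open>Only meaningful on \<open>hilbert_schmidt\<close>: a divergent \<open>infsum\<close> is \<open>0\<close>.\<close>

definition hs_norm :: "('a::{real_inner,banach} \<Rightarrow>\<^sub>L 'a) \<Rightarrow> real"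
  where "hs_norm a = sqrt (op_trace (blinfun_adjoint a o\<^sub>L a))"

definition complex_structure :: "('a::{real_inner,banach} \<Rightarrow>\<^sub>L 'a) \<Rightarrow> bool"
  where "complex_structure J \<longleftrightarrow>
    (\<forall>x. norm (blinfun_apply J x) = norm x) \<and>
    J o\<^sub>L J = - id_blinfun \<and> blinfun_adjoint J = - J"

definition Sp ::
  "('a::{real_inner,banach} \<Rightarrow>\<^sub>L 'a) \<Rightarrow> ('a \<Rightarrow>\<^sub>L 'a) set"
  where "Sp J =
    {g. blinfun_invertible g \<and> blinfun_adjoint g o\<^sub>L J o\<^sub>L g = J}"

definition Sp2 ::
  "('a::{real_inner,banach} \<Rightarrow>\<^sub>L 'a) \<Rightarrow> ('a \<Rightarrow>\<^sub>L 'a) set"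
  where "Sp2 J = {g \<in> Sp J. g - id_blinfun \<in> hilbert_schmidt}"

text \<open>Differentiation in the affine Banach space \<open>1 + hilbert_schmidt\<close>: the difference
  quotients converge in \<open>hs_norm\<close>, not just in the operator norm. At the endpoints
  of an interval \<open>S\<close> the derivative is one-sided.\<close>

definition has_hs_derivative ::
  "(real \<Rightarrow> ('a::{real_inner,banach} \<Rightarrow>\<^sub>L 'a)) \<Rightarrow> ('a \<Rightarrow>\<^sub>L 'a)
    \<Rightarrow> real \<Rightarrow> real set \<Rightarrow> bool"
  where "has_hs_derivative \<alpha> v t S \<longleftrightarrow>
    v \<in> hilbert_schmidt \<and> (\<forall>s\<in>S. \<alpha> s - \<alpha> t \<in> hilbert_schmidt) \<and>
    ((\<lambda>s. hs_norm ((\<alpha> s - \<alpha> t) /\<^sub>R (s - t) - v)) \<longlongrightarrow> 0) (at t within S)"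

definition hs_derivative ::
  "(real \<Rightarrow> ('a::{real_inner,banach} \<Rightarrow>\<^sub>L 'a)) \<Rightarrow> real \<Rightarrow> ('a \<Rightarrow>\<^sub>L 'a)"
  where "hs_derivative \<alpha> t = (THE v. has_hs_derivative \<alpha> v t {0..1})"

text \<open>\<open>D n\<close> is the \<open>n\<close>-th derivative of \<open>\<alpha>\<close>.\<close>

definition hs_smooth_on ::
  "(real \<Rightarrow> ('a::{real_inner,banach} \<Rightarrow>\<^sub>L 'a)) \<Rightarrow> real set \<Rightarrow> bool"
  where "hs_smooth_on \<alpha> S \<longleftrightarrow>
    (\<exists>D. (\<forall>t\<in>S. D 0 t = \<alpha> t) \<and>
         (\<forall>n. \<forall>t\<in>S. has_hs_derivative (D n) (D (Suc n) t) t S))"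

text \<open>Smoothness on the closed pieces, which share their endpoints, entails continuity
  on \<open>{0..1}\<close>.\<close>

definition piecewise_hs_smooth ::
  "(real \<Rightarrow> ('a::{real_inner,banach} \<Rightarrow>\<^sub>L 'a)) \<Rightarrow> bool"
  where "piecewise_hs_smooth \<alpha> \<longleftrightarrow>
    (\<exists>(n::nat) \<tau>. \<tau> 0 = 0 \<and> \<tau> n = 1 \<and>
      (\<forall>i<n. \<tau> i < \<tau> (Suc i) \<and> hs_smooth_on \<alpha> {\<tau> i..\<tau> (Suc i)}))"

definition Sp2_curves ::
  "('a::{real_inner,banach} \<Rightarrow>\<^sub>L 'a) \<Rightarrow> ('a \<Rightarrow>\<^sub>L 'a) \<Rightarrow> ('a \<Rightarrow>\<^sub>L 'a)
    \<Rightarrow> (real \<Rightarrow> ('a \<Rightarrow>\<^sub>L 'a)) set"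
  where "Sp2_curves J p q =
    {\<alpha>. piecewise_hs_smooth \<alpha> \<and> (\<forall>t\<in>{0..1}. \<alpha> t \<in> Sp2 J) \<and> \<alpha> 0 = p \<and> \<alpha> 1 = q}"

definition left_metric ::
  "('a::{real_inner,banach} \<Rightarrow>\<^sub>L 'a) \<Rightarrow> ('a \<Rightarrow>\<^sub>L 'a) \<Rightarrow> real"
  where "left_metric g v = hs_norm (blinfun_inverse g o\<^sub>L v)"

text \<open>At the finitely many break points \<open>hs_derivative\<close> may be arbitrary; this does not
  affect the integral.\<close>

definition curve_length ::
  "(real \<Rightarrow> ('a::{real_inner,banach} \<Rightarrow>\<^sub>L 'a)) \<Rightarrow> real"
  where "curve_length \<alpha> =
    integral {0..1} (\<lambda>t. left_metric (\<alpha> t) (hs_derivative \<alpha> t))"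

text \<open>The locale \<open>Metric_space\<close> requires nonnegativity and symmetry also off the carrier,
  where there are no curves and \<open>Inf {}\<close> is unspecified; hence the value \<open>0\<close> there.\<close>

definition geodesic_dist ::
  "('a::{real_inner,banach} \<Rightarrow>\<^sub>L 'a) \<Rightarrow> ('a \<Rightarrow>\<^sub>L 'a) \<Rightarrow> ('a \<Rightarrow>\<^sub>L 'a)
    \<Rightarrow> real"
  where "geodesic_dist J p q =
    (if p \<in> Sp2 J \<and> q \<in> Sp2 J then INF \<alpha>\<in>Sp2_curves J p q. curve_length \<alpha> else 0)"

end

theory Submission
  imports Defs
begin

text \<open>
  Along a curve from \<open>1\<close> of length \<open>L \<le> 1/2\<close> the operator norm stays below 2, so its end point is
  within \<open>2 L\<close> of \<open>1\<close> in the Hilbert-Schmidt norm; conversely an element near \<open>1\<close> is joined to \<open>1\<close>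
  by a Cayley path of length at most a constant times its Hilbert-Schmidt distance from \<open>1\<close>. By left
  invariance, a Cauchy sequence for the geodesic distance is, up to translation, Cauchy in the
  Hilbert-Schmidt norm, and it converges for both.

  The distance is finite because the group is connected. Halley's iteration for the polar
  decomposition, each step of which stays in the path component, makes the antilinear part
  of an element small. Then finitely many sign changes on complex lines, each lowering
  \<open>\<parallel>g - 1\<parallel>\<^sub>2\<^sup>2\<close> by at least 3, lead to an element that a Cayley path joins to \<open>1\<close>. No spectral theorem is needed.
\<close>

section \<open>Orthonormal bases and adjoints\<close>

text \<open>The left invariant metric and the Hilbert-Schmidt norm are comparable only where
  \<open>g\<close> and its inverse are bounded. In the symplectic group the inverse is minus the
  adjoint conjugated by two factors \<open>J\<close>, so one bound on \<open>g\<close> controls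
  both. The Cayley transform replaces the exponential map because it is rational: it needs only
  inverses of coercive operators, which a fixed point argument supplies. The price is a condition on
  the numerical range, which fails where \<open>g\<close> acts nearly as \<open>-1\<close>; this is
  the obstacle to connectedness. A sign change removes such a direction. It is made on a complex
  line so that it commutes with \<open>J\<close> and stays in the group. The Hilbert-Schmidt norm
  counts the bad directions, each contributing a fixed amount to \<open>g - 1\<close>, hence
  finitely many changes suffice. A bad vector \<open>v\<close> says nothing about \<open>J v\<close>
  unless \<open>g\<close> is almost complex linear, and this is why the polar decomposition is
  approximated beforehand.\<close>

lemma closed_subspace_projection:
  fixes x :: "'a::{real_inner,banach}"
  assumes M: "subspace M" "closed M"
  obtains m where "m \<in> M" "\<And>y. y \<in> M \<Longrightarrow> (x - m) \<bullet> y = 0"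
proof -
  define d where "d = (INF y\<in>M. (norm (x - y))\<^sup>2)"
  have bdd: "bdd_below ((\<lambda>y. (norm (x - y))\<^sup>2) ` M)"
    by (rule bdd_belowI2[of _ 0]) simp
  have ne: "M \<noteq> {}"
    using subspace_0[OF M(1)] by auto
  have dle: "d \<le> (norm (x - y))\<^sup>2" if "y \<in> M" for y
    unfolding d_def using bdd that by (rule cINF_lower)
  have "\<exists>y\<in>M. (norm (x - y))\<^sup>2 < d + inverse (real (Suc n))" for n
    using cINF_less_iff[OF ne bdd, of "d + inverse (real (Suc n))"] unfolding d_def by simp
  then obtain y where y: "\<And>n. y n \<in> M" "\<And>n. (norm (x - y n))\<^sup>2 < d + inverse (real (Suc n))"
    by metis
  \<comment> \<open>The parallelogram law for \<open>x - y n\<close> and \<open>x - y k\<close>: the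
    midpoint of \<open>y n\<close> and \<open>y k\<close> lies in \<open>M\<close>, so its squared
    distance from \<open>x\<close> is at least \<open>d\<close>, and all multiples of
    \<open>d\<close> cancel.\<close>
  have par: "(norm (y n - y k))\<^sup>2 \<le> 2 * inverse (real (Suc n)) + 2 * inverse (real (Suc k))" for n k
  proof -
    have mid: "(1/2) *\<^sub>R (y n + y k) \<in> M"
      using M(1) y(1) by (simp add: subspace_add subspace_scale)
    have "(norm (y n - y k))\<^sup>2 = 2 * (norm (x - y n))\<^sup>2 + 2 * (norm (x - y k))\<^sup>2
        - 4 * (norm (x - (1/2) *\<^sub>R (y n + y k)))\<^sup>2"
      unfolding power2_norm_eq_inner
      by (simp add: inner_diff_left inner_diff_right inner_add_left inner_add_right inner_commute field_simps)
    then show ?thesis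
      using dle[OF mid] y(2)[of n] y(2)[of k] by linarith
  qed
  have "Cauchy y"
  proof (rule CauchyI)
    fix e :: real assume "e > 0"
    then obtain N where N: "inverse (real (Suc N)) < e\<^sup>2 / 4"
      using reals_Archimedean[of "e\<^sup>2/4"] by auto
    have "norm (y n - y k) < e" if "n \<ge> N" "k \<ge> N" for n k
    proof -
      have "inverse (real (Suc n)) \<le> inverse (real (Suc N))" "inverse (real (Suc k)) \<le> inverse (real (Suc N))"
        using that by (simp_all add: field_simps)
      then have "(norm (y n - y k))\<^sup>2 < e\<^sup>2"
        using par[of n k] N by linarith
      then show ?thesis
        using \<open>e > 0\<close> by (simp add: power_less_imp_less_base)
    qed
    then show "\<exists>N. \<forall>m\<ge>N. \<forall>n\<ge>N. norm (y m - y n) < e" by blast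
  qed
  then obtain m where m: "y \<longlonglongrightarrow> m"
    using convergent_eq_Cauchy by blast
  have mM: "m \<in> M"
    using M(2) m y(1) closed_sequentially by blast
  have "(\<lambda>n. (norm (x - y n))\<^sup>2) \<longlonglongrightarrow> (norm (x - m))\<^sup>2"
    by (intro tendsto_intros m)
  moreover have "(\<lambda>n. d + inverse (real (Suc n))) \<longlonglongrightarrow> d + 0"
    by (intro tendsto_intros LIMSEQ_inverse_real_of_nat)
  ultimately have md: "(norm (x - m))\<^sup>2 \<le> d"
    using y(2) by (metis (mono_tags, lifting) LIMSEQ_le add.right_neutral less_imp_le)
  have "(x - m) \<bullet> z = 0" if z: "z \<in> M" for z
  proof (cases "z = 0")
    case False
    \<comment> \<open>The minimizer in \<open>t\<close> of the squared norm of
      \<open>x - m - t z\<close>; any decrease there would contradict the minimality of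
      \<open>m\<close>.\<close>
    define t where "t = ((x - m) \<bullet> z) / (z \<bullet> z)"
    have "m + t *\<^sub>R z \<in> M"
      using M(1) mM z by (simp add: subspace_add subspace_scale)
    from dle[OF this] md have "(norm (x - m))\<^sup>2 \<le> (norm (x - (m + t *\<^sub>R z)))\<^sup>2" by linarith
    also have "\<dots> = (norm (x - m))\<^sup>2 - 2 * t * ((x - m) \<bullet> z) + t * (t * (z \<bullet> z))"
      unfolding power2_norm_eq_inner
      by (simp add: inner_diff_left inner_diff_right inner_add_left inner_add_right inner_commute algebra_simps)
    also have "t * (z \<bullet> z) = (x - m) \<bullet> z"
      using False by (simp add: t_def)
    finally have "t * ((x - m) \<bullet> z) \<le> 0" by simp
    then have "((x - m) \<bullet> z)\<^sup>2 / (z \<bullet> z) \<le> 0"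
      by (simp add: t_def power2_eq_square)
    then show ?thesis
      using False by (simp add: divide_le_0_iff) (metis inner_gt_zero_iff not_le)
  qed simp
  with mM show thesis by (rule that)
qed

text \<open>The kernel of a nonzero \<open>f\<close> is a closed hyperplane, and a vector orthogonal
  to it represents \<open>f\<close> after rescaling. This gives the existence of adjoints:
  \<open>adjoint\<close> is a choice and means something only once a suitable map exists.\<close>

lemma riesz_representation:
  fixes f :: "'a::{real_inner,banach} \<Rightarrow> real"
  assumes "bounded_linear f"
  obtains y where "\<And>x. f x = x \<bullet> y"
proof (cases "\<forall>x. f x = 0")
  case True
  then show thesis using that[of 0] by simp
next
  case False
  interpret bounded_linear f by fact
  obtain x where x: "f x \<noteq> 0" using False by blast
  have "subspace {x. f x = 0}"
    by (auto simp: subspace_def add scaleR)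
  moreover have "closed {x. f x = 0}"
    by (intro closed_Collect_eq continuous_on_const linear_continuous_on assms)
  ultimately obtain m where m: "f m = 0" "\<And>y. f y = 0 \<Longrightarrow> (x - m) \<bullet> y = 0"
    by (rule closed_subspace_projection[of "{x. f x = 0}" x]) auto
  define w where "w = x - m"
  have fw: "f w \<noteq> 0" using x m by (simp add: w_def diff)
  then have ww: "w \<bullet> w \<noteq> 0" using zero by auto
  have "f z = z \<bullet> ((f w / (w \<bullet> w)) *\<^sub>R w)" for z
  proof -
    have "f (z - (f z / f w) *\<^sub>R w) = 0" using fw by (simp add: diff scaleR)
    then have "w \<bullet> (z - (f z / f w) *\<^sub>R w) = 0" using m(2) by (simp add: w_def)
    then have "z \<bullet> w = (f z / f w) * (w \<bullet> w)" by (simp add: inner_diff_right inner_commute)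
    then show ?thesis using fw ww by simp
  qed
  then show thesis by (rule that)
qed

lemma subspace_closure:
  fixes S :: "'a::real_normed_vector set"
  assumes "subspace S"
  shows "subspace (closure S)"
proof (rule subspaceI)
  show "0 \<in> closure S"
    using subspace_0[OF assms] closure_subset by blast
next
  fix x y assume "x \<in> closure S" "y \<in> closure S"
  then obtain u v where "\<forall>n. u n \<in> S" "u \<longlonglongrightarrow> x" "\<forall>n. v n \<in> S" "v \<longlonglongrightarrow> y"
    unfolding closure_sequential by blast
  then show "x + y \<in> closure S"
    unfolding closure_sequential using subspace_add[OF assms]
    by (intro exI[of _ "\<lambda>n. u n + v n"]) (simp add: tendsto_add)
next
  fix c x assume "x \<in> closure S"
  then obtain u where "\<forall>n. u n \<in> S" "u \<longlonglongrightarrow> x"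
    unfolding closure_sequential by blast
  then show "c *\<^sub>R x \<in> closure S"
    unfolding closure_sequential using subspace_scale[OF assms]
    by (intro exI[of _ "\<lambda>n. c *\<^sub>R u n"]) (simp add: tendsto_scaleR)
qed

text \<open>A maximal orthonormal set exists by Zorn's lemma. If its span were not dense, the
  normalized component of some vector orthogonal to the closed span could be added to it.\<close>

lemma orthonormal_basis_exists:
  "\<exists>B::'a::{real_inner,banach} set. orthonormal_basis B"
proof -
  let ?A = "{B::'a set. pairwise orthogonal B \<and> (\<forall>e\<in>B. norm e = 1)}"
  have "\<exists>M\<in>?A. \<forall>X\<in>?A. M \<subseteq> X \<longrightarrow> X = M"
  proof (rule subset_Zorn_nonempty)
    show "?A \<noteq> {}" by (auto intro!: exI[of _ "{}"])
  next
    fix C assume C: "C \<noteq> {}" "subset.chain ?A C"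
    have "pairwise orthogonal (\<Union>C)"
      unfolding pairwise_def
    proof (intro ballI impI)
      fix x y assume "x \<in> \<Union>C" "y \<in> \<Union>C" "x \<noteq> y"
      then obtain X Y where XY: "X \<in> C" "Y \<in> C" "x \<in> X" "y \<in> Y" by auto
      then have "X \<subseteq> Y \<or> Y \<subseteq> X" using C(2) by (auto simp: subset_chain_def)
      moreover have "X \<in> ?A" "Y \<in> ?A" using C(2) XY by (auto simp: subset_chain_def)
      ultimately show "orthogonal x y" using XY \<open>x \<noteq> y\<close> by (auto simp: pairwise_def)
    qed
    moreover have "\<forall>e\<in>\<Union>C. norm e = 1" using C(2) by (auto simp: subset_chain_def)
    ultimately show "\<Union>C \<in> ?A" by simp
  qed
  then obtain B where BA: "B \<in> ?A" and maxA: "\<forall>X\<in>?A. B \<subseteq> X \<longrightarrow> X = B" by (rule bexE)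
  then have B: "pairwise orthogonal B" "\<forall>e\<in>B. norm e = 1" by simp_all
  have max: "X = B" if "pairwise orthogonal X" "\<forall>e\<in>X. norm e = 1" "B \<subseteq> X" for X
    using bspec[OF maxA, of X] that by simp
  have "closure (span B) = UNIV"
  proof (rule ccontr)
    assume "closure (span B) \<noteq> UNIV"
    then obtain x where x: "x \<notin> closure (span B)" by auto
    obtain m where m: "m \<in> closure (span B)" "\<And>y. y \<in> closure (span B) \<Longrightarrow> (x - m) \<bullet> y = 0"
      by (rule closed_subspace_projection[of "closure (span B)" x])
        (simp_all add: subspace_closure)
    define e where "e = (x - m) /\<^sub>R norm (x - m)"
    have xm: "x - m \<noteq> 0" using x m(1) by auto
    then have ne: "norm e = 1" by (simp add: e_def)
    have "e \<bullet> y = 0" if "y \<in> B" for y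
      using m(2)[of y] subsetD[OF closure_subset span_base[OF that]] by (simp add: e_def)
    then have orth: "pairwise orthogonal (insert e B)"
      using B(1) by (auto simp: pairwise_insert orthogonal_def inner_commute)
    have "e \<in> B" using max[OF orth] ne B(2) by auto
    then have "e \<bullet> e = 0" using \<open>\<And>y. y \<in> B \<Longrightarrow> e \<bullet> y = 0\<close> by blast
    then show False using ne by auto
  qed
  with B show ?thesis unfolding orthonormal_basis_def by blast
qed

lemma the_basis: "orthonormal_basis (the_basis :: 'a::{real_inner,banach} set)"
  unfolding the_basis_def by (rule someI_ex[OF orthonormal_basis_exists])

lemma the_basis_inner:
  "e \<in> the_basis \<Longrightarrow> f \<in> the_basis \<Longrightarrow> e \<bullet> f = (if e = f then 1 else 0)"
  using the_basis unfolding orthonormal_basis_def pairwise_def orthogonal_def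
  by (auto simp: dot_square_norm)

text \<open>Completing the square in the coefficients. With \<open>c e = x \<bullet> e\<close> the
  last sum vanishes, which is Bessel's inequality; for other \<open>c\<close> it shows that no
  combination approximates better.\<close>

lemma norm_diff_basis_combination:
  fixes x :: "'a::{real_inner,banach}"
  assumes "finite F" "F \<subseteq> the_basis"
  shows "(norm (x - (\<Sum>e\<in>F. c e *\<^sub>R e)))\<^sup>2 = (norm x)\<^sup>2 - (\<Sum>e\<in>F. (x \<bullet> e)\<^sup>2) + (\<Sum>e\<in>F. (c e - x \<bullet> e)\<^sup>2)"
proof -
  let ?y = "\<Sum>e\<in>F. c e *\<^sub>R e"
  have ye: "?y \<bullet> e = c e" if "e \<in> F" for e
  proof -
    have "?y \<bullet> e = (\<Sum>f\<in>F. if f = e then c f else 0)"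
      unfolding inner_sum_left
      by (rule sum.cong) (use assms that in \<open>auto simp: the_basis_inner subset_iff\<close>)
    then show ?thesis using assms that by simp
  qed
  have "(norm (x - ?y))\<^sup>2 = (norm x)\<^sup>2 - 2 * (x \<bullet> ?y) + ?y \<bullet> ?y"
    unfolding power2_norm_eq_inner by (simp add: inner_diff_left inner_diff_right inner_commute)
  also have "x \<bullet> ?y = (\<Sum>e\<in>F. c e * (x \<bullet> e))"
    by (simp add: inner_sum_right)
  also have "?y \<bullet> ?y = (\<Sum>e\<in>F. c e * c e)"
    by (subst inner_sum_right) (simp add: ye)
  finally show ?thesis
    by (simp add: power2_diff sum.distrib sum_subtractf sum_distrib_left power2_eq_square algebra_simps)
qed

lemma bessel_inequality:
  assumes "finite F" "F \<subseteq> the_basis"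
  shows "(\<Sum>e\<in>F. (x \<bullet> e)\<^sup>2) \<le> (norm (x::'a::{real_inner,banach}))\<^sup>2"
  using norm_diff_basis_combination[OF assms, of x "\<lambda>e. x \<bullet> e"]
    zero_le_power2[of "norm (x - (\<Sum>e\<in>F. (x \<bullet> e) *\<^sub>R e))"] by simp

text \<open>Bessel's inequality is one half. For the other, density provides a finite combination
  within \<open>sqrt \<epsilon>\<close> of \<open>x\<close>, and whatever its coefficients are, the
  defect in Bessel's inequality is then at most \<open>\<epsilon>\<close>.\<close>

lemma parseval:
  fixes x :: "'a::{real_inner,banach}"
  shows "((\<lambda>e. (x \<bullet> e)\<^sup>2) has_sum (norm x)\<^sup>2) the_basis"
proof -
  have sm: "(\<lambda>e. (x \<bullet> e)\<^sup>2) summable_on the_basis"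
    by (rule nonneg_bounded_partial_sums_imp_summable_on[where C="(norm x)\<^sup>2"])
      (auto intro!: eventually_finite_subsets_at_top_weakI bessel_inequality)
  have "(norm x)\<^sup>2 \<le> (\<Sum>\<^sub>\<infinity>e\<in>the_basis. (x \<bullet> e)\<^sup>2)"
  proof (rule field_le_epsilon)
    fix \<epsilon> :: real assume "\<epsilon> > 0"
    have "x \<in> closure (span the_basis)" using the_basis unfolding orthonormal_basis_def by blast
    then obtain y where y: "y \<in> span the_basis" "dist y x < sqrt \<epsilon>"
      using \<open>\<epsilon> > 0\<close> unfolding closure_approachable by (meson real_sqrt_gt_zero)
    then obtain F c where F: "finite F" "F \<subseteq> the_basis" "y = (\<Sum>e\<in>F. c e *\<^sub>R e)"
      unfolding span_explicit by auto
    have "(norm (x - y))\<^sup>2 < \<epsilon>"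
      using power_strict_mono[of "norm (x - y)" "sqrt \<epsilon>" 2] y(2) \<open>\<epsilon> > 0\<close>
      by (simp add: dist_norm norm_minus_commute)
    moreover have "(\<Sum>e\<in>F. (c e - x \<bullet> e)\<^sup>2) \<ge> 0" by (simp add: sum_nonneg)
    ultimately have "(norm x)\<^sup>2 \<le> (\<Sum>e\<in>F. (x \<bullet> e)\<^sup>2) + \<epsilon>"
      using norm_diff_basis_combination[OF F(1,2), of x c] F(3) by simp
    also have "(\<Sum>e\<in>F. (x \<bullet> e)\<^sup>2) \<le> (\<Sum>\<^sub>\<infinity>e\<in>the_basis. (x \<bullet> e)\<^sup>2)"
      by (rule finite_sum_le_infsum[OF sm F(1,2)]) simp
    finally show "(norm x)\<^sup>2 \<le> (\<Sum>\<^sub>\<infinity>e\<in>the_basis. (x \<bullet> e)\<^sup>2) + \<epsilon>" by simp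
  qed
  moreover have "(\<Sum>\<^sub>\<infinity>e\<in>the_basis. (x \<bullet> e)\<^sup>2) \<le> (norm x)\<^sup>2"
    by (rule infsum_le_finite_sums[OF sm]) (rule bessel_inequality)
  ultimately show ?thesis
    using has_sum_infsum[OF sm] by simp
qed

text \<open>Polarization of \<open>parseval\<close>.\<close>

lemma parseval_inner:
  fixes x y :: "'a::{real_inner,banach}"
  shows "((\<lambda>e. (x \<bullet> e) * (y \<bullet> e)) has_sum (x \<bullet> y)) the_basis"
proof -
  have "((\<lambda>e. (1/4) * (((x + y) \<bullet> e)\<^sup>2 + - ((x - y) \<bullet> e)\<^sup>2)) has_sum
      ((1/4) * ((norm (x + y))\<^sup>2 + - (norm (x - y))\<^sup>2))) the_basis"
    by (intro has_sum_cmult_right has_sum_add has_sum_uminusI parseval)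
  moreover have "(1/4) * ((norm (x + y))\<^sup>2 + - (norm (x - y))\<^sup>2) = x \<bullet> y"
    unfolding power2_norm_eq_inner by (simp add: inner_diff_left inner_diff_right inner_add_left inner_add_right inner_commute)
  moreover have "(1/4) * (((x + y) \<bullet> e)\<^sup>2 + - ((x - y) \<bullet> e)\<^sup>2) = (x \<bullet> e) * (y \<bullet> e)" for e
    by (simp add: inner_add_left inner_diff_left power2_eq_square algebra_simps)
  ultimately show ?thesis
    by (simp only:)
qed

text \<open>Riesz provides a map \<open>f\<close> with the adjoint identity, uniqueness identifies
  it with the chosen \<open>adjoint\<close>, and boundedness of \<open>f\<close> makes
  \<open>Blinfun\<close> faithful to it.\<close>

lemma blinfun_adjoint_inner_right:
  fixes a :: "'a::{real_inner,banach} \<Rightarrow>\<^sub>L 'a"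
  shows "x \<bullet> blinfun_adjoint a y = a x \<bullet> y"
proof -
  have "\<exists>z. \<forall>x. a x \<bullet> y = x \<bullet> z" for y
  proof -
    have "bounded_linear (\<lambda>x. a x \<bullet> y)"
      by (intro bounded_linear_intros)
    then show ?thesis using riesz_representation by metis
  qed
  then obtain f where f: "\<And>x y. a x \<bullet> y = x \<bullet> f y" by metis
  have adj: "adjoint a = f" by (rule adjoint_unique) (simp add: f)
  have eq: "u = v" if "\<And>x. x \<bullet> u = x \<bullet> v" for u v :: 'a
    using that vector_eq_ldot by blast
  have "bounded_linear f"
  proof (rule bounded_linear_intro[where K="norm a"])
    fix x y :: 'a and r :: real
    show "f (x + y) = f x + f y" by (rule eq) (simp add: inner_add_right flip: f)
    show "f (r *\<^sub>R x) = r *\<^sub>R f x" by (rule eq) (simp flip: f)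
    have "norm (f x) * norm (f x) = a (f x) \<bullet> x"
      by (simp add: f power2_norm_eq_inner flip: power2_eq_square)
    also have "\<dots> \<le> norm (a (f x)) * norm x" by (rule norm_cauchy_schwarz)
    also have "\<dots> \<le> norm (f x) * (norm x * norm a)"
      using mult_right_mono[OF norm_blinfun[of a "f x"] norm_ge_zero[of x]] by (simp add: mult_ac)
    finally show "norm (f x) \<le> norm x * norm a"
      by (cases "f x = 0") simp_all
  qed
  then have "blinfun_adjoint a y = f y" for y
    unfolding blinfun_adjoint_def adj by (simp add: bounded_linear_Blinfun_apply)
  then show ?thesis by (simp add: f)
qed

lemma blinfun_adjoint_inner_left:
  fixes a :: "'a::{real_inner,banach} \<Rightarrow>\<^sub>L 'a"
  shows "blinfun_adjoint a y \<bullet> x = y \<bullet> a x"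
  by (metis blinfun_adjoint_inner_right inner_commute)

lemma blinfun_adjoint_unique:
  fixes a b :: "'a::{real_inner,banach} \<Rightarrow>\<^sub>L 'a"
  assumes "\<And>x y. a x \<bullet> y = x \<bullet> b y"
  shows "blinfun_adjoint a = b"
  by (rule blinfun_eqI) (metis assms blinfun_adjoint_inner_right vector_eq_ldot)

lemma blinfun_adjoint_adjoint [simp]: "blinfun_adjoint (blinfun_adjoint a) = a"
  by (rule blinfun_adjoint_unique) (simp add: blinfun_adjoint_inner_left)

lemma norm_blinfun_adjoint_le: "norm (blinfun_adjoint a) \<le> norm a"
proof (rule norm_blinfun_bound)
  fix x
  let ?f = "blinfun_adjoint a x"
  have "norm ?f * norm ?f = a ?f \<bullet> x"
    by (simp add: power2_norm_eq_inner blinfun_adjoint_inner_right flip: power2_eq_square)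
  also have "\<dots> \<le> norm (a ?f) * norm x" by (rule norm_cauchy_schwarz)
  also have "\<dots> \<le> norm ?f * (norm a * norm x)"
    using mult_right_mono[OF norm_blinfun[of a "?f"] norm_ge_zero[of x]] by (simp add: mult_ac)
  finally show "norm ?f \<le> norm a * norm x"
    by (cases "?f = 0") simp_all
qed simp

section \<open>Hilbert-Schmidt operators\<close>

lemma inner_adjoint_compose:
  fixes a :: "'a::{real_inner,banach} \<Rightarrow>\<^sub>L 'a"
  shows "blinfun_apply (blinfun_adjoint a o\<^sub>L a) e \<bullet> e = (norm (a e))\<^sup>2"
  by (simp add: blinfun_adjoint_inner_left power2_norm_eq_inner)

lemma hilbert_schmidt_iff:
  "a \<in> hilbert_schmidt \<longleftrightarrow> (\<lambda>e. (norm (blinfun_apply a e))\<^sup>2) summable_on the_basis"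
  unfolding hilbert_schmidt_def inner_adjoint_compose by simp

lemma hs_norm_eq: "hs_norm a = sqrt (\<Sum>\<^sub>\<infinity>e\<in>the_basis. (norm (blinfun_apply a e))\<^sup>2)"
  unfolding hs_norm_def op_trace_def inner_adjoint_compose ..

lemma hs_norm_nonneg [simp]: "0 \<le> hs_norm a"
  unfolding hs_norm_eq by (simp add: infsum_nonneg)

lemma hs_norm_has_sum:
  assumes "a \<in> hilbert_schmidt"
  shows "((\<lambda>e. (norm (blinfun_apply a e))\<^sup>2) has_sum (hs_norm a)\<^sup>2) the_basis"
proof -
  have "(hs_norm a)\<^sup>2 = (\<Sum>\<^sub>\<infinity>e\<in>the_basis. (norm (blinfun_apply a e))\<^sup>2)"
    unfolding hs_norm_eq by (simp add: infsum_nonneg)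
  then show ?thesis
    using assms unfolding hilbert_schmidt_iff by simp
qed

lemma L2_set_le_hs_norm:
  assumes "a \<in> hilbert_schmidt" "finite F" "F \<subseteq> the_basis"
  shows "L2_set (\<lambda>e. norm (blinfun_apply a e)) F \<le> hs_norm a"
proof -
  have "(\<Sum>e\<in>F. (norm (blinfun_apply a e))\<^sup>2) \<le> (\<Sum>\<^sub>\<infinity>e\<in>the_basis. (norm (blinfun_apply a e))\<^sup>2)"
    by (rule finite_sum_le_infsum) (use assms in \<open>simp_all add: hilbert_schmidt_iff\<close>)
  then show ?thesis
    unfolding L2_set_def hs_norm_eq by simp
qed

text \<open>Membership and norm bounds are both read off finite subsets of the basis, where
  Minkowski's inequality for \<open>L2_set\<close> and limits of finite sums are available. The
  ideal property and completeness are proved in this form.\<close>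

lemma hilbert_schmidtI:
  assumes "\<And>F. finite F \<Longrightarrow> F \<subseteq> the_basis \<Longrightarrow> L2_set (\<lambda>e. norm (blinfun_apply a e)) F \<le> c"
  shows "a \<in> hilbert_schmidt" "hs_norm a \<le> c"
proof -
  have c: "0 \<le> c" using assms[of "{}"] by simp
  have le: "(\<Sum>e\<in>F. (norm (blinfun_apply a e))\<^sup>2) \<le> c\<^sup>2" if "finite F" "F \<subseteq> the_basis" for F
    using assms[OF that] c unfolding L2_set_def by (simp add: sqrt_le_D)
  show HS: "a \<in> hilbert_schmidt"
    unfolding hilbert_schmidt_iff
    by (rule nonneg_bounded_partial_sums_imp_summable_on[where C="c\<^sup>2"])
      (auto intro!: eventually_finite_subsets_at_top_weakI le)
  show "hs_norm a \<le> c"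
    unfolding hs_norm_eq
    by (rule real_le_lsqrt) (use c le HS in \<open>auto intro!: infsum_le_finite_sums infsum_nonneg simp: hilbert_schmidt_iff\<close>)
qed

lemma
  shows hilbert_schmidt_zero [simp]: "0 \<in> hilbert_schmidt"
    and hs_norm_zero [simp]: "hs_norm 0 = 0"
  by (simp_all add: hilbert_schmidt_iff hs_norm_eq)

lemma
  assumes "a \<in> hilbert_schmidt" "b \<in> hilbert_schmidt"
  shows hilbert_schmidt_add: "a + b \<in> hilbert_schmidt"
    and hs_norm_triangle: "hs_norm (a + b) \<le> hs_norm a + hs_norm b"
proof -
  have "L2_set (\<lambda>e. norm (blinfun_apply (a + b) e)) F \<le> hs_norm a + hs_norm b"
    if F: "finite F" "F \<subseteq> the_basis" for F
  proof -
    have "L2_set (\<lambda>e. norm (blinfun_apply (a + b) e)) F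
        \<le> L2_set (\<lambda>e. norm (blinfun_apply a e) + norm (blinfun_apply b e)) F"
      by (rule L2_set_mono) (simp_all add: blinfun.add_left norm_triangle_ineq)
    also have "\<dots> \<le> L2_set (\<lambda>e. norm (blinfun_apply a e)) F + L2_set (\<lambda>e. norm (blinfun_apply b e)) F"
      by (rule L2_set_triangle_ineq)
    also have "\<dots> \<le> hs_norm a + hs_norm b"
      by (intro add_mono L2_set_le_hs_norm assms F)
    finally show ?thesis .
  qed
  from hilbert_schmidtI[of "a + b", OF this]
  show "a + b \<in> hilbert_schmidt" "hs_norm (a + b) \<le> hs_norm a + hs_norm b" by auto
qed

lemma
  assumes "b \<in> hilbert_schmidt"
  shows hilbert_schmidt_compose_left: "a o\<^sub>L b \<in> hilbert_schmidt"
    and hs_norm_compose_left: "hs_norm (a o\<^sub>L b) \<le> norm a * hs_norm b"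
proof -
  have "L2_set (\<lambda>e. norm (blinfun_apply (a o\<^sub>L b) e)) F \<le> norm a * hs_norm b"
    if F: "finite F" "F \<subseteq> the_basis" for F
  proof -
    have "L2_set (\<lambda>e. norm (blinfun_apply (a o\<^sub>L b) e)) F
        \<le> L2_set (\<lambda>e. norm a * norm (blinfun_apply b e)) F"
      by (rule L2_set_mono) (simp_all add: norm_blinfun)
    also have "\<dots> = norm a * L2_set (\<lambda>e. norm (blinfun_apply b e)) F"
      by (simp add: L2_set_right_distrib)
    also have "\<dots> \<le> norm a * hs_norm b"
      by (intro mult_left_mono L2_set_le_hs_norm assms F) simp
    finally show ?thesis .
  qed
  from hilbert_schmidtI[of "a o\<^sub>L b", OF this]
  show "a o\<^sub>L b \<in> hilbert_schmidt" "hs_norm (a o\<^sub>L b) \<le> norm a * hs_norm b" by auto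
qed

lemma hs_norm_scaleR: "hs_norm (c *\<^sub>R a) = \<bar>c\<bar> * hs_norm a"
  by (simp add: hs_norm_eq blinfun.scaleR_left power_mult_distrib infsum_cmult_right' real_sqrt_mult)

lemma hilbert_schmidt_scaleR:
  assumes "a \<in> hilbert_schmidt" shows "c *\<^sub>R a \<in> hilbert_schmidt"
  using summable_on_cmult_right[of "\<lambda>e. (norm (blinfun_apply a e))\<^sup>2" the_basis "c\<^sup>2"] assms
  by (simp add: hilbert_schmidt_iff blinfun.scaleR_left power_mult_distrib)

lemma hilbert_schmidt_minus: "a \<in> hilbert_schmidt \<Longrightarrow> - a \<in> hilbert_schmidt"
  using hilbert_schmidt_scaleR[of a "-1"] by simp

lemma hilbert_schmidt_diff:
  "a \<in> hilbert_schmidt \<Longrightarrow> b \<in> hilbert_schmidt \<Longrightarrow> a - b \<in> hilbert_schmidt"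
  using hilbert_schmidt_add[of a "- b"] hilbert_schmidt_minus[of b] by simp

text \<open>Expand each \<open>blinfun_adjoint a f\<close> by Parseval and exchange the sums; as
  \<open>f\<close> runs over a finite set, no exchange of two infinite sums occurs. Bessel's
  inequality then bounds the sum over \<open>f\<close> by the squared norm of
  \<open>a e\<close>.\<close>

lemma
  assumes a: "a \<in> hilbert_schmidt"
  shows hilbert_schmidt_adjoint: "blinfun_adjoint a \<in> hilbert_schmidt"
    and hs_norm_adjoint_le: "hs_norm (blinfun_adjoint a) \<le> hs_norm a"
proof -
  let ?b = "blinfun_adjoint a"
  have "L2_set (\<lambda>e. norm (blinfun_apply ?b e)) F \<le> hs_norm a"
    if F: "finite F" "F \<subseteq> the_basis" for F
  proof -
    have "((\<lambda>e. \<Sum>f\<in>F. (?b f \<bullet> e)\<^sup>2) has_sum (\<Sum>f\<in>F. (norm (?b f))\<^sup>2)) the_basis"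
      using F(1) by (induction F) (auto intro!: has_sum_add parseval)
    moreover have "(\<Sum>f\<in>F. (?b f \<bullet> e)\<^sup>2) \<le> (norm (a e))\<^sup>2" for e
      using bessel_inequality[OF F, of "a e"] by (simp add: blinfun_adjoint_inner_left inner_commute[of "a e"])
    ultimately have "(\<Sum>f\<in>F. (norm (?b f))\<^sup>2) \<le> (hs_norm a)\<^sup>2"
      by (rule has_sum_mono[OF _ hs_norm_has_sum[OF a]])
    then show ?thesis
      unfolding L2_set_def by (rule real_le_lsqrt[rotated]) simp
  qed
  from hilbert_schmidtI[of ?b, OF this]
  show "?b \<in> hilbert_schmidt" "hs_norm ?b \<le> hs_norm a" by auto
qed

lemma hs_norm_adjoint:
  "a \<in> hilbert_schmidt \<Longrightarrow> hs_norm (blinfun_adjoint a) = hs_norm a"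
  using hs_norm_adjoint_le[of a] hs_norm_adjoint_le[of "blinfun_adjoint a"] hilbert_schmidt_adjoint[of a]
  by simp

lemma blinfun_adjoint_compose:
  fixes a b :: "'a::{real_inner,banach} \<Rightarrow>\<^sub>L 'a"
  shows "blinfun_adjoint (a o\<^sub>L b) = blinfun_adjoint b o\<^sub>L blinfun_adjoint a"
  by (rule blinfun_adjoint_unique) (simp add: blinfun_adjoint_inner_right)

text \<open>Obtained from the left ideal property by taking adjoints, since a factor on the right
  moves the basis vectors on which \<open>a\<close> is evaluated.\<close>

lemma
  assumes "a \<in> hilbert_schmidt"
  shows hilbert_schmidt_compose_right: "a o\<^sub>L b \<in> hilbert_schmidt"
    and hs_norm_compose_right: "hs_norm (a o\<^sub>L b) \<le> hs_norm a * norm b"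
proof -
  let ?c = "blinfun_adjoint b o\<^sub>L blinfun_adjoint a"
  have c: "?c \<in> hilbert_schmidt"
    by (intro hilbert_schmidt_compose_left hilbert_schmidt_adjoint assms)
  have eq: "a o\<^sub>L b = blinfun_adjoint ?c"
    by (simp add: blinfun_adjoint_compose)
  show "a o\<^sub>L b \<in> hilbert_schmidt"
    unfolding eq using c by (rule hilbert_schmidt_adjoint)
  have "hs_norm (a o\<^sub>L b) = hs_norm ?c"
    unfolding eq using c by (rule hs_norm_adjoint)
  also have "\<dots> \<le> norm (blinfun_adjoint b) * hs_norm (blinfun_adjoint a)"
    by (intro hs_norm_compose_left hilbert_schmidt_adjoint assms)
  also have "\<dots> \<le> norm b * hs_norm a"
    using norm_blinfun_adjoint_le[of b] by (simp add: hs_norm_adjoint assms mult_right_mono)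
  finally show "hs_norm (a o\<^sub>L b) \<le> hs_norm a * norm b" by (simp add: mult.commute)
qed

text \<open>By Parseval the squared norm of \<open>a x\<close> is the sum of the squares of
  \<open>x \<bullet> blinfun_adjoint a e\<close>; apply Cauchy-Schwarz to each term.\<close>

lemma norm_le_hs_norm:
  fixes a :: "'a::{real_inner,banach} \<Rightarrow>\<^sub>L 'a"
  assumes a: "a \<in> hilbert_schmidt"
  shows "norm a \<le> hs_norm a"
proof (rule norm_blinfun_bound)
  fix x :: 'a
  let ?b = "blinfun_adjoint a"
  have b: "?b \<in> hilbert_schmidt" using a by (rule hilbert_schmidt_adjoint)
  have "((\<lambda>e. (norm x)\<^sup>2 * (norm (?b e))\<^sup>2) has_sum ((norm x)\<^sup>2 * (hs_norm ?b)\<^sup>2)) the_basis"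
    by (intro has_sum_cmult_right hs_norm_has_sum b)
  moreover have "(a x \<bullet> e)\<^sup>2 \<le> (norm x)\<^sup>2 * (norm (?b e))\<^sup>2" for e
    using power_mono[OF Cauchy_Schwarz_ineq2[of x "?b e"], of 2]
    by (simp add: blinfun_adjoint_inner_right power_mult_distrib)
  ultimately have "(norm (a x))\<^sup>2 \<le> (norm x)\<^sup>2 * (hs_norm ?b)\<^sup>2"
    by (rule has_sum_mono[OF parseval])
  then have "(norm (a x))\<^sup>2 \<le> (hs_norm a * norm x)\<^sup>2"
    by (simp add: hs_norm_adjoint a power_mult_distrib mult.commute)
  then show "norm (a x) \<le> hs_norm a * norm x"
    by (rule power2_le_imp_le) simp
qed simp

text \<open>A separate type, because the bounded operators already carry the operator norm. It makes
  \<open>hs_norm\<close> the norm of a Banach space, with its vector derivatives, integrals and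
  Cauchy sequences.\<close>

typedef (overloaded) 'a hs = "hilbert_schmidt :: ('a::{real_inner,banach} \<Rightarrow>\<^sub>L 'a) set"
  morphisms hs_op Hs
  by (rule exI[of _ 0]) simp

setup_lifting type_definition_hs

instantiation hs :: ("{real_inner,banach}") real_vector
begin

lift_definition zero_hs :: "'a hs" is 0 by simp
lift_definition plus_hs :: "'a hs \<Rightarrow> 'a hs \<Rightarrow> 'a hs" is "(+)" by (rule hilbert_schmidt_add)
lift_definition minus_hs :: "'a hs \<Rightarrow> 'a hs \<Rightarrow> 'a hs" is "(-)" by (rule hilbert_schmidt_diff)
lift_definition uminus_hs :: "'a hs \<Rightarrow> 'a hs" is uminus by (rule hilbert_schmidt_minus)
lift_definition scaleR_hs :: "real \<Rightarrow> 'a hs \<Rightarrow> 'a hs" is scaleR by (rule hilbert_schmidt_scaleR)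

instance
  by standard (transfer, simp add: algebra_simps)+

end

instantiation hs :: ("{real_inner,banach}") real_normed_vector
begin

lift_definition norm_hs :: "'a hs \<Rightarrow> real" is hs_norm .
definition dist_hs :: "'a hs \<Rightarrow> 'a hs \<Rightarrow> real" where "dist_hs a b = norm (a - b)"
definition sgn_hs :: "'a hs \<Rightarrow> 'a hs" where "sgn_hs a = a /\<^sub>R norm a"
definition uniformity_hs :: "('a hs \<times> 'a hs) filter" where
  "uniformity_hs = (INF e\<in>{0 <..}. principal {(x, y). dist x y < e})"
definition open_hs :: "'a hs set \<Rightarrow> bool" where
  "open_hs S = (\<forall>x\<in>S. \<forall>\<^sub>F (x', y) in uniformity. x' = x \<longrightarrow> y \<in> S)"

instance
proof
  fix a b :: "'a hs" and r :: real
  show "norm a = 0 \<longleftrightarrow> a = 0"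
  proof transfer
    fix a :: "'a \<Rightarrow>\<^sub>L 'a" assume "a \<in> hilbert_schmidt"
    then show "hs_norm a = 0 \<longleftrightarrow> a = 0" using norm_le_hs_norm[of a] by auto
  qed
  show "norm (a + b) \<le> norm a + norm b" by transfer (rule hs_norm_triangle)
  show "norm (r *\<^sub>R a) = \<bar>r\<bar> * norm a" by transfer (rule hs_norm_scaleR)
qed (simp_all add: dist_hs_def sgn_hs_def uniformity_hs_def open_hs_def)

end

instance hs :: ("{real_inner,banach}") banach
proof
  fix X :: "nat \<Rightarrow> 'a hs" assume X: "Cauchy X"
  define Y where "Y n = hs_op (X n)" for n
  have Y: "Y n \<in> hilbert_schmidt" for n unfolding Y_def by (rule hs_op)
  have nX: "norm (X n - X m) = hs_norm (Y n - Y m)" for n m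
    unfolding Y_def by transfer simp
  have le: "norm (Y n - Y m) \<le> norm (X n - X m)" for n m
    unfolding nX by (intro norm_le_hs_norm hilbert_schmidt_diff Y)
  have "Cauchy Y"
    using X unfolding Cauchy_iff by (meson le le_less_trans)
  then obtain a where a: "Y \<longlonglongrightarrow> a" using convergent_eq_Cauchy by blast
  \<comment> \<open>The limit \<open>a\<close> is taken in the operator norm. The Hilbert-Schmidt
    bound survives because \<open>L2_set\<close> over a finite set of basis vectors is continuous in
    that norm.\<close>
  have *: "Y n - a \<in> hilbert_schmidt \<and> hs_norm (Y n - a) \<le> e"
    if e: "\<And>m. m \<ge> N \<Longrightarrow> norm (X n - X m) \<le> e" for n N e
  proof -
    have "L2_set (\<lambda>x. norm (blinfun_apply (Y n - a) x)) F \<le> e" if F: "finite F" "F \<subseteq> the_basis" for F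
    proof (rule LIMSEQ_le_const2)
      show "(\<lambda>m. L2_set (\<lambda>x. norm (blinfun_apply (Y n - Y m) x)) F)
          \<longlonglongrightarrow> L2_set (\<lambda>x. norm (blinfun_apply (Y n - a) x)) F"
        unfolding L2_set_def by (intro tendsto_intros a)
      show "\<exists>N. \<forall>m\<ge>N. L2_set (\<lambda>x. norm (blinfun_apply (Y n - Y m) x)) F \<le> e"
        using e L2_set_le_hs_norm[OF hilbert_schmidt_diff[OF Y Y] F] unfolding nX by (meson order_trans)
    qed
    from hilbert_schmidtI[of "Y n - a", OF this] show ?thesis by auto
  qed
  have ex: "\<exists>N. \<forall>n\<ge>N. Y n - a \<in> hilbert_schmidt \<and> hs_norm (Y n - a) \<le> e" if "e > 0" for e
  proof -
    obtain N where "\<forall>m\<ge>N. \<forall>n\<ge>N. norm (X m - X n) < e"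
      using X \<open>e > 0\<close> unfolding Cauchy_iff by blast
    then show ?thesis using *[of N] by (meson less_imp_le)
  qed
  have aHS: "a \<in> hilbert_schmidt"
  proof -
    obtain n where "Y n - a \<in> hilbert_schmidt" using ex[of 1] by auto
    from hilbert_schmidt_diff[OF Y[of n] this] show ?thesis by simp
  qed
  have "X \<longlonglongrightarrow> Hs a"
  proof (rule LIMSEQ_I)
    fix r :: real assume "r > 0"
    then obtain N where "\<forall>n\<ge>N. hs_norm (Y n - a) \<le> r / 2" using ex[of "r/2"] by auto
    moreover have "norm (X n - Hs a) = hs_norm (Y n - a)" for n
      unfolding Y_def norm_hs.rep_eq minus_hs.rep_eq by (simp add: Hs_inverse aHS)
    ultimately show "\<exists>no. \<forall>n\<ge>no. norm (X n - Hs a) < r"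
      using \<open>r > 0\<close> by (intro exI[of _ N]) force
  qed
  then show "convergent X" by (rule convergentI)
qed

lemma norm_Hs: "a \<in> hilbert_schmidt \<Longrightarrow> norm (Hs a) = hs_norm a"
  by (simp add: norm_hs.rep_eq Hs_inverse)

lemma Hs_diff:
  "a \<in> hilbert_schmidt \<Longrightarrow> b \<in> hilbert_schmidt \<Longrightarrow> Hs a - Hs b = Hs (a - b)"
  by (simp add: minus_hs.abs_eq eq_onp_def)

lemma Hs_scaleR: "a \<in> hilbert_schmidt \<Longrightarrow> c *\<^sub>R Hs a = Hs (c *\<^sub>R a)"
  by (simp add: scaleR_hs.abs_eq eq_onp_def)

lemma bounded_linear_hs_op: "bounded_linear hs_op"
  by (rule bounded_linear_intro[where K=1])
    (simp_all add: plus_hs.rep_eq scaleR_hs.rep_eq norm_hs.rep_eq norm_le_hs_norm hs_op)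

section \<open>Differentiation in the Hilbert-Schmidt norm\<close>

lemma has_vector_derivative_iff_quotient:
  fixes f :: "real \<Rightarrow> 'b::real_normed_vector"
  shows "(f has_vector_derivative f') (at t within S) \<longleftrightarrow>
    ((\<lambda>s. norm ((f s - f t) /\<^sub>R (s - t) - f')) \<longlongrightarrow> 0) (at t within S)"
proof -
  have "norm (f s - f t - (s - t) *\<^sub>R f') / norm (s - t) = norm ((f s - f t) /\<^sub>R (s - t) - f')"
    if "s \<noteq> t" for s
  proof -
    have "f s - f t - (s - t) *\<^sub>R f' = (s - t) *\<^sub>R ((f s - f t) /\<^sub>R (s - t) - f')"
      using that by (simp add: scaleR_diff_right)
    then show ?thesis using that by simp
  qed
  then show ?thesis
    unfolding has_vector_derivative_def has_derivative_iff_norm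
    by (simp add: bounded_linear_scaleR_left)
      (rule tendsto_cong, simp add: eventually_at_filter)
qed

text \<open>A curve in the group is not itself Hilbert-Schmidt, only its difference from a constant
  is. The constant \<open>c\<close> is the identity for such curves and \<open>0\<close> for their
  derivatives.\<close>

lemma has_hs_derivative_iff:
  assumes c: "\<And>s. s \<in> S \<Longrightarrow> \<alpha> s - c \<in> hilbert_schmidt" and "t \<in> S"
  shows "has_hs_derivative \<alpha> v t S \<longleftrightarrow> v \<in> hilbert_schmidt \<and>
    ((\<lambda>s. Hs (\<alpha> s - c)) has_vector_derivative Hs v) (at t within S)"
proof -
  have d: "\<alpha> s - \<alpha> t \<in> hilbert_schmidt" if "s \<in> S" for s
    using hilbert_schmidt_diff[OF c[OF that] c[OF \<open>t \<in> S\<close>]] by simp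
  have "norm ((Hs (\<alpha> s - c) - Hs (\<alpha> t - c)) /\<^sub>R (s - t) - Hs v) = hs_norm ((\<alpha> s - \<alpha> t) /\<^sub>R (s - t) - v)"
    if "s \<in> S" "v \<in> hilbert_schmidt" for s
  proof -
    have q: "(\<alpha> s - \<alpha> t) /\<^sub>R (s - t) \<in> hilbert_schmidt"
      by (intro hilbert_schmidt_scaleR d that)
    have "(Hs (\<alpha> s - c) - Hs (\<alpha> t - c)) /\<^sub>R (s - t) - Hs v = Hs ((\<alpha> s - \<alpha> t) /\<^sub>R (s - t) - v)"
      using d[OF that(1)] q that(2) by (simp add: Hs_diff[OF c[OF that(1)] c[OF \<open>t \<in> S\<close>]] Hs_scaleR Hs_diff)
    then show ?thesis by (simp add: norm_Hs hilbert_schmidt_diff q that)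
  qed
  then have "((\<lambda>s. norm ((Hs (\<alpha> s - c) - Hs (\<alpha> t - c)) /\<^sub>R (s - t) - Hs v)) \<longlongrightarrow> 0) (at t within S)
     \<longleftrightarrow> ((\<lambda>s. hs_norm ((\<alpha> s - \<alpha> t) /\<^sub>R (s - t) - v)) \<longlongrightarrow> 0) (at t within S)"
    if "v \<in> hilbert_schmidt"
    using that by (intro tendsto_cong) (simp add: eventually_at_filter)
  then show ?thesis
    unfolding has_hs_derivative_def has_vector_derivative_iff_quotient using d by blast
qed

section \<open>Coercive operators and the symplectic group\<close>

lemma blinfun_inverseI:
  fixes g h :: "'a::real_normed_vector \<Rightarrow>\<^sub>L 'a"
  assumes "g o\<^sub>L h = id_blinfun" "h o\<^sub>L g = id_blinfun"
  shows "blinfun_inverse g = h"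
  unfolding blinfun_inverse_def
proof (rule the_equality)
  fix k :: "'a \<Rightarrow>\<^sub>L 'a" assume k: "g o\<^sub>L k = id_blinfun \<and> k o\<^sub>L g = id_blinfun"
  show "k = h"
  proof (rule blinfun_eqI)
    fix x
    have "k (g (h x)) = h x"
      using arg_cong[OF k[THEN conjunct2], of "\<lambda>f. blinfun_apply f (h x)"] by simp
    moreover have "g (h x) = x"
      using arg_cong[OF assms(1), of "\<lambda>f. blinfun_apply f x"] by simp
    ultimately show "k x = h x" by simp
  qed
qed (use assms in simp)

lemma blinfun_inverse:
  assumes "blinfun_invertible g"
  shows "g o\<^sub>L blinfun_inverse g = id_blinfun" "blinfun_inverse g o\<^sub>L g = id_blinfun"
proof -
  obtain h where h: "g o\<^sub>L h = id_blinfun" "h o\<^sub>L g = id_blinfun"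
    using assms unfolding blinfun_invertible_def by blast
  then show "g o\<^sub>L blinfun_inverse g = id_blinfun" "blinfun_inverse g o\<^sub>L g = id_blinfun"
    by (simp_all add: blinfun_inverseI)
qed

lemma blinfun_inverse_apply:
  fixes g :: "'a::real_normed_vector \<Rightarrow>\<^sub>L 'a"
  assumes "blinfun_invertible g"
  shows "g (blinfun_inverse g x) = x" "blinfun_inverse g (g x) = x"
  using blinfun_inverse[OF assms, THEN arg_cong[where f="\<lambda>f. blinfun_apply f x"]] by simp_all

lemma blinfun_invertibleI:
  fixes g h :: "'a::real_normed_vector \<Rightarrow>\<^sub>L 'a"
  assumes "\<And>x. g (blinfun_apply h x) = x" "\<And>x. h (blinfun_apply g x) = x"
  shows "blinfun_invertible g" "blinfun_inverse g = h"
proof -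
  have "g o\<^sub>L h = id_blinfun" "h o\<^sub>L g = id_blinfun"
    by (auto intro!: blinfun_eqI simp: assms)
  then show "blinfun_invertible g" "blinfun_inverse g = h"
    using blinfun_inverseI unfolding blinfun_invertible_def by auto
qed

text \<open>For small \<open>r > 0\<close> the map \<open>x \<mapsto> x - r (b x - y)\<close> is a contraction,
  and its fixed point solves \<open>b x = y\<close>.\<close>

lemma
  fixes b :: "'a::{real_inner,banach} \<Rightarrow>\<^sub>L 'a"
  assumes c: "c > 0" and co: "\<And>x. c * (norm x)\<^sup>2 \<le> b x \<bullet> x"
  shows coercive_invertible: "blinfun_invertible b"
    and norm_coercive_inverse: "norm (blinfun_inverse b) \<le> 1 / c"
proof -
  \<comment> \<open>Expanding the squared norm of \<open>u - r b u\<close> gives the factor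
    \<open>1 - 2 r c + r^2 K^2\<close>, which \<open>r = c / K^2\<close> minimizes. The choice
    \<open>K > c\<close> keeps the minimum \<open>1 - c^2 / K^2\<close> strictly between 0 and
    1.\<close>
  define K where "K = norm b + c + 1"
  define r where "r = c / K\<^sup>2"
  have K: "K > 0" "c < K" "norm b \<le> K" using c by (auto simp: K_def add_nonneg_pos)
  define q where "q = sqrt (1 - c\<^sup>2 / K\<^sup>2)"
  have cK: "c\<^sup>2 / K\<^sup>2 < 1" using c K by (simp add: power_strict_mono)
  have q: "0 \<le> q" "q < 1" using cK c K by (auto simp: q_def)
  have contr: "norm (u - r *\<^sub>R b u) \<le> q * norm u" for u
  proof -
    have "(norm (u - r *\<^sub>R b u))\<^sup>2 = (norm u)\<^sup>2 - 2 * r * (b u \<bullet> u) + r\<^sup>2 * (norm (b u))\<^sup>2"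
      unfolding power2_norm_eq_inner
      by (simp add: inner_diff_left inner_diff_right inner_commute power2_eq_square algebra_simps)
    also have "\<dots> \<le> (norm u)\<^sup>2 - 2 * r * (c * (norm u)\<^sup>2) + r\<^sup>2 * (K * norm u)\<^sup>2"
    proof -
      have "norm (b u) \<le> K * norm u"
        using norm_blinfun[of b u] mult_right_mono[OF K(3) norm_ge_zero[of u]] by linarith
      then have "r\<^sup>2 * (norm (b u))\<^sup>2 \<le> r\<^sup>2 * (K * norm u)\<^sup>2"
        by (intro mult_left_mono power_mono) simp_all
      moreover have "2 * r * (c * (norm u)\<^sup>2) \<le> 2 * r * (b u \<bullet> u)"
        using c K by (intro mult_left_mono co) (simp add: r_def)
      ultimately show ?thesis by linarith
    qed
    also have "\<dots> = (1 - c\<^sup>2 / K\<^sup>2) * (norm u)\<^sup>2"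
      using K(1) by (simp add: r_def field_simps power2_eq_square)
    also have "\<dots> = (q * norm u)\<^sup>2"
      using cK by (simp add: q_def power_mult_distrib)
    finally show ?thesis
      by (rule power2_le_imp_le) (use q in simp)
  qed
  have surj: "\<exists>x. b x = y" for y
  proof -
    have "\<exists>!x. x - r *\<^sub>R (b x - y) = x"
    proof (rule banach_fix_type[OF q], intro allI)
      fix x z
      have "dist (x - r *\<^sub>R (b x - y)) (z - r *\<^sub>R (b z - y)) = norm ((x - z) - r *\<^sub>R b (x - z))"
        by (simp add: dist_norm blinfun.diff_right algebra_simps)
      also have "\<dots> \<le> q * dist x z"
        unfolding dist_norm by (rule contr)
      finally show "dist (x - r *\<^sub>R (b x - y)) (z - r *\<^sub>R (b z - y)) \<le> q * dist x z" .
    qed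
    then obtain x where "x - r *\<^sub>R (b x - y) = x" by blast
    then have "r *\<^sub>R (b x - y) = 0" by (simp add: diff_eq_eq)
    then show ?thesis using c K by (auto simp: r_def)
  qed
  have below: "c * norm x \<le> norm (b x)" for x
  proof (cases "x = 0")
    case False
    have "c * (norm x)\<^sup>2 \<le> norm (b x) * norm x"
      using co[of x] norm_cauchy_schwarz[of "b x" x] by linarith
    then show ?thesis using False by (simp add: power2_eq_square)
  qed simp
  have inj: "x = z" if "b x = b z" for x z
    using below[of "x - z"] that c by (simp add: blinfun.diff_right mult_le_0_iff)
  obtain f where f: "\<And>y. b (f y) = y" using surj by metis
  have fle: "norm (f y) \<le> norm y * (1 / c)" for y
    using below[of "f y"] c by (simp add: f field_simps)
  have "bounded_linear f"
    by (rule bounded_linear_intro[where K="1/c"])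
      (rule inj, simp add: f blinfun.add_right blinfun.scaleR_right | rule fle)+
  then have Bf: "blinfun_apply (Blinfun f) = f" by (rule bounded_linear_Blinfun_apply)
  have fb: "f (b x) = x" for x by (rule inj) (simp add: f)
  show "blinfun_invertible b"
    by (rule blinfun_invertibleI[of _ "Blinfun f"]) (simp_all add: Bf f fb)
  have "blinfun_inverse b = Blinfun f"
    by (rule blinfun_invertibleI) (simp_all add: Bf f fb)
  moreover have "norm (Blinfun f) \<le> 1 / c"
    by (rule norm_blinfun_bound) (use c fle in \<open>simp_all add: Bf mult.commute\<close>)
  ultimately show "norm (blinfun_inverse b) \<le> 1 / c" by simp
qed

lemma inner_eqI: "(\<And>z. x \<bullet> z = y \<bullet> z) \<Longrightarrow> x = y"
  by (metis vector_eq_rdot)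

lemma inner_ge_half_if_close_to_id:
  fixes g :: "'a::{real_inner,banach} \<Rightarrow>\<^sub>L 'a"
  assumes n: "norm (g - id_blinfun) \<le> 1/2"
  shows "(1/2) * (norm v)\<^sup>2 \<le> g v \<bullet> v"
proof -
  have "\<bar>(g - id_blinfun) v \<bullet> v\<bar> \<le> norm ((g - id_blinfun) v) * norm v"
    by (rule Cauchy_Schwarz_ineq2)
  also have "\<dots> \<le> (1/2 * norm v) * norm v"
    using norm_blinfun[of "g - id_blinfun" v] mult_right_mono[OF n norm_ge_zero[of v]]
    by (intro mult_right_mono) (linarith | simp)+
  finally have "- (norm v)\<^sup>2 / 2 \<le> (g - id_blinfun) v \<bullet> v" by (simp add: power2_eq_square abs_le_iff)
  moreover have "g v \<bullet> v = (g - id_blinfun) v \<bullet> v + (norm v)\<^sup>2"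
    by (simp add: blinfun.diff_left inner_diff_left power2_norm_eq_inner)
  ultimately show ?thesis by simp
qed

section \<open>The symplectic group of a complex structure\<close>

locale complex_hilbert_space =
  fixes J :: "'a::{real_inner,banach} \<Rightarrow>\<^sub>L 'a"
  assumes complex_structure: "complex_structure J"
begin

lemma J_J [simp]: "J (J x) = - x"
proof -
  have "J o\<^sub>L J = - id_blinfun" using complex_structure by (simp add: complex_structure_def)
  from arg_cong[OF this, of "\<lambda>f. blinfun_apply f x"] show ?thesis by (simp add: blinfun.minus_left)
qed

lemma norm_J [simp]: "norm (J x) = norm x"
  using complex_structure by (simp add: complex_structure_def)

lemma adjoint_J: "blinfun_adjoint J = - J"
  using complex_structure by (simp add: complex_structure_def)

lemma inner_J_left: "J x \<bullet> y = - (x \<bullet> J y)"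
  using blinfun_adjoint_inner_right[of x J y] by (simp add: adjoint_J blinfun.minus_left)

lemma inner_J_J [simp]: "J x \<bullet> J y = x \<bullet> y"
  by (simp add: inner_J_left)

lemma inner_J_self [simp]: "J x \<bullet> x = 0" "x \<bullet> J x = 0"
  using inner_J_left[of x x] by (simp_all add: inner_commute)

text \<open>The operator identity is the invariance of the skew form \<open>J x \<bullet> y\<close>,
  which can be checked pointwise and passes to limits.\<close>

lemma Sp_iff:
  "g \<in> Sp J \<longleftrightarrow> blinfun_invertible g \<and> (\<forall>x y. J (g x) \<bullet> g y = J x \<bullet> y)"
proof -
  have "blinfun_adjoint g o\<^sub>L J o\<^sub>L g = J \<longleftrightarrow> (\<forall>x y. J (g x) \<bullet> g y = J x \<bullet> y)" (is "?l \<longleftrightarrow> ?r")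
  proof
    assume eq: ?l
    show ?r
    proof (intro allI)
      fix x y
      have "blinfun_adjoint g (J (g x)) = J x"
        using arg_cong[OF eq, of "\<lambda>f. blinfun_apply f x"] by simp
      then show "J (g x) \<bullet> g y = J x \<bullet> y" by (metis blinfun_adjoint_inner_left)
    qed
  next
    assume ?r
    then show ?l
      by (intro blinfun_eqI) (rule inner_eqI, simp add: blinfun_adjoint_inner_left)
  qed
  then show ?thesis unfolding Sp_def by simp
qed

text \<open>Invariance of the form only makes
  \<open>- (J o\<^sub>L blinfun_adjoint g o\<^sub>L J)\<close> a left inverse; in infinite
  dimensions surjectivity has to come from elsewhere. A right inverse \<open>k\<close> supplies it,
  and then coincides with that left inverse.\<close>

lemma
  fixes g k :: "'a \<Rightarrow>\<^sub>L 'a"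
  assumes sym: "\<And>x y. J (g x) \<bullet> g y = J x \<bullet> y" and right: "\<And>x. g (blinfun_apply k x) = x"
  shows Sp_I: "g \<in> Sp J"
    and Sp_inverse_eq: "blinfun_inverse g = - (J o\<^sub>L blinfun_adjoint g o\<^sub>L J)"
proof -
  let ?h = "- (J o\<^sub>L blinfun_adjoint g o\<^sub>L J)"
  have "blinfun_adjoint g (J (g x)) = J x" for x
    by (rule inner_eqI) (simp add: blinfun_adjoint_inner_left sym)
  then have hg: "?h (g x) = x" for x
    by (simp add: blinfun.minus_left)
  have "?h x = k x" for x
    using hg[of "k x"] by (simp add: right)
  then have gh: "g (?h x) = x" for x
    using right[of x] by simp
  show "blinfun_inverse g = ?h" by (rule blinfun_invertibleI[OF gh hg])
  have "blinfun_invertible g" by (rule blinfun_invertibleI[OF gh hg])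
  then show "g \<in> Sp J" unfolding Sp_iff using sym by simp
qed

lemma Sp_D:
  fixes g :: "'a \<Rightarrow>\<^sub>L 'a"
  assumes "g \<in> Sp J"
  shows "blinfun_invertible g" "J (g x) \<bullet> g y = J x \<bullet> y"
  using assms unfolding Sp_iff by auto

lemma Sp_inverse:
  assumes "g \<in> Sp J"
  shows "blinfun_inverse g = - (J o\<^sub>L blinfun_adjoint g o\<^sub>L J)"
  using Sp_inverse_eq[of g "blinfun_inverse g"] Sp_D[OF assms] blinfun_inverse_apply by blast

lemma Sp_inverse_apply [simp]:
  assumes "g \<in> Sp J"
  shows "g (blinfun_inverse g x) = x" "blinfun_inverse g (g x) = x"
  using blinfun_inverse_apply Sp_D(1)[OF assms] by auto

text \<open>The formula for the inverse consists of the adjoint and two isometries. A bound on the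
  elements of a curve is thus also a bound on their inverses.\<close>

lemma norm_Sp_inverse_le:
  assumes "g \<in> Sp J"
  shows "norm (blinfun_inverse g) \<le> norm g"
proof (rule norm_blinfun_bound)
  fix x :: 'a
  have "norm (blinfun_inverse g x) = norm (blinfun_adjoint g (J x))"
    by (simp add: Sp_inverse[OF assms] blinfun.minus_left)
  also have "\<dots> \<le> norm (blinfun_adjoint g) * norm x"
    using norm_blinfun[of "blinfun_adjoint g" "J x"] by simp
  also have "\<dots> \<le> norm g * norm x"
    by (intro mult_right_mono norm_blinfun_adjoint_le) simp
  finally show "norm (blinfun_inverse g x) \<le> norm g * norm x" .
qed simp

lemma Sp_compose:
  assumes "g \<in> Sp J" "h \<in> Sp J"
  shows "g o\<^sub>L h \<in> Sp J"
  by (rule Sp_I[where k="blinfun_inverse h o\<^sub>L blinfun_inverse g"])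
    (simp_all add: assms Sp_D(2))

lemma inverse_compose:
  assumes "g \<in> Sp J" "h \<in> Sp J"
  shows "blinfun_inverse (g o\<^sub>L h) = blinfun_inverse h o\<^sub>L blinfun_inverse g"
  by (rule blinfun_invertibleI) (simp_all add: assms)

lemma Sp_inverse_closed:
  assumes "g \<in> Sp J"
  shows "blinfun_inverse g \<in> Sp J"
proof (rule Sp_I[where k=g])
  fix x y
  show "J (blinfun_inverse g x) \<bullet> blinfun_inverse g y = J x \<bullet> y"
    using Sp_D(2)[OF assms, of "blinfun_inverse g x" "blinfun_inverse g y"] by (simp add: assms)
qed (simp add: assms)

lemma Sp2_D:
  assumes "g \<in> Sp2 J"
  shows "g \<in> Sp J" "g - id_blinfun \<in> hilbert_schmidt"
  using assms unfolding Sp2_def by auto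

lemma Sp2_I: "g \<in> Sp J \<Longrightarrow> g - id_blinfun \<in> hilbert_schmidt \<Longrightarrow> g \<in> Sp2 J"
  unfolding Sp2_def by simp

lemma Sp2_compose:
  assumes "g \<in> Sp2 J" "h \<in> Sp2 J"
  shows "g o\<^sub>L h \<in> Sp2 J"
proof (rule Sp2_I)
  have "(g o\<^sub>L h) - id_blinfun = ((g - id_blinfun) o\<^sub>L h) + (h - id_blinfun)"
    by (rule blinfun_eqI) (simp add: blinfun.bilinear_simps)
  then show "(g o\<^sub>L h) - id_blinfun \<in> hilbert_schmidt"
    using assms by (simp only: Sp2_D hilbert_schmidt_add hilbert_schmidt_compose_right)
qed (use assms in \<open>simp add: Sp_compose Sp2_D\<close>)

lemma Sp2_inverse_closed:
  assumes "g \<in> Sp2 J"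
  shows "blinfun_inverse g \<in> Sp2 J"
proof (rule Sp2_I)
  have "blinfun_inverse g - id_blinfun = - (blinfun_inverse g o\<^sub>L (g - id_blinfun))"
    by (rule blinfun_eqI) (simp add: blinfun.bilinear_simps Sp2_D(1)[OF assms])
  then show "blinfun_inverse g - id_blinfun \<in> hilbert_schmidt"
    using assms by (simp only: Sp2_D hilbert_schmidt_compose_left hilbert_schmidt_minus)
qed (use assms in \<open>simp add: Sp_inverse_closed Sp2_D\<close>)

end

section \<open>Piecewise smooth curves\<close>

text \<open>The subdivision in inductive form, on arbitrary intervals, so that gluing, rescaling and
  reversal go by induction without renumbering the break points.\<close>

inductive piecewise_hs_smooth_on ::
  "(real \<Rightarrow> ('a::{real_inner,banach} \<Rightarrow>\<^sub>L 'a)) \<Rightarrow> real \<Rightarrow> real \<Rightarrow> bool" for \<alpha> where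
  piece: "a < b \<Longrightarrow> hs_smooth_on \<alpha> {a..b} \<Longrightarrow> piecewise_hs_smooth_on \<alpha> a b"
| add_piece: "piecewise_hs_smooth_on \<alpha> a b \<Longrightarrow> b < c \<Longrightarrow> hs_smooth_on \<alpha> {b..c} \<Longrightarrow>
    piecewise_hs_smooth_on \<alpha> a c"

lemma piecewise_hs_smooth_on_less: "piecewise_hs_smooth_on \<alpha> a b \<Longrightarrow> a < b"
  by (induction rule: piecewise_hs_smooth_on.induct) auto

lemma piecewise_hs_smooth_on_join:
  assumes "piecewise_hs_smooth_on \<alpha> b c" "piecewise_hs_smooth_on \<alpha> a b"
  shows "piecewise_hs_smooth_on \<alpha> a c"
  using assms by (induction rule: piecewise_hs_smooth_on.induct) (auto intro: add_piece)

lemma piecewise_hs_smooth_iff: "piecewise_hs_smooth \<alpha> \<longleftrightarrow> piecewise_hs_smooth_on \<alpha> 0 1"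
proof
  assume "piecewise_hs_smooth \<alpha>"
  then obtain n :: nat and \<tau> where \<tau>: "\<tau> 0 = 0" "\<tau> n = 1"
    "\<And>i. i < n \<Longrightarrow> \<tau> i < \<tau> (Suc i) \<and> hs_smooth_on \<alpha> {\<tau> i..\<tau> (Suc i)}"
    unfolding piecewise_hs_smooth_def by blast
  have "k < n \<Longrightarrow> piecewise_hs_smooth_on \<alpha> (\<tau> 0) (\<tau> (Suc k))" for k
  proof (induction k)
    case 0 then show ?case using \<tau>(3)[of 0] by (auto intro: piece)
  next
    case (Suc k) then show ?case using \<tau>(3)[of "Suc k"] by (auto intro: add_piece)
  qed
  moreover have "n \<noteq> 0" using \<tau>(1,2) by (cases "n = 0") auto
  ultimately show "piecewise_hs_smooth_on \<alpha> 0 1"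
    using \<tau>(1,2) by (metis Suc_pred' lessI neq0_conv)
next
  have "\<exists>(n::nat) \<tau>. \<tau> 0 = a \<and> \<tau> n = b \<and>
      (\<forall>i<n. \<tau> i < \<tau> (Suc i) \<and> hs_smooth_on \<alpha> {\<tau> i..\<tau> (Suc i)})"
    if "piecewise_hs_smooth_on \<alpha> a b" for a b
    using that
  proof (induction rule: piecewise_hs_smooth_on.induct)
    case (piece a b)
    then show ?case
      by (intro exI[of _ "Suc 0"] exI[of _ "\<lambda>i. if i = 0 then a else b"]) simp
  next
    case (add_piece a b c)
    then obtain n :: nat and \<tau> where \<tau>: "\<tau> 0 = a" "\<tau> n = b"
      "\<And>i. i < n \<Longrightarrow> \<tau> i < \<tau> (Suc i) \<and> hs_smooth_on \<alpha> {\<tau> i..\<tau> (Suc i)}"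
      by blast
    then show ?case
      using add_piece
      by (intro exI[of _ "Suc n"] exI[of _ "\<tau>(Suc n := c)"]) (auto simp: less_Suc_eq)
  qed
  moreover assume "piecewise_hs_smooth_on \<alpha> 0 1"
  ultimately show "piecewise_hs_smooth \<alpha>" unfolding piecewise_hs_smooth_def by blast
qed

lemma hs_smooth_on_cong:
  "hs_smooth_on \<alpha> S \<Longrightarrow> (\<And>t. t \<in> S \<Longrightarrow> \<beta> t = \<alpha> t) \<Longrightarrow> hs_smooth_on \<beta> S"
  unfolding hs_smooth_on_def by metis

lemma piecewise_hs_smooth_on_cong:
  assumes "piecewise_hs_smooth_on \<alpha> a b" "\<And>t. t \<in> {a..b} \<Longrightarrow> \<beta> t = \<alpha> t"
  shows "piecewise_hs_smooth_on \<beta> a b"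
  using assms
proof (induction rule: piecewise_hs_smooth_on.induct)
  case (piece a b)
  show ?case
    by (rule piecewise_hs_smooth_on.piece[OF piece(1)])
      (rule hs_smooth_on_cong[OF piece(2)], rule piece(3))
next
  case (add_piece a b c)
  show ?case
  proof (rule piecewise_hs_smooth_on.add_piece)
    show "piecewise_hs_smooth_on \<beta> a b"
      using add_piece by simp
    show "hs_smooth_on \<beta> {b..c}"
      using add_piece piecewise_hs_smooth_on_less[OF add_piece(1)] by (auto intro: hs_smooth_on_cong)
  qed fact
qed

lemma has_hs_derivative_affine:
  assumes d: "has_hs_derivative \<alpha> v (m * t + c) S" and m: "m \<noteq> 0"
    and S': "\<And>s. s \<in> S' \<Longrightarrow> m * s + c \<in> S"
  shows "has_hs_derivative (\<lambda>s. \<alpha> (m * s + c)) (m *\<^sub>R v) t S'"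
proof -
  let ?l = "\<lambda>s. m * s + c"
  have lim: "((\<lambda>s. hs_norm ((\<alpha> s - \<alpha> (?l t)) /\<^sub>R (s - ?l t) - v)) \<longlongrightarrow> 0) (at (?l t) within S)"
    using d unfolding has_hs_derivative_def by blast
  have "filterlim ?l (at (?l t) within S) (at t within S')"
    unfolding filterlim_at using S' m
    by (auto simp: eventually_at_filter intro!: tendsto_eq_intros)
  from tendsto_mult_right_zero[OF filterlim_compose[OF lim this], of "\<bar>m\<bar>"]
  have "((\<lambda>s. hs_norm (m *\<^sub>R ((\<alpha> (?l s) - \<alpha> (?l t)) /\<^sub>R (?l s - ?l t) - v))) \<longlongrightarrow> 0) (at t within S')"
    by (simp add: hs_norm_scaleR)
  moreover have "m *\<^sub>R ((\<alpha> (?l s) - \<alpha> (?l t)) /\<^sub>R (?l s - ?l t) - v)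
      = (\<alpha> (?l s) - \<alpha> (?l t)) /\<^sub>R (s - t) - m *\<^sub>R v" for s
  proof -
    have l: "?l s - ?l t = m * (s - t)" by (simp add: algebra_simps)
    \<comment> \<open>At \<open>s = t\<close> both sides are 0, since
      \<open>inverse 0 = 0\<close>.\<close>
    have k: "m * inverse (m * (s - t)) = inverse (s - t)" using m by (cases "s = t") simp_all
    show ?thesis unfolding l scaleR_diff_right scaleR_scaleR k ..
  qed
  ultimately show ?thesis
    using d S' unfolding has_hs_derivative_def by (simp add: hilbert_schmidt_scaleR)
qed

lemma hs_smooth_on_affine:
  assumes "hs_smooth_on \<alpha> S" and m: "m \<noteq> 0" and S': "\<And>s. s \<in> S' \<Longrightarrow> m * s + c \<in> S"
  shows "hs_smooth_on (\<lambda>s. \<alpha> (m * s + c)) S'"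
proof -
  obtain D where D: "\<And>t. t \<in> S \<Longrightarrow> D 0 t = \<alpha> t"
    "\<And>n t. t \<in> S \<Longrightarrow> has_hs_derivative (D n) (D (Suc n) t) t S"
    using assms(1) unfolding hs_smooth_on_def by blast
  have scale: "has_hs_derivative (\<lambda>s. k *\<^sub>R \<gamma> s) (k *\<^sub>R v) t S'"
    if "has_hs_derivative \<gamma> v t S'" for k \<gamma> v t
  proof -
    have "((\<lambda>s. \<bar>k\<bar> * hs_norm ((\<gamma> s - \<gamma> t) /\<^sub>R (s - t) - v)) \<longlongrightarrow> 0) (at t within S')"
      using that unfolding has_hs_derivative_def by (intro tendsto_mult_right_zero) blast
    then show ?thesis
      using that unfolding has_hs_derivative_def
      by (simp add: hilbert_schmidt_scaleR mult.commute flip: hs_norm_scaleR scaleR_diff_right)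
        (simp add: scaleR_diff_right mult.commute)
  qed
  show ?thesis
    unfolding hs_smooth_on_def
  proof (intro exI[of _ "\<lambda>n t. m ^ n *\<^sub>R D n (m * t + c)"] conjI ballI allI)
    fix n t assume "t \<in> S'"
    from scale[OF has_hs_derivative_affine[OF D(2)[OF S'[OF this]] m S'], of "m ^ n"]
    show "has_hs_derivative (\<lambda>t. m ^ n *\<^sub>R D n (m * t + c)) (m ^ Suc n *\<^sub>R D (Suc n) (m * t + c)) t S'"
      by (simp add: mult.commute)
  qed (simp add: D(1) S')
qed

lemma piecewise_hs_smooth_on_scale:
  assumes "piecewise_hs_smooth_on \<alpha> a b" "m > 0"
  shows "piecewise_hs_smooth_on (\<lambda>t. \<alpha> (m * t + c)) ((a - c) / m) ((b - c) / m)"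
  using assms(1)
proof (induction rule: piecewise_hs_smooth_on.induct)
  case (piece a b)
  show ?case
    by (rule piecewise_hs_smooth_on.piece, use piece assms(2) in \<open>simp add: divide_strict_right_mono\<close>)
      (rule hs_smooth_on_affine[OF piece(2)], use assms(2) in \<open>auto simp: field_simps\<close>)
next
  case (add_piece a b d)
  show ?case
    by (rule piecewise_hs_smooth_on.add_piece[OF add_piece.IH],
        use add_piece assms(2) in \<open>simp add: divide_strict_right_mono\<close>)
      (rule hs_smooth_on_affine[OF add_piece(3)], use assms(2) in \<open>auto simp: field_simps\<close>)
qed

lemma piecewise_hs_smooth_on_reverse:
  assumes "piecewise_hs_smooth_on \<alpha> a b"
  shows "piecewise_hs_smooth_on (\<lambda>t. \<alpha> (c - t)) (c - b) (c - a)"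
proof -
  have rev: "hs_smooth_on (\<lambda>t. \<alpha> (c - t)) {c - v..c - u}" if "hs_smooth_on \<alpha> {u..v}" for u v
    using hs_smooth_on_affine[OF that, of "-1" "{c - v..c - u}" c] by (simp add: add.commute)
  show ?thesis
    using assms
  proof (induction rule: piecewise_hs_smooth_on.induct)
    case (piece a b)
    then show ?case by (intro piecewise_hs_smooth_on.piece rev) auto
  next
    \<comment> \<open>Reversal puts the last piece in front, where \<open>add_piece\<close> cannot
      attach it; it is therefore joined as a curve of its own.\<close>
    case (add_piece a b d)
    have "piecewise_hs_smooth_on (\<lambda>t. \<alpha> (c - t)) (c - d) (c - b)"
      using add_piece by (intro piecewise_hs_smooth_on.piece rev) auto
    with add_piece.IH show ?case by (rule piecewise_hs_smooth_on_join)
  qed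
qed

lemma has_hs_derivative_compose_left:
  assumes "has_hs_derivative \<alpha> v t S"
  shows "has_hs_derivative (\<lambda>s. g o\<^sub>L \<alpha> s) (g o\<^sub>L v) t S"
proof -
  have v: "v \<in> hilbert_schmidt" and d: "\<And>s. s \<in> S \<Longrightarrow> \<alpha> s - \<alpha> t \<in> hilbert_schmidt"
    and lim: "((\<lambda>s. hs_norm ((\<alpha> s - \<alpha> t) /\<^sub>R (s - t) - v)) \<longlongrightarrow> 0) (at t within S)"
    using assms unfolding has_hs_derivative_def by auto
  have eq: "(g o\<^sub>L x) - (g o\<^sub>L y) = g o\<^sub>L (x - y)" "(g o\<^sub>L x) /\<^sub>R r = g o\<^sub>L (x /\<^sub>R r)" for x y r
    by (rule blinfun_eqI, simp add: blinfun.bilinear_simps)+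
  have "((\<lambda>s. hs_norm (g o\<^sub>L ((\<alpha> s - \<alpha> t) /\<^sub>R (s - t) - v))) \<longlongrightarrow> 0) (at t within S)"
  proof (rule Lim_null_comparison[OF _ tendsto_mult_right_zero[OF lim, of "norm g"]])
    show "\<forall>\<^sub>F s in at t within S. norm (hs_norm (g o\<^sub>L ((\<alpha> s - \<alpha> t) /\<^sub>R (s - t) - v)))
        \<le> norm g * hs_norm ((\<alpha> s - \<alpha> t) /\<^sub>R (s - t) - v)"
      unfolding eventually_at_filter real_norm_def abs_of_nonneg[OF hs_norm_nonneg]
      by (intro always_eventually allI impI hs_norm_compose_left hilbert_schmidt_diff
          hilbert_schmidt_scaleR d v)
  qed
  then show ?thesis
    unfolding has_hs_derivative_def eq using v d by (simp add: hilbert_schmidt_compose_left)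
qed

lemma hs_smooth_on_compose_left:
  assumes "hs_smooth_on \<alpha> S"
  shows "hs_smooth_on (\<lambda>t. g o\<^sub>L \<alpha> t) S"
proof -
  obtain D where "\<And>t. t \<in> S \<Longrightarrow> D 0 t = \<alpha> t"
    "\<And>n t. t \<in> S \<Longrightarrow> has_hs_derivative (D n) (D (Suc n) t) t S"
    using assms unfolding hs_smooth_on_def by blast
  then show ?thesis
    unfolding hs_smooth_on_def
    by (intro exI[of _ "\<lambda>n t. g o\<^sub>L D n t"]) (simp add: has_hs_derivative_compose_left)
qed

lemma piecewise_hs_smooth_on_compose_left:
  "piecewise_hs_smooth_on \<alpha> a b \<Longrightarrow> piecewise_hs_smooth_on (\<lambda>t. g o\<^sub>L \<alpha> t) a b"
  by (induction rule: piecewise_hs_smooth_on.induct)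
    (auto intro: piecewise_hs_smooth_on.intros hs_smooth_on_compose_left)

lift_definition hs_mult :: "('a::{real_inner,banach} \<Rightarrow>\<^sub>L 'a) \<Rightarrow> 'a hs \<Rightarrow> 'a hs" is "(o\<^sub>L)"
  by (rule hilbert_schmidt_compose_left)

lemma bounded_bilinear_hs_mult: "bounded_bilinear hs_mult"
proof
  show "\<exists>K. \<forall>a b. norm (hs_mult a b) \<le> norm a * norm b * K"
    by (intro exI[of _ 1] allI, transfer) (simp add: hs_norm_compose_left)
qed (transfer, rule blinfun_eqI, simp add: blinfun.bilinear_simps)+

lemma norm_hs_mult_le: "norm (hs_mult a b) \<le> norm a * norm b"
  by transfer (rule hs_norm_compose_left)

lemma hs_mult_assoc: "hs_mult a (hs_mult b v) = hs_mult (a o\<^sub>L b) v"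
  by transfer (rule blinfun_eqI, simp)

lemma hs_mult_id [simp]: "hs_mult id_blinfun v = v"
  by transfer (rule blinfun_eqI, simp)

lemma bounded_linear_adjoint: "bounded_linear (blinfun_adjoint :: ('a::{real_inner,banach} \<Rightarrow>\<^sub>L 'a) \<Rightarrow> _)"
  by (rule bounded_linear_intro[where K=1])
    (rule blinfun_adjoint_unique, simp add: blinfun.bilinear_simps inner_add_left inner_add_right
        blinfun_adjoint_inner_right | simp add: norm_blinfun_adjoint_le)+

lemma left_metric_eq: "left_metric g (hs_op v) = norm (hs_mult (blinfun_inverse g) v)"
  unfolding left_metric_def by transfer rule

section \<open>Lengths of curves\<close>

context complex_hilbert_space
begin

text \<open>A relation instead of an integral of \<open>hs_derivative\<close>: the velocity
  \<open>V\<close> is prescribed only off a finite set, so that curves on arbitrary intervals can be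
  glued. Continuity in the Hilbert-Schmidt norm is included for the fundamental theorem of
  calculus.\<close>

definition has_length :: "(real \<Rightarrow> ('a \<Rightarrow>\<^sub>L 'a)) \<Rightarrow> real \<Rightarrow> real \<Rightarrow> real \<Rightarrow> bool" where
  "has_length \<alpha> a b L \<longleftrightarrow>
    (\<forall>t\<in>{a..b}. \<alpha> t \<in> Sp2 J) \<and> continuous_on {a..b} (\<lambda>t. Hs (\<alpha> t - id_blinfun)) \<and>
    (\<exists>V X. finite X \<and>
      (\<forall>t\<in>{a<..<b} - X. ((\<lambda>s. Hs (\<alpha> s - id_blinfun)) has_vector_derivative V t) (at t)) \<and>
      ((\<lambda>t. left_metric (\<alpha> t) (hs_op (V t))) has_integral L) {a..b})"

lemma has_lengthE:
  assumes "has_length \<alpha> a b L"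
  obtains V X where "\<And>t. t \<in> {a..b} \<Longrightarrow> \<alpha> t \<in> Sp2 J"
    "continuous_on {a..b} (\<lambda>t. Hs (\<alpha> t - id_blinfun))" "finite X"
    "\<And>t. t \<in> {a<..<b} - X \<Longrightarrow> ((\<lambda>s. Hs (\<alpha> s - id_blinfun)) has_vector_derivative V t) (at t)"
    "((\<lambda>t. left_metric (\<alpha> t) (hs_op (V t))) has_integral L) {a..b}"
  using assms unfolding has_length_def by blast

text \<open>On the symplectic group inversion agrees with a bounded linear map, built from the
  adjoint and \<open>J\<close>, so its continuity needs no estimate.\<close>

lemma continuous_on_Sp2_curve:
  assumes "\<And>t. t \<in> S \<Longrightarrow> \<alpha> t \<in> Sp2 J" "continuous_on S (\<lambda>t. Hs (\<alpha> t - id_blinfun))"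
  shows "continuous_on S \<alpha>" "continuous_on S (\<lambda>t. blinfun_inverse (\<alpha> t))"
proof -
  have "continuous_on S (\<lambda>t. hs_op (Hs (\<alpha> t - id_blinfun)) + id_blinfun)"
    by (intro continuous_intros bounded_linear.continuous_on[OF bounded_linear_hs_op] assms)
  then show c: "continuous_on S \<alpha>"
    by (rule continuous_on_eq) (simp add: Hs_inverse Sp2_D assms)
  have "continuous_on S (\<lambda>t. - (J o\<^sub>L blinfun_adjoint (\<alpha> t) o\<^sub>L J))"
    by (intro continuous_intros bounded_bilinear.continuous_on[OF bounded_bilinear_blinfun_compose]
        bounded_linear.continuous_on[OF bounded_linear_adjoint] c)
  then show "continuous_on S (\<lambda>t. blinfun_inverse (\<alpha> t))"
    by (rule continuous_on_eq) (simp add: Sp_inverse Sp2_D assms)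
qed

lemma hs_smooth_on_has_length:
  assumes ab: "a < b" and sm: "hs_smooth_on \<alpha> {a..b}" and Sp: "\<And>t. t \<in> {a..b} \<Longrightarrow> \<alpha> t \<in> Sp2 J"
  shows "\<exists>L. has_length \<alpha> a b L"
proof -
  let ?A = "\<lambda>t. Hs (\<alpha> t - id_blinfun)"
  obtain D where D: "\<And>t. t \<in> {a..b} \<Longrightarrow> D 0 t = \<alpha> t"
    "\<And>n t. t \<in> {a..b} \<Longrightarrow> has_hs_derivative (D n) (D (Suc n) t) t {a..b}"
    using sm unfolding hs_smooth_on_def by blast
  have dD: "((\<lambda>s. Hs (D n s - c)) has_vector_derivative Hs (D (Suc n) t)) (at t within {a..b})"
    if "t \<in> {a..b}" "\<And>s. s \<in> {a..b} \<Longrightarrow> D n s - c \<in> hilbert_schmidt" for n c t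
    using D(2)[OF that(1), of n] has_hs_derivative_iff[of "{a..b}" "D n" c t] that by blast
  have D1: "D 1 t \<in> hilbert_schmidt" if "t \<in> {a..b}" for t
    using D(2)[OF that, of 0] unfolding has_hs_derivative_def by simp
  have dA: "(?A has_vector_derivative Hs (D 1 t)) (at t within {a..b})" if "t \<in> {a..b}" for t
  proof -
    have "((\<lambda>s. Hs (D 0 s - id_blinfun)) has_vector_derivative Hs (D (Suc 0) t)) (at t within {a..b})"
      using that by (intro dD) (simp_all add: D(1) Sp2_D Sp)
    then show ?thesis
      using has_vector_derivative_transform[OF that, of ?A "\<lambda>s. Hs (D 0 s - id_blinfun)"] by (simp add: D(1))
  qed
  have cA: "continuous_on {a..b} ?A"
    using dA has_vector_derivative_continuous by (fastforce simp: continuous_on_eq_continuous_within)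
  \<comment> \<open>The velocity is continuous because it is differentiable in turn; hence the speed
    is continuous and integrable.\<close>
  have "continuous_on {a..b} (\<lambda>t. Hs (D 1 t - 0))"
    unfolding continuous_on_eq_continuous_within
    by (intro ballI has_vector_derivative_continuous[OF dD]) (simp_all add: D1[unfolded One_nat_def])
  then have c1: "continuous_on {a..b} (\<lambda>t. Hs (D 1 t))" by simp
  have "continuous_on {a..b} (\<lambda>t. norm (hs_mult (blinfun_inverse (\<alpha> t)) (Hs (D 1 t))))"
    by (intro continuous_intros bounded_bilinear.continuous_on[OF bounded_bilinear_hs_mult]
        continuous_on_Sp2_curve cA c1 Sp)
  then have "(\<lambda>t. left_metric (\<alpha> t) (hs_op (Hs (D 1 t)))) integrable_on {a..b}"
    unfolding left_metric_eq by (rule integrable_continuous_real)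
  then obtain L where "((\<lambda>t. left_metric (\<alpha> t) (hs_op (Hs (D 1 t)))) has_integral L) {a..b}"
    by blast
  moreover have "(?A has_vector_derivative Hs (D 1 t)) (at t)" if "t \<in> {a<..<b}" for t
    using dA[of t] that at_within_Icc_at[of a t b] by simp
  ultimately show ?thesis
    unfolding has_length_def using cA Sp by (auto intro!: exI[of _ "\<lambda>t. Hs (D 1 t)"] exI[of _ "{}"])
qed

lemma has_length_join:
  assumes "has_length \<alpha> a b L" "has_length \<alpha> b c M" "a \<le> b" "b \<le> c"
  shows "has_length \<alpha> a c (L + M)"
proof -
  obtain V X where V: "\<And>t. t \<in> {a..b} \<Longrightarrow> \<alpha> t \<in> Sp2 J"
    "continuous_on {a..b} (\<lambda>t. Hs (\<alpha> t - id_blinfun))" "finite X"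
    "\<And>t. t \<in> {a<..<b} - X \<Longrightarrow> ((\<lambda>s. Hs (\<alpha> s - id_blinfun)) has_vector_derivative V t) (at t)"
    "((\<lambda>t. left_metric (\<alpha> t) (hs_op (V t))) has_integral L) {a..b}"
    using assms(1) by (rule has_lengthE) blast
  obtain W Y where W: "\<And>t. t \<in> {b..c} \<Longrightarrow> \<alpha> t \<in> Sp2 J"
    "continuous_on {b..c} (\<lambda>t. Hs (\<alpha> t - id_blinfun))" "finite Y"
    "\<And>t. t \<in> {b<..<c} - Y \<Longrightarrow> ((\<lambda>s. Hs (\<alpha> s - id_blinfun)) has_vector_derivative W t) (at t)"
    "((\<lambda>t. left_metric (\<alpha> t) (hs_op (W t))) has_integral M) {b..c}"
    using assms(2) by (rule has_lengthE) blast
  define U where "U t = (if t < b then V t else W t)" for t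
  have ac: "{a..c} = {a..b} \<union> {b..c}" using assms(3,4) by auto
  have "((\<lambda>t. left_metric (\<alpha> t) (hs_op (U t))) has_integral L) {a..b}"
    by (rule has_integral_spike_finite[OF _ _ V(5), of "{b}"]) (auto simp: U_def)
  moreover have "((\<lambda>t. left_metric (\<alpha> t) (hs_op (U t))) has_integral M) {b..c}"
    by (rule has_integral_spike_finite[OF _ _ W(5), of "{}"]) (auto simp: U_def)
  ultimately have "((\<lambda>t. left_metric (\<alpha> t) (hs_op (U t))) has_integral L + M) {a..c}"
    using assms(3,4) by (rule has_integral_combine[rotated 2])
  moreover have "((\<lambda>s. Hs (\<alpha> s - id_blinfun)) has_vector_derivative U t) (at t)"
    if "t \<in> {a<..<c} - (insert b (X \<union> Y))" for t
    using that V(4)[of t] W(4)[of t] by (cases "t < b") (auto simp: U_def)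
  moreover have "continuous_on {a..c} (\<lambda>t. Hs (\<alpha> t - id_blinfun))"
    unfolding ac using V(2) W(2) by (intro continuous_on_closed_Un) auto
  moreover have "finite (insert b (X \<union> Y))" using V(3) W(3) by simp
  ultimately show ?thesis
    unfolding has_length_def ac using V(1) W(1) by blast
qed

lemma piecewise_hs_smooth_on_has_length:
  assumes "piecewise_hs_smooth_on \<alpha> a b" "\<And>t. t \<in> {a..b} \<Longrightarrow> \<alpha> t \<in> Sp2 J"
  shows "\<exists>L. has_length \<alpha> a b L"
  using assms
proof (induction rule: piecewise_hs_smooth_on.induct)
  case (piece a b)
  then show ?case by (rule hs_smooth_on_has_length)
next
  case (add_piece a b c)
  have ab: "a < b" using add_piece(1) by (rule piecewise_hs_smooth_on_less)
  obtain L where L: "has_length \<alpha> a b L" using add_piece by auto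
  obtain M where M: "has_length \<alpha> b c M"
    using hs_smooth_on_has_length[OF add_piece(2,3)] add_piece(5) ab by auto
  show ?case using has_length_join[OF L M] ab add_piece(2) by auto
qed

lemma has_length_cong:
  assumes "has_length \<alpha> a b L" "\<And>t. t \<in> {a..b} \<Longrightarrow> \<beta> t = \<alpha> t"
  shows "has_length \<beta> a b L"
proof -
  obtain V X where V: "\<And>t. t \<in> {a..b} \<Longrightarrow> \<alpha> t \<in> Sp2 J"
    "continuous_on {a..b} (\<lambda>t. Hs (\<alpha> t - id_blinfun))" "finite X"
    "\<And>t. t \<in> {a<..<b} - X \<Longrightarrow> ((\<lambda>s. Hs (\<alpha> s - id_blinfun)) has_vector_derivative V t) (at t)"
    "((\<lambda>t. left_metric (\<alpha> t) (hs_op (V t))) has_integral L) {a..b}"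
    using assms(1) by (rule has_lengthE) blast
  have "((\<lambda>s. Hs (\<beta> s - id_blinfun)) has_vector_derivative V t) (at t)" if t: "t \<in> {a<..<b} - X" for t
    by (rule has_vector_derivative_transform_within_open[OF V(4)[OF t], of "{a<..<b}"])
      (use t assms(2) in auto)
  moreover have "continuous_on {a..b} (\<lambda>t. Hs (\<beta> t - id_blinfun))"
    by (rule continuous_on_eq[OF V(2)]) (simp add: assms(2))
  moreover have "((\<lambda>t. left_metric (\<beta> t) (hs_op (V t))) has_integral L) {a..b}"
    by (rule has_integral_eq[OF _ V(5)]) (simp add: assms(2))
  ultimately show ?thesis
    unfolding has_length_def using V(1,3) assms(2) by (metis (no_types, lifting))
qed

text \<open>The velocity is multiplied by \<open>m\<close> and the integral by
  \<open>1 / \<bar>m\<bar>\<close>, so the length is unchanged. As \<open>m\<close> may be negative,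
  this covers reversal as well as rescaling.\<close>

lemma has_length_affine:
  assumes "has_length \<alpha> a b L" and m: "m \<noteq> 0"
    and S: "\<And>t. m * t + c \<in> {a..b} \<longleftrightarrow> t \<in> {a'..b'}"
    and I: "\<And>t. t \<in> {a'<..<b'} \<Longrightarrow> m * t + c \<in> {a<..<b}"
  shows "has_length (\<lambda>t. \<alpha> (m * t + c)) a' b' L"
proof -
  obtain V X where V: "\<And>t. t \<in> {a..b} \<Longrightarrow> \<alpha> t \<in> Sp2 J"
    "continuous_on {a..b} (\<lambda>t. Hs (\<alpha> t - id_blinfun))" "finite X"
    "\<And>t. t \<in> {a<..<b} - X \<Longrightarrow> ((\<lambda>s. Hs (\<alpha> s - id_blinfun)) has_vector_derivative V t) (at t)"
    "((\<lambda>t. left_metric (\<alpha> t) (hs_op (V t))) has_integral L) {a..b}"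
    using assms(1) by (rule has_lengthE) blast
  let ?l = "\<lambda>t. m * t + c" and ?X = "(\<lambda>x. (x - c) / m) ` X"
  have der: "((\<lambda>s. Hs (\<alpha> (?l s) - id_blinfun)) has_vector_derivative m *\<^sub>R V (?l t)) (at t)"
    if t: "t \<in> {a'<..<b'} - ?X" for t
  proof -
    have "?l t \<in> X \<Longrightarrow> t \<in> ?X" using m by (intro image_eqI[of _ _ "?l t"]) simp_all
    then have "?l t \<in> {a<..<b} - X" using I[of t] t by auto
    moreover have "(?l has_vector_derivative m) (at t)"
      by (auto intro!: derivative_eq_intros simp: has_real_derivative_iff_has_vector_derivative[symmetric])
    ultimately show ?thesis
      using vector_diff_chain_at[of ?l m t "\<lambda>s. Hs (\<alpha> s - id_blinfun)" "V (?l t)"] V(4)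
      by (simp add: o_def)
  qed
  have cont: "continuous_on {a'..b'} (\<lambda>t. Hs (\<alpha> (?l t) - id_blinfun))"
    by (rule continuous_on_compose2[OF V(2), of _ ?l]) (use S in \<open>auto intro!: continuous_intros\<close>)
  have img: "(\<lambda>x. (1 / m) *\<^sub>R x + - ((1 / m) *\<^sub>R c)) ` {a..b} = {a'..b'}"
  proof (intro equalityI subsetI)
    fix t assume "t \<in> (\<lambda>x. (1 / m) *\<^sub>R x + - ((1 / m) *\<^sub>R c)) ` {a..b}"
    then obtain x where "x \<in> {a..b}" "t = (x - c) / m" by (auto simp: diff_divide_distrib)
    then show "t \<in> {a'..b'}" using m S[of t] by simp
  next
    fix t assume "t \<in> {a'..b'}"
    then have "?l t \<in> {a..b}" using S by simp
    then show "t \<in> (\<lambda>x. (1 / m) *\<^sub>R x + - ((1 / m) *\<^sub>R c)) ` {a..b}"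
      using m by (intro image_eqI[of _ _ "?l t"]) (simp_all add: field_simps)
  qed
  have "((\<lambda>t. left_metric (\<alpha> (?l t)) (hs_op (V (?l t)))) has_integral (1 / \<bar>m\<bar>) *\<^sub>R L) {a'..b'}"
    using has_integral_affinity[of "\<lambda>t. left_metric (\<alpha> t) (hs_op (V t))" L a b m c] V(5) m img by simp
  from has_integral_mult_right[OF this, of "\<bar>m\<bar>"]
  have "((\<lambda>t. left_metric (\<alpha> (?l t)) (hs_op (m *\<^sub>R V (?l t)))) has_integral L) {a'..b'}"
    using m by (simp add: left_metric_eq bounded_bilinear.scaleR_right[OF bounded_bilinear_hs_mult])
  then show ?thesis
    unfolding has_length_def using V(1,3) der cont S
    by (intro conjI exI[of _ "\<lambda>t. m *\<^sub>R V (?l t)"] exI[of _ ?X]) auto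
qed

text \<open>Left invariance of the metric: the factor \<open>g\<close> cancels between the inverse
  of the translated curve and its velocity. In the Hilbert-Schmidt space, translation is the affine
  map that sends \<open>\<alpha> - 1\<close> to \<open>g (\<alpha> - 1) + (g - 1)\<close>.\<close>

lemma has_length_compose_left:
  assumes "has_length \<alpha> a b L" and g: "g \<in> Sp2 J"
  shows "has_length (\<lambda>t. g o\<^sub>L \<alpha> t) a b L"
proof -
  obtain V X where V: "\<And>t. t \<in> {a..b} \<Longrightarrow> \<alpha> t \<in> Sp2 J"
    "continuous_on {a..b} (\<lambda>t. Hs (\<alpha> t - id_blinfun))" "finite X"
    "\<And>t. t \<in> {a<..<b} - X \<Longrightarrow> ((\<lambda>s. Hs (\<alpha> s - id_blinfun)) has_vector_derivative V t) (at t)"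
    "((\<lambda>t. left_metric (\<alpha> t) (hs_op (V t))) has_integral L) {a..b}"
    using assms(1) by (rule has_lengthE) blast
  let ?B = "\<lambda>t. hs_mult g (Hs (\<alpha> t - id_blinfun)) + Hs (g - id_blinfun)"
  have eq: "?B t = Hs ((g o\<^sub>L \<alpha> t) - id_blinfun)" if "t \<in> {a..b}" for t
  proof -
    have "\<alpha> t - id_blinfun \<in> hilbert_schmidt" "g - id_blinfun \<in> hilbert_schmidt"
      using V(1)[OF that] g Sp2_D by auto
    then have "?B t = Hs ((g o\<^sub>L (\<alpha> t - id_blinfun)) + (g - id_blinfun))"
      by (simp add: hs_mult.abs_eq plus_hs.abs_eq eq_onp_def hilbert_schmidt_compose_left)
    also have "\<dots> = Hs ((g o\<^sub>L \<alpha> t) - id_blinfun)"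
      by (intro arg_cong[where f=Hs] blinfun_eqI) (simp add: blinfun.bilinear_simps)
    finally show ?thesis .
  qed
  have lin: "bounded_linear (hs_mult g)"
    by (rule bounded_bilinear.bounded_linear_right[OF bounded_bilinear_hs_mult])
  have "((\<lambda>s. Hs ((g o\<^sub>L \<alpha> s) - id_blinfun)) has_vector_derivative hs_mult g (V t)) (at t)"
    if t: "t \<in> {a<..<b} - X" for t
  proof (rule has_vector_derivative_transform_within_open[of ?B _ _ "{a<..<b}"])
    show "(?B has_vector_derivative hs_mult g (V t)) (at t)"
      using has_vector_derivative_add[OF bounded_linear.has_vector_derivative[OF lin V(4)[OF t]]
          has_vector_derivative_const[of "Hs (g - id_blinfun)"]] by simp
  qed (use t eq in auto)
  moreover have "continuous_on {a..b} (\<lambda>t. Hs ((g o\<^sub>L \<alpha> t) - id_blinfun))"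
    by (rule continuous_on_eq[of _ ?B])
      (simp_all add: eq continuous_intros bounded_linear.continuous_on[OF lin V(2)])
  moreover have "((\<lambda>t. left_metric (g o\<^sub>L \<alpha> t) (hs_op (hs_mult g (V t)))) has_integral L) {a..b}"
  proof (rule has_integral_eq[OF _ V(5)])
    fix t assume "t \<in> {a..b}"
    then have \<alpha>: "\<alpha> t \<in> Sp J" using V(1) Sp2_D by blast
    have gS: "g \<in> Sp J" using g Sp2_D by blast
    have "blinfun_inverse (g o\<^sub>L \<alpha> t) o\<^sub>L g = blinfun_inverse (\<alpha> t)"
      by (rule blinfun_eqI) (simp add: inverse_compose \<alpha> gS)
    then show "left_metric (\<alpha> t) (hs_op (V t)) = left_metric (g o\<^sub>L \<alpha> t) (hs_op (hs_mult g (V t)))"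
      by (simp add: left_metric_eq hs_mult_assoc)
  qed
  ultimately show ?thesis
    unfolding has_length_def using V(1,3) g Sp2_compose
    by (intro conjI exI[of _ "\<lambda>t. hs_mult g (V t)"] exI[of _ X]) auto
qed

text \<open>At interior points off the exceptional set the derivative within \<open>{0..1}\<close>
  is two-sided and unique, hence equal to \<open>V\<close>; the remaining points are finitely
  many.\<close>

lemma has_length_curve_length:
  assumes "has_length \<alpha> 0 1 L"
  shows "curve_length \<alpha> = L"
proof -
  obtain V X where V: "\<And>t. t \<in> {0..1} \<Longrightarrow> \<alpha> t \<in> Sp2 J"
    "continuous_on {0..1} (\<lambda>t. Hs (\<alpha> t - id_blinfun))" "finite X"
    "\<And>t. t \<in> {0<..<1} - X \<Longrightarrow> ((\<lambda>s. Hs (\<alpha> s - id_blinfun)) has_vector_derivative V t) (at t)"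
    "((\<lambda>t. left_metric (\<alpha> t) (hs_op (V t))) has_integral L) {0..1}"
    using assms by (rule has_lengthE) blast
  have "hs_derivative \<alpha> t = hs_op (V t)" if t: "t \<in> {0<..<1} - X" for t
  proof -
    have at: "at t within {0..1} = at t" using t by (simp add: at_within_Icc_at)
    have iff: "has_hs_derivative \<alpha> v t {0..1} \<longleftrightarrow> v \<in> hilbert_schmidt \<and>
      ((\<lambda>s. Hs (\<alpha> s - id_blinfun)) has_vector_derivative Hs v) (at t)" for v
      unfolding at[symmetric] by (rule has_hs_derivative_iff) (use t V(1) Sp2_D in auto)
    show ?thesis
      unfolding hs_derivative_def
    proof (rule the_equality)
      show "has_hs_derivative \<alpha> (hs_op (V t)) t {0..1}"
        unfolding iff using V(4)[OF t] hs_op by (simp add: hs_op_inverse)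
      fix v assume "has_hs_derivative \<alpha> v t {0..1}"
      then show "v = hs_op (V t)"
        unfolding iff using vector_derivative_unique_at[OF V(4)[OF t]] by (metis Hs_inverse)
    qed
  qed
  then have "((\<lambda>t. left_metric (\<alpha> t) (hs_derivative \<alpha> t)) has_integral L) {0..1}"
    by (intro has_integral_spike_finite[OF _ _ V(5), of "insert 0 (insert 1 X)"]) (auto simp: V(3))
  then show ?thesis unfolding curve_length_def by (rule integral_unique)
qed

text \<open>Writing \<open>V\<close> as \<open>\<alpha>\<close> times its left translate to the
  identity bounds its norm by \<open>M\<close> times the speed. The integral of \<open>V\<close> is
  the increment of the curve.\<close>

lemma has_length_bound:
  assumes "has_length \<alpha> a b L" "a \<le> b" and M: "\<And>t. t \<in> {a..b} \<Longrightarrow> norm (\<alpha> t) \<le> M"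
  shows "hs_norm (\<alpha> b - \<alpha> a) \<le> M * L"
proof -
  obtain V X where V: "\<And>t. t \<in> {a..b} \<Longrightarrow> \<alpha> t \<in> Sp2 J"
    "continuous_on {a..b} (\<lambda>t. Hs (\<alpha> t - id_blinfun))" "finite X"
    "\<And>t. t \<in> {a<..<b} - X \<Longrightarrow> ((\<lambda>s. Hs (\<alpha> s - id_blinfun)) has_vector_derivative V t) (at t)"
    "((\<lambda>t. left_metric (\<alpha> t) (hs_op (V t))) has_integral L) {a..b}"
    using assms(1) by (rule has_lengthE) blast
  have int: "(V has_integral Hs (\<alpha> b - id_blinfun) - Hs (\<alpha> a - id_blinfun)) {a..b}"
    using fundamental_theorem_of_calculus_interior_strong[OF V(3) assms(2) V(4) V(2)] by simp
  have le: "norm (V t) \<le> M * left_metric (\<alpha> t) (hs_op (V t))" if "t \<in> {a..b}" for t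
  proof -
    have "\<alpha> t o\<^sub>L blinfun_inverse (\<alpha> t) = id_blinfun"
      using V(1)[OF that] Sp2_D Sp_D blinfun_inverse by blast
    then have "V t = hs_mult (\<alpha> t) (hs_mult (blinfun_inverse (\<alpha> t)) (V t))"
      by (simp add: hs_mult_assoc)
    then have "norm (V t) \<le> norm (\<alpha> t) * left_metric (\<alpha> t) (hs_op (V t))"
      unfolding left_metric_eq by (metis norm_hs_mult_le)
    also have "\<dots> \<le> M * left_metric (\<alpha> t) (hs_op (V t))"
      by (rule mult_right_mono[OF M[OF that]]) (simp add: left_metric_eq)
    finally show ?thesis .
  qed
  have "norm (integral {a..b} V) \<le> integral {a..b} (\<lambda>t. M * left_metric (\<alpha> t) (hs_op (V t)))"
    by (rule integral_norm_bound_integral) (use int V(5) le in \<open>auto intro!: integrable_on_mult_right\<close>)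
  also have "\<dots> = M * L" using V(5) by (simp add: integral_unique)
  also have "integral {a..b} V = Hs (\<alpha> b - id_blinfun) - Hs (\<alpha> a - id_blinfun)"
    using int by (rule integral_unique)
  also have "\<dots> = Hs (\<alpha> b - \<alpha> a)"
    using V(1)[of a] V(1)[of b] assms(2) Sp2_D by (simp add: Hs_diff)
  finally show ?thesis
    using hilbert_schmidt_diff[of "\<alpha> b - id_blinfun" "\<alpha> a - id_blinfun"] V(1)[of a] V(1)[of b] assms(2) Sp2_D
    by (simp add: norm_Hs)
qed

section \<open>Paths and their lengths as a relation\<close>

definition joined :: "('a \<Rightarrow>\<^sub>L 'a) \<Rightarrow> ('a \<Rightarrow>\<^sub>L 'a) \<Rightarrow> real \<Rightarrow> bool" where
  "joined p q L \<longleftrightarrow> (\<exists>\<alpha>. \<alpha> \<in> Sp2_curves J p q \<and> has_length \<alpha> 0 1 L)"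

lemma has_length_Sp2: "has_length \<alpha> a b L \<Longrightarrow> t \<in> {a..b} \<Longrightarrow> \<alpha> t \<in> Sp2 J"
  unfolding has_length_def by blast

lemma joinedI:
  assumes "piecewise_hs_smooth_on \<alpha> 0 1" "has_length \<alpha> 0 1 L"
  shows "joined (\<alpha> 0) (\<alpha> 1) L"
  using assms has_length_Sp2
  unfolding joined_def Sp2_curves_def piecewise_hs_smooth_iff[symmetric] by blast

lemma joinedE:
  assumes "joined p q L"
  obtains \<alpha> where "piecewise_hs_smooth_on \<alpha> 0 1" "has_length \<alpha> 0 1 L" "\<alpha> 0 = p" "\<alpha> 1 = q"
  using assms unfolding joined_def Sp2_curves_def piecewise_hs_smooth_iff by blast

text \<open>Every admissible curve has a length in the sense of \<open>has_length\<close>, so the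
  geodesic distance is an infimum over \<open>joined\<close> and the metric axioms reduce to
  properties of this relation.\<close>

lemma curve_lengths_eq: "curve_length ` Sp2_curves J p q = {L. joined p q L}"
proof (intro equalityI subsetI)
  fix L assume "L \<in> curve_length ` Sp2_curves J p q"
  then obtain \<alpha> where \<alpha>: "\<alpha> \<in> Sp2_curves J p q" "L = curve_length \<alpha>" by blast
  then obtain M where M: "has_length \<alpha> 0 1 M"
    using piecewise_hs_smooth_on_has_length[of \<alpha> 0 1]
    unfolding Sp2_curves_def piecewise_hs_smooth_iff by blast
  with \<alpha> show "L \<in> {L. joined p q L}"
    unfolding joined_def using has_length_curve_length[OF M] by auto
next
  fix L assume "L \<in> {L. joined p q L}"
  then show "L \<in> curve_length ` Sp2_curves J p q"
    unfolding joined_def using has_length_curve_length by blast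
qed

lemma has_length_nonneg: "has_length \<alpha> a b L \<Longrightarrow> 0 \<le> L"
  unfolding has_length_def left_metric_def by (auto intro: has_integral_nonneg)

lemma joined_nonneg: "joined p q L \<Longrightarrow> 0 \<le> L"
  unfolding joined_def using has_length_nonneg by blast

lemma joined_Sp2: assumes "joined p q L" shows "p \<in> Sp2 J" "q \<in> Sp2 J"
  using joinedE[OF assms] has_length_Sp2[of _ 0 1 L 0] has_length_Sp2[of _ 0 1 L 1] by force+

lemma joined_refl:
  assumes "p \<in> Sp2 J"
  shows "joined p p 0"
proof -
  have d: "has_hs_derivative (\<lambda>_. c) 0 t S" for c :: "'a \<Rightarrow>\<^sub>L 'a" and t S
    unfolding has_hs_derivative_def by simp
  have "hs_smooth_on (\<lambda>_. p) {0..1}"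
    unfolding hs_smooth_on_def
  proof (intro exI[of _ "\<lambda>n _. if n = 0 then p else 0"] conjI allI ballI)
    fix n :: nat and t :: real
    show "has_hs_derivative (\<lambda>_. if n = 0 then p else 0) (if Suc n = 0 then p else 0) t {0..1}"
      by (simp only: nat.simps if_False d)
  qed simp
  moreover have "has_length (\<lambda>_. p) 0 1 0"
    unfolding has_length_def using assms
    by (auto intro!: exI[of _ "\<lambda>_. 0"] exI[of _ "{}"]
        simp: left_metric_eq bounded_bilinear.zero_right[OF bounded_bilinear_hs_mult])
  ultimately show ?thesis
    using joinedI[OF piecewise_hs_smooth_on.piece] by simp
qed

lemma joined_sym:
  assumes "joined p q L"
  shows "joined q p L"
proof -
  obtain \<alpha> where \<alpha>: "piecewise_hs_smooth_on \<alpha> 0 1" "has_length \<alpha> 0 1 L" "\<alpha> 0 = p" "\<alpha> 1 = q"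
    using assms by (rule joinedE)
  have "has_length (\<lambda>t. \<alpha> (-1 * t + 1)) 0 1 L"
    by (rule has_length_affine[OF \<alpha>(2)]) auto
  moreover have "piecewise_hs_smooth_on (\<lambda>t. \<alpha> (-1 * t + 1)) 0 1"
    using piecewise_hs_smooth_on_reverse[OF \<alpha>(1), of 1] by simp
  ultimately show ?thesis
    using joinedI[of "\<lambda>t. \<alpha> (-1 * t + 1)" L] \<alpha>(3,4) by simp
qed

lemma joined_trans:
  assumes "joined p q L" "joined q r M"
  shows "joined p r (L + M)"
proof -
  obtain \<alpha> where \<alpha>: "piecewise_hs_smooth_on \<alpha> 0 1" "has_length \<alpha> 0 1 L" "\<alpha> 0 = p" "\<alpha> 1 = q"
    using assms(1) by (rule joinedE)
  obtain \<beta> where \<beta>: "piecewise_hs_smooth_on \<beta> 0 1" "has_length \<beta> 0 1 M" "\<beta> 0 = q" "\<beta> 1 = r"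
    using assms(2) by (rule joinedE)
  \<comment> \<open>The terms \<open>+ 0\<close> and \<open>+ (-1)\<close> keep the shape
    \<open>m * t + c\<close> of the affine lemmas. At \<open>1/2\<close> both branches give
    \<open>q\<close>.\<close>
  define \<gamma> where "\<gamma> t = (if t \<le> 1/2 then \<alpha> (2 * t + 0) else \<beta> (2 * t + (-1)))" for t
  have \<gamma>1: "\<gamma> t = \<alpha> (2 * t + 0)" if "t \<in> {0..1/2}" for t using that by (simp add: \<gamma>_def)
  have \<gamma>2: "\<gamma> t = \<beta> (2 * t + (-1))" if "t \<in> {1/2..1}" for t
  proof (cases "t = 1/2")
    case True
    show ?thesis unfolding True using \<alpha>(4) \<beta>(3) by (simp add: \<gamma>_def)
  qed (use that in \<open>simp add: \<gamma>_def\<close>)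
  have "has_length (\<lambda>t. \<alpha> (2 * t + 0)) 0 (1/2) L" by (rule has_length_affine[OF \<alpha>(2)]) auto
  moreover have "has_length (\<lambda>t. \<beta> (2 * t + (-1))) (1/2) 1 M" by (rule has_length_affine[OF \<beta>(2)]) auto
  ultimately have len: "has_length \<gamma> 0 1 (L + M)"
    using \<gamma>1 \<gamma>2 by (intro has_length_join[of _ 0 "1/2"]) (blast intro: has_length_cong | simp)+
  have "piecewise_hs_smooth_on (\<lambda>t. \<alpha> (2 * t + 0)) 0 (1/2)"
    using piecewise_hs_smooth_on_scale[OF \<alpha>(1), of 2 0] by simp
  then have p1: "piecewise_hs_smooth_on \<gamma> 0 (1/2)"
    using \<gamma>1 by (rule piecewise_hs_smooth_on_cong)
  have "piecewise_hs_smooth_on (\<lambda>t. \<beta> (2 * t + (-1))) (1/2) 1"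
    using piecewise_hs_smooth_on_scale[OF \<beta>(1), of 2 "-1"] by simp
  then have "piecewise_hs_smooth_on \<gamma> (1/2) 1"
    using \<gamma>2 by (rule piecewise_hs_smooth_on_cong)
  then have "piecewise_hs_smooth_on \<gamma> 0 1" using p1 by (rule piecewise_hs_smooth_on_join)
  from joinedI[OF this len] show ?thesis using \<alpha>(3) \<beta>(4) by (simp add: \<gamma>_def)
qed

lemma joined_compose_left:
  assumes "joined p q L" "g \<in> Sp2 J"
  shows "joined (g o\<^sub>L p) (g o\<^sub>L q) L"
proof -
  obtain \<alpha> where \<alpha>: "piecewise_hs_smooth_on \<alpha> 0 1" "has_length \<alpha> 0 1 L" "\<alpha> 0 = p" "\<alpha> 1 = q"
    using assms(1) by (rule joinedE)
  from joinedI[OF piecewise_hs_smooth_on_compose_left[OF \<alpha>(1)] has_length_compose_left[OF \<alpha>(2) assms(2)]]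
  show ?thesis by (simp add: \<alpha>(3,4))
qed

text \<open>The speed is nonnegative, so an initial arc is no longer than the curve. This serves to
  estimate a curve up to the parameter where its norm is maximal.\<close>

lemma has_length_initial:
  assumes "has_length \<alpha> a b L" and t: "t \<in> {a..b}"
  obtains L' where "has_length \<alpha> a t L'" "L' \<le> L"
proof -
  obtain V X where V: "\<And>t. t \<in> {a..b} \<Longrightarrow> \<alpha> t \<in> Sp2 J"
    "continuous_on {a..b} (\<lambda>t. Hs (\<alpha> t - id_blinfun))" "finite X"
    "\<And>t. t \<in> {a<..<b} - X \<Longrightarrow> ((\<lambda>s. Hs (\<alpha> s - id_blinfun)) has_vector_derivative V t) (at t)"
    "((\<lambda>t. left_metric (\<alpha> t) (hs_op (V t))) has_integral L) {a..b}"
    using assms(1) by (rule has_lengthE) blast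
  let ?f = "\<lambda>t. left_metric (\<alpha> t) (hs_op (V t))"
  have int: "?f integrable_on {a..t}"
    by (rule integrable_on_subinterval[of _ "{a..b}"]) (use V(5) t in auto)
  have "integral {a..t} ?f \<le> integral {a..b} ?f"
    by (rule integral_subset_le) (use int V(5) t in \<open>auto simp: left_metric_eq\<close>)
  then have "integral {a..t} ?f \<le> L" using V(5) by (simp add: integral_unique)
  moreover have "has_length \<alpha> a t (integral {a..t} ?f)"
    unfolding has_length_def
  proof (intro conjI exI[of _ V] exI[of _ X] ballI)
    show "continuous_on {a..t} (\<lambda>t. Hs (\<alpha> t - id_blinfun))"
      by (rule continuous_on_subset[OF V(2)]) (use t in auto)
  qed (use V t int in auto)
  ultimately show thesis using that by blast
qed

text \<open>If \<open>M\<close> is the maximal norm along a curve of length \<open>L\<close> starting at the identity, then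
  \<open>M \<le> 1 + M L\<close>; so \<open>M \<le> 2\<close> as soon as \<open>L \<le> 1/2\<close>.\<close>

lemma joined_bound:
  assumes "joined p q L" "L \<le> 1/2"
  shows "hs_norm ((blinfun_inverse p o\<^sub>L q) - id_blinfun) \<le> 2 * L"
proof -
  have p: "p \<in> Sp2 J" using assms(1) by (rule joined_Sp2)
  then have "blinfun_inverse p o\<^sub>L p = id_blinfun" using blinfun_inverse Sp2_D Sp_D by blast
  then have "joined id_blinfun (blinfun_inverse p o\<^sub>L q) L"
    using joined_compose_left[OF assms(1) Sp2_inverse_closed[OF p]] by simp
  then obtain \<beta> where \<beta>: "has_length \<beta> 0 1 L" "\<beta> 0 = id_blinfun" "\<beta> 1 = blinfun_inverse p o\<^sub>L q"
    by (rule joinedE)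
  have "continuous_on {0..1} \<beta>"
    using \<beta>(1) continuous_on_Sp2_curve(1)[of "{0..1}" \<beta>] unfolding has_length_def by blast
  then have "continuous_on {0..1} (\<lambda>t. norm (\<beta> t))" by (intro continuous_intros)
  then obtain s where s: "s \<in> {0..1}" "\<And>t. t \<in> {0..1} \<Longrightarrow> norm (\<beta> t) \<le> norm (\<beta> s)"
    using continuous_attains_sup[of "{0..1::real}" "\<lambda>t. norm (\<beta> t)"] by auto
  obtain L' where L': "has_length \<beta> 0 s L'" "L' \<le> L" using \<beta>(1) s(1) by (rule has_length_initial)
  have HS: "\<beta> t - id_blinfun \<in> hilbert_schmidt" if "t \<in> {0..1}" for t
    using has_length_Sp2[OF \<beta>(1) that] by (rule Sp2_D)
  have "norm (\<beta> s) \<le> norm (id_blinfun :: 'a \<Rightarrow>\<^sub>L 'a) + norm (\<beta> s - id_blinfun)"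
    using norm_triangle_ineq[of id_blinfun "\<beta> s - id_blinfun"] by simp
  also have "\<dots> \<le> 1 + hs_norm (\<beta> s - \<beta> 0)"
    by (rule add_mono) (simp_all add: \<beta>(2) norm_le_hs_norm[OF HS[OF s(1)]] norm_blinfun_id_le)
  also have "hs_norm (\<beta> s - \<beta> 0) \<le> norm (\<beta> s) * L'"
    by (rule has_length_bound[OF L'(1)]) (use s in auto)
  also have "\<dots> \<le> norm (\<beta> s) * (1/2)"
    using L'(2) assms(2) by (intro mult_left_mono) auto
  finally have "norm (\<beta> s) \<le> 2" by simp
  then have "hs_norm (\<beta> 1 - \<beta> 0) \<le> 2 * L"
    using s(2) by (intro has_length_bound[OF \<beta>(1)]) fastforce+
  then show ?thesis by (simp add: \<beta>(2,3))
qed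

end

section \<open>The Cayley path\<close>

text \<open>Operator norm differentiability of \<open>K\<close> is enough: the fixed Hilbert-Schmidt
  factor \<open>x\<close> on the left turns operator norm convergence into Hilbert-Schmidt
  convergence.\<close>

lemma has_hs_derivative_hs_compose:
  assumes K: "(K has_vector_derivative K') (at t within S)" and x: "x \<in> hilbert_schmidt"
  shows "has_hs_derivative (\<lambda>s. c + (x o\<^sub>L K s)) (x o\<^sub>L K') t S"
proof -
  let ?q = "\<lambda>s. (K s - K t) /\<^sub>R (s - t) - K'"
  have eq: "((c + (x o\<^sub>L K s)) - (c + (x o\<^sub>L K t))) /\<^sub>R (s - t) - (x o\<^sub>L K') = x o\<^sub>L ?q s" for s
    by (rule blinfun_eqI) (simp add: blinfun.bilinear_simps)
  have eq': "(c + (x o\<^sub>L K s)) - (c + (x o\<^sub>L K t)) = x o\<^sub>L (K s - K t)" for s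
    by (rule blinfun_eqI) (simp add: blinfun.bilinear_simps)
  have lim: "((\<lambda>s. norm (?q s)) \<longlongrightarrow> 0) (at t within S)"
    using K unfolding has_vector_derivative_iff_quotient .
  have "((\<lambda>s. hs_norm (x o\<^sub>L ?q s)) \<longlongrightarrow> 0) (at t within S)"
    by (rule Lim_null_comparison[OF _ tendsto_mult_right_zero[OF lim, of "hs_norm x"]])
      (simp add: hs_norm_compose_right x)
  then show ?thesis
    unfolding has_hs_derivative_def eq unfolding eq' using x by (simp add: hilbert_schmidt_compose_right)
qed

text \<open>With \<open>x = g - 1\<close> and \<open>s = ((1 - t) g + 1 + t)\<^sup>-\<^sup>1\<close>, for which \<open>s' = s x s\<close>, the Cayley path from
  \<open>1\<close> to \<open>g\<close> is \<open>1 + 2 t x s\<close>, and its derivative of order \<open>m + 1\<close> is \<open>x o cayley_factor x s t m\<close>.\<close>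

primrec cayley_factor ::
  "('a::real_normed_vector \<Rightarrow>\<^sub>L 'a) \<Rightarrow> ('a \<Rightarrow>\<^sub>L 'a) \<Rightarrow> real \<Rightarrow> nat \<Rightarrow> ('a \<Rightarrow>\<^sub>L 'a)" where
  "cayley_factor x s t 0 = 2 *\<^sub>R s + (2 * t) *\<^sub>R (s o\<^sub>L x o\<^sub>L s)"
| "cayley_factor x s t (Suc m) = real (m + 2) *\<^sub>R (s o\<^sub>L x o\<^sub>L cayley_factor x s t m)"

lemma has_vector_derivative_compose:
  fixes f g :: "real \<Rightarrow> ('a::real_normed_vector \<Rightarrow>\<^sub>L 'a)"
  assumes "(f has_vector_derivative f') (at t within S)" "(g has_vector_derivative g') (at t within S)"
  shows "((\<lambda>s. f s o\<^sub>L g s) has_vector_derivative ((f t o\<^sub>L g') + (f' o\<^sub>L g t))) (at t within S)"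
  using bounded_bilinear.has_vector_derivative[OF bounded_bilinear_blinfun_compose assms] .

lemma has_vector_derivative_compose_const:
  fixes f :: "real \<Rightarrow> ('a::real_normed_vector \<Rightarrow>\<^sub>L 'a)" and x :: "'a \<Rightarrow>\<^sub>L 'a"
  assumes "(f has_vector_derivative f') (at t within S)"
  shows "((\<lambda>s. f s o\<^sub>L x) has_vector_derivative (f' o\<^sub>L x)) (at t within S)"
  using has_vector_derivative_compose[OF assms has_vector_derivative_const[of x]] by simp

context
  fixes s :: "real \<Rightarrow> ('a::real_normed_vector \<Rightarrow>\<^sub>L 'a)" and x and T and t
  assumes s: "(s has_vector_derivative (s t o\<^sub>L x o\<^sub>L s t)) (at t within T)"
begin

lemma sx_derivative:
  "((\<lambda>r. s r o\<^sub>L x) has_vector_derivative (s t o\<^sub>L x o\<^sub>L s t o\<^sub>L x)) (at t within T)"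
  by (rule has_vector_derivative_compose_const[OF s])

lemma cayley_factor_derivative_0:
  "((\<lambda>r. (2 * r) *\<^sub>R s r) has_vector_derivative cayley_factor x (s t) t 0) (at t within T)"
proof -
  have "((\<lambda>r. 2 * r) has_vector_derivative 2) (at t within T)"
    by (auto intro!: derivative_eq_intros simp: has_real_derivative_iff_has_vector_derivative[symmetric])
  from bounded_bilinear.has_vector_derivative[OF bounded_bilinear_scaleR this s]
  show ?thesis by (simp add: add.commute)
qed

text \<open>If \<open>k' = (m + 2) s x k\<close> and \<open>s' = s x s\<close>, then the product
  rule for \<open>s x k\<close> yields \<open>m + 2\<close> copies of \<open>s x s x k\<close> from
  \<open>k'\<close> and one more from \<open>s'\<close>; hence the next coefficient
  \<open>m + 3\<close>.\<close>

lemma cayley_factor_derivative: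
  "((\<lambda>r. cayley_factor x (s r) r m) has_vector_derivative (cayley_factor x (s t) t (Suc m))) (at t within T)"
proof (induction m)
  case 0
  have "((\<lambda>r. 2 * r) has_vector_derivative 2) (at t within T)"
    by (auto intro!: derivative_eq_intros simp: has_real_derivative_iff_has_vector_derivative[symmetric])
  from has_vector_derivative_add[OF
      bounded_linear.has_vector_derivative[OF bounded_linear_scaleR_right[of 2] s]
      bounded_bilinear.has_vector_derivative[OF bounded_bilinear_scaleR this
        has_vector_derivative_compose[OF sx_derivative s]]]
  have "((\<lambda>r. cayley_factor x (s r) r 0) has_vector_derivative
      (2 *\<^sub>R (s t o\<^sub>L x o\<^sub>L s t) + ((2 * t) *\<^sub>R ((s t o\<^sub>L x o\<^sub>L (s t o\<^sub>L x o\<^sub>L s t)) + (s t o\<^sub>L x o\<^sub>L s t o\<^sub>L x o\<^sub>L s t))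
        + 2 *\<^sub>R (s t o\<^sub>L x o\<^sub>L s t)))) (at t within T)"
    by simp
  moreover have "2 *\<^sub>R (s t o\<^sub>L x o\<^sub>L s t) + ((2 * t) *\<^sub>R ((s t o\<^sub>L x o\<^sub>L (s t o\<^sub>L x o\<^sub>L s t)) + (s t o\<^sub>L x o\<^sub>L s t o\<^sub>L x o\<^sub>L s t))
        + 2 *\<^sub>R (s t o\<^sub>L x o\<^sub>L s t)) = cayley_factor x (s t) t (Suc 0)"
    by (rule blinfun_eqI) (simp add: blinfun.bilinear_simps algebra_simps flip: scaleR_2)
  ultimately show ?case by simp
next
  case (Suc m)
  let ?k = "cayley_factor x (s t) t m"
  from bounded_linear.has_vector_derivative[OF bounded_linear_scaleR_right[of "real (m + 2)"]
      has_vector_derivative_compose[OF sx_derivative Suc.IH]]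
  have "((\<lambda>r. cayley_factor x (s r) r (Suc m)) has_vector_derivative
      real (m + 2) *\<^sub>R ((s t o\<^sub>L x o\<^sub>L cayley_factor x (s t) t (Suc m)) + (s t o\<^sub>L x o\<^sub>L s t o\<^sub>L x o\<^sub>L ?k)))
      (at t within T)"
    by simp
  moreover have "real (m + 2) *\<^sub>R ((s t o\<^sub>L x o\<^sub>L cayley_factor x (s t) t (Suc m)) + (s t o\<^sub>L x o\<^sub>L s t o\<^sub>L x o\<^sub>L ?k))
      = cayley_factor x (s t) t (Suc (Suc m))"
  proof -
    let ?y = "s t o\<^sub>L x o\<^sub>L (s t o\<^sub>L x o\<^sub>L ?k)"
    have 1: "s t o\<^sub>L x o\<^sub>L cayley_factor x (s t) t (Suc m) = real (m + 2) *\<^sub>R ?y"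
      by (rule blinfun_eqI) (simp only: cayley_factor.simps blinfun.bilinear_simps blinfun_apply_blinfun_compose)
    have 2: "s t o\<^sub>L x o\<^sub>L s t o\<^sub>L x o\<^sub>L ?k = ?y"
      by (rule blinfun_eqI) simp
    have 3: "cayley_factor x (s t) t (Suc (Suc m)) = real (Suc m + 2) *\<^sub>R (real (m + 2) *\<^sub>R ?y)"
      unfolding cayley_factor.simps(2)[of x "s t" t "Suc m"] 1 ..
    have "real (m + 2) *\<^sub>R ?y + ?y = (real (m + 2) + 1) *\<^sub>R ?y"
      by (simp only: scaleR_left_distrib scaleR_one)
    then have "real (m + 2) *\<^sub>R ?y + ?y = real (Suc m + 2) *\<^sub>R ?y" by simp
    then show ?thesis
      unfolding 1 2 3 by (simp add: mult.commute)
  qed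
  ultimately show ?case by simp
qed

end

context complex_hilbert_space
begin

lemma has_length_le:
  assumes "has_length \<alpha> 0 1 L"
    and v: "\<And>t. t \<in> {0..1} \<Longrightarrow> has_hs_derivative \<alpha> (v t) t {0..1}"
    and C: "\<And>t. t \<in> {0..1} \<Longrightarrow> left_metric (\<alpha> t) (v t) \<le> C"
  shows "L \<le> C"
proof -
  obtain V X where V: "\<And>t. t \<in> {0..1} \<Longrightarrow> \<alpha> t \<in> Sp2 J"
    "continuous_on {0..1} (\<lambda>t. Hs (\<alpha> t - id_blinfun))" "finite X"
    "\<And>t. t \<in> {0<..<1} - X \<Longrightarrow> ((\<lambda>s. Hs (\<alpha> s - id_blinfun)) has_vector_derivative V t) (at t)"
    "((\<lambda>t. left_metric (\<alpha> t) (hs_op (V t))) has_integral L) {0..1}"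
    using assms(1) by (rule has_lengthE) blast
  have "hs_op (V t) = v t" if t: "t \<in> {0<..<1} - X" for t
  proof -
    have at: "at t within {0..1} = at t" using t by (simp add: at_within_Icc_at)
    have "v t \<in> hilbert_schmidt \<and> ((\<lambda>s. Hs (\<alpha> s - id_blinfun)) has_vector_derivative Hs (v t)) (at t)"
      unfolding at[symmetric]
      by (rule iffD1[OF has_hs_derivative_iff v]) (use t V(1) Sp2_D in auto)
    then show ?thesis using vector_derivative_unique_at[OF V(4)[OF t]] by (metis Hs_inverse)
  qed
  then have "((\<lambda>t. left_metric (\<alpha> t) (v t)) has_integral L) {0..1}"
    by (intro has_integral_spike_finite[OF _ _ V(5), of "insert 0 (insert 1 X)"]) (auto simp: V(3))
  moreover have "((\<lambda>_. C) has_integral C) {0..1::real}"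
    using has_integral_const_real[of C 0 1] by simp
  ultimately show ?thesis using C by (rule has_integral_le)
qed

text \<open>Multiply the Cayley transform of \<open>g\<close> by \<open>t\<close> and transform
  back: the result is the quotient of \<open>(1 + t) g + (1 - t)\<close> by
  \<open>(1 - t) g + (1 + t)\<close>. The hypothesis on the numerical range makes the denominator
  coercive with constant \<open>1/2\<close> for all \<open>t\<close> in
  \<open>{0..1}\<close>.\<close>

lemma joined_cayley:
  assumes g: "g \<in> Sp2 J" and num: "\<And>v. - (norm v)\<^sup>2 / 2 \<le> g v \<bullet> v"
  obtains L where "joined id_blinfun g L"
    "L \<le> (1 + 4 * norm (g - id_blinfun)) * (4 + 8 * norm (g - id_blinfun)) * hs_norm (g - id_blinfun)"
proof -
  define x where "x = g - id_blinfun"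
  have x: "x \<in> hilbert_schmidt" unfolding x_def using g by (rule Sp2_D)
  have gS: "g \<in> Sp J" using g by (rule Sp2_D)
  have gx: "g u = u + x u" for u by (simp add: x_def blinfun.diff_left)
  define B where "B t = (1 - t) *\<^sub>R g + (1 + t) *\<^sub>R id_blinfun" for t
  define S where "S t = blinfun_inverse (B t)" for t
  have co: "(1/2) * (norm u)\<^sup>2 \<le> B t u \<bullet> u" if "t \<in> {0..1}" for t u
  proof -
    have "(1 - t) * (- (norm u)\<^sup>2 / 2) \<le> (1 - t) * (g u \<bullet> u)"
      using that by (intro mult_left_mono num) simp
    moreover have "0 \<le> 3 * t / 2 * (norm u)\<^sup>2" using that by simp
    moreover have "B t u \<bullet> u = (1 - t) * (g u \<bullet> u) + (1 + t) * (norm u)\<^sup>2"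
      by (simp add: B_def blinfun.bilinear_simps inner_add_left power2_norm_eq_inner)
    ultimately have "B t u \<bullet> u \<ge> (1 - t) * (- (norm u)\<^sup>2 / 2) + (1 + t) * (norm u)\<^sup>2" by linarith
    also have "(1 - t) * (- (norm u)\<^sup>2 / 2) + (1 + t) * (norm u)\<^sup>2 = (1/2) * (norm u)\<^sup>2 + 3 * t / 2 * (norm u)\<^sup>2"
      by (simp add: field_simps)
    finally show ?thesis using \<open>0 \<le> 3 * t / 2 * (norm u)\<^sup>2\<close> by linarith
  qed
  have BS: "B t (S t u) = u" "S t (B t u) = u" if "t \<in> {0..1}" for t u
    unfolding S_def using blinfun_inverse_apply[OF coercive_invertible[OF _ co[OF that]]] by auto
  have nS: "norm (S t) \<le> 2" if "t \<in> {0..1}" for t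
    unfolding S_def using norm_coercive_inverse[OF _ co[OF that]] by simp
  define \<alpha> where "\<alpha> t = id_blinfun + (x o\<^sub>L ((2 * t) *\<^sub>R S t))" for t
  define A where "A t u = (1 + t) *\<^sub>R g u + (1 - t) *\<^sub>R u" for t u
  \<comment> \<open>Because \<open>B t + 2 t x\<close> is the numerator \<open>A t\<close>.\<close>
  have \<alpha>B: "\<alpha> t (B t u) = A t u" if "t \<in> {0..1}" for t u
    by (simp add: \<alpha>_def blinfun.bilinear_simps BS[OF that])
      (simp add: A_def B_def gx blinfun.bilinear_simps algebra_simps flip: scaleR_2)
  have sym: "J (\<alpha> t u) \<bullet> \<alpha> t w = J u \<bullet> w" if t: "t \<in> {0..1}" for t u w
  proof -
    \<comment> \<open>The coefficients of \<open>A\<close> and \<open>B\<close> are interchanged.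
      Either side is \<open>(1 + t)^2 + (1 - t)^2\<close> times \<open>J u \<bullet> w\<close> plus
      \<open>1 - t^2\<close> times the same mixed terms.\<close>
    have "J (A t u) \<bullet> A t w = J (B t u) \<bullet> B t w" for u w
      by (simp add: A_def B_def blinfun.bilinear_simps inner_add_left inner_add_right Sp_D(2)[OF gS] algebra_simps)
    from this[of "S t u" "S t w"] show ?thesis
      by (simp add: \<alpha>B[OF t, symmetric] BS[OF t])
  qed
  have surj: "\<exists>k. \<forall>u. \<alpha> t (blinfun_apply k u) = u" if t: "t \<in> {0..1}" for t
  proof -
    let ?i = "blinfun_inverse g"
    \<comment> \<open>The numerator factors as \<open>g C\<close>. The inverse of \<open>g\<close>
      satisfies the same numerical range condition, its value at \<open>u\<close> being that of
      \<open>g\<close> at \<open>J u\<close>, so \<open>C\<close> is coercive too.\<close>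
    define C where "C = (1 + t) *\<^sub>R id_blinfun + (1 - t) *\<^sub>R ?i"
    have "(1/2) * (norm u)\<^sup>2 \<le> C u \<bullet> u" for u
    proof -
      have "?i u \<bullet> u = - (J (blinfun_adjoint g (J u)) \<bullet> u)"
        by (simp add: Sp_inverse[OF gS] blinfun.minus_left)
      also have "\<dots> = blinfun_adjoint g (J u) \<bullet> J u"
        by (simp only: inner_J_left minus_minus)
      also have "\<dots> = J u \<bullet> g (J u)"
        by (rule blinfun_adjoint_inner_left)
      also have "\<dots> = g (J u) \<bullet> J u" by (rule inner_commute)
      finally have "?i u \<bullet> u = g (J u) \<bullet> J u" .
      then have "- (norm u)\<^sup>2 / 2 \<le> ?i u \<bullet> u" using num[of "J u"] by simp
      then have "(1 - t) * (- (norm u)\<^sup>2 / 2) \<le> (1 - t) * (?i u \<bullet> u)"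
        using t by (intro mult_left_mono) simp_all
      moreover have "0 \<le> 3 * t / 2 * (norm u)\<^sup>2" using t by simp
      moreover have "C u \<bullet> u = (1 - t) * (?i u \<bullet> u) + (1 + t) * (norm u)\<^sup>2"
        by (simp add: C_def blinfun.bilinear_simps inner_add_left power2_norm_eq_inner)
      ultimately have "C u \<bullet> u \<ge> (1 - t) * (- (norm u)\<^sup>2 / 2) + (1 + t) * (norm u)\<^sup>2" by linarith
      also have "(1 - t) * (- (norm u)\<^sup>2 / 2) + (1 + t) * (norm u)\<^sup>2 = (1/2) * (norm u)\<^sup>2 + 3 * t / 2 * (norm u)\<^sup>2"
        by (simp add: field_simps)
      finally show ?thesis using \<open>0 \<le> 3 * t / 2 * (norm u)\<^sup>2\<close> by linarith
    qed
    then have inv: "blinfun_invertible C" by (intro coercive_invertible[of "1/2"]) auto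
    have gC: "A t w = g (C w)" for w
      by (simp add: A_def C_def blinfun.bilinear_simps gS)
    have "\<alpha> t ((B t o\<^sub>L blinfun_inverse C o\<^sub>L ?i) u) = u" for u
      by (simp add: \<alpha>B[OF t] gC blinfun_inverse_apply[OF inv] gS)
    then show ?thesis by blast
  qed
  have \<alpha>Sp: "\<alpha> t \<in> Sp2 J" if t: "t \<in> {0..1}" for t
  proof (rule Sp2_I)
    obtain k where "\<And>u. \<alpha> t (blinfun_apply k u) = u" using surj[OF t] by blast
    then show "\<alpha> t \<in> Sp J" using sym[OF t] by (intro Sp_I)
    show "\<alpha> t - id_blinfun \<in> hilbert_schmidt"
      by (simp add: \<alpha>_def hilbert_schmidt_compose_right x)
  qed
  have dS: "(S has_vector_derivative (S t o\<^sub>L x o\<^sub>L S t)) (at t within {0..1})" if t: "t \<in> {0..1}" for t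
  proof -
    \<comment> \<open>The resolvent identity, from \<open>B t - B r = (r - t) x\<close>.\<close>
    have diff: "S r - S t = (r - t) *\<^sub>R (S r o\<^sub>L x o\<^sub>L S t)" if r: "r \<in> {0..1}" for r
    proof (rule blinfun_eqI)
      fix u
      have "S r (B t (S t u)) - S r (B r (S t u)) = (r - t) *\<^sub>R S r (x (S t u))"
        by (simp add: B_def gx blinfun.bilinear_simps algebra_simps)
      then show "(S r - S t) u = ((r - t) *\<^sub>R (S r o\<^sub>L x o\<^sub>L S t)) u"
        by (simp add: BS[OF r] BS[OF t] blinfun.bilinear_simps)
    qed
    have lip: "norm (S r - S t) \<le> \<bar>r - t\<bar> * (4 * norm x)" if r: "r \<in> {0..1}" for r
    proof -
      have "norm (S r o\<^sub>L x o\<^sub>L S t) \<le> norm (S r) * norm x * norm (S t)"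
        by (meson norm_blinfun_compose mult_right_mono norm_ge_zero order_trans)
      also have "\<dots> \<le> 2 * norm x * 2"
        by (intro mult_mono) (simp_all add: nS[OF r] nS[OF t])
      finally show ?thesis unfolding diff[OF r] by (simp add: mult_left_mono)
    qed
    have lim: "((\<lambda>r. \<bar>r - t\<bar> * (4 * norm x) * norm (x o\<^sub>L S t)) \<longlongrightarrow> 0) (at t within {0..1})"
      by (auto intro!: tendsto_eq_intros)
    show ?thesis
      unfolding has_vector_derivative_iff_quotient
    proof (rule Lim_null_comparison[OF _ lim])
      have "norm (norm ((S r - S t) /\<^sub>R (r - t) - (S t o\<^sub>L x o\<^sub>L S t))) \<le> \<bar>r - t\<bar> * (4 * norm x) * norm (x o\<^sub>L S t)"
        if r: "r \<in> {0..1}" "r \<noteq> t" for r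
      proof -
        have q: "(S r - S t) /\<^sub>R (r - t) = S r o\<^sub>L x o\<^sub>L S t"
          unfolding diff[OF r(1)] using r(2) by simp
        have "(S r - S t) /\<^sub>R (r - t) - (S t o\<^sub>L x o\<^sub>L S t) = (S r - S t) o\<^sub>L (x o\<^sub>L S t)"
          unfolding q by (rule blinfun_eqI) (simp add: blinfun.bilinear_simps)
        also have "norm \<dots> \<le> norm (S r - S t) * norm (x o\<^sub>L S t)" by (rule norm_blinfun_compose)
        also have "\<dots> \<le> \<bar>r - t\<bar> * (4 * norm x) * norm (x o\<^sub>L S t)"
          by (rule mult_right_mono[OF lip[OF r(1)]]) simp
        finally show ?thesis by simp
      qed
      then show "\<forall>\<^sub>F r in at t within {0..1}. norm (norm ((S r - S t) /\<^sub>R (r - t) - (S t o\<^sub>L x o\<^sub>L S t)))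
          \<le> \<bar>r - t\<bar> * (4 * norm x) * norm (x o\<^sub>L S t)"
        by (simp add: eventually_at_filter)
    qed
  qed
  define D where "D n t = (case n of 0 \<Rightarrow> \<alpha> t | Suc m \<Rightarrow> x o\<^sub>L cayley_factor x (S t) t m)" for n t
  have D0: "D 0 = \<alpha>" and DS: "D (Suc m) = (\<lambda>t. x o\<^sub>L cayley_factor x (S t) t m)" for m
    by (simp_all add: D_def fun_eq_iff)
  have d0: "has_hs_derivative \<alpha> (x o\<^sub>L cayley_factor x (S t) t 0) t {0..1}" if t: "t \<in> {0..1}" for t
    using has_hs_derivative_hs_compose[OF cayley_factor_derivative_0[of S, OF dS[OF t]] x, of id_blinfun]
    unfolding \<alpha>_def .
  have "hs_smooth_on \<alpha> {0..1}"
    unfolding hs_smooth_on_def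
  proof (intro exI[of _ D] conjI ballI allI)
    fix n t assume t: "t \<in> {0..1::real}"
    show "has_hs_derivative (D n) (D (Suc n) t) t {0..1}"
    proof (cases n)
      case 0
      show ?thesis unfolding 0 D0 DS by (rule d0[OF t])
    next
      case (Suc m)
      show ?thesis
        using has_hs_derivative_hs_compose[OF cayley_factor_derivative[of S, OF dS[OF t]] x, of 0 m]
        unfolding Suc DS by simp
    qed
  qed (simp add: D0)
  then have pw: "piecewise_hs_smooth_on \<alpha> 0 1" by (intro piece) simp
  obtain L where L: "has_length \<alpha> 0 1 L"
    using piecewise_hs_smooth_on_has_length[OF pw \<alpha>Sp] by blast
  have "\<alpha> 0 = id_blinfun" by (simp add: \<alpha>_def)
  moreover have "\<alpha> 1 = g"
  proof (rule blinfun_eqI)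
    fix u
    show "\<alpha> 1 u = g u"
      using \<alpha>B[of 1 u] by (simp add: A_def B_def blinfun.bilinear_simps)
  qed
  ultimately have join: "joined id_blinfun g L" using joinedI[OF pw L] by simp
  \<comment> \<open>The speed is bounded by the norm of the inverse of \<open>\<alpha> t\<close>, at
    most \<open>1 + 4 * norm x\<close>, times that of the velocity, \<open>x\<close> followed by a
    factor of norm at most \<open>4 + 8 * norm x\<close>. Both constants come from
    \<open>norm (S t) \<le> 2\<close>.\<close>
  have "L \<le> (1 + 4 * norm x) * (4 + 8 * norm x) * hs_norm x"
  proof (rule has_length_le[OF L d0])
    fix t :: real assume t: "t \<in> {0..1}"
    let ?s = "S t"
    have "norm (\<alpha> t) \<le> norm (id_blinfun :: 'a \<Rightarrow>\<^sub>L 'a) + norm (x o\<^sub>L ((2 * t) *\<^sub>R ?s))"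
      unfolding \<alpha>_def by (rule norm_triangle_ineq)
    also have "\<dots> \<le> 1 + norm x * norm ((2 * t) *\<^sub>R ?s)"
      by (intro add_mono norm_blinfun_id_le norm_blinfun_compose)
    also have "norm ((2 * t) *\<^sub>R ?s) \<le> 2 * 2"
      using t nS[OF t] mult_mono[of "2 * t" 2 "norm ?s" 2] by simp
    finally have n\<alpha>: "norm (\<alpha> t) \<le> 1 + 4 * norm x"
      by (simp add: mult_left_mono)
    have sxs: "norm (?s o\<^sub>L x o\<^sub>L ?s) \<le> 2 * norm x * 2"
    proof -
      have "norm (?s o\<^sub>L x o\<^sub>L ?s) \<le> norm ?s * norm x * norm ?s"
        by (meson norm_blinfun_compose mult_right_mono norm_ge_zero order_trans)
      also have "\<dots> \<le> 2 * norm x * 2"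
        by (intro mult_mono) (simp_all add: nS[OF t])
      finally show ?thesis .
    qed
    have "norm (cayley_factor x ?s t 0) \<le> norm (2 *\<^sub>R ?s) + norm ((2 * t) *\<^sub>R (?s o\<^sub>L x o\<^sub>L ?s))"
      unfolding cayley_factor.simps by (rule norm_triangle_ineq)
    also have "\<dots> \<le> 2 * 2 + 2 * (2 * norm x * 2)"
      using t nS[OF t] sxs mult_mono[of "2 * t" 2 "norm (?s o\<^sub>L x o\<^sub>L ?s)" "2 * norm x * 2"]
      by (intro add_mono) simp_all
    finally have nc: "norm (cayley_factor x ?s t 0) \<le> 4 + 8 * norm x" by simp
    have "left_metric (\<alpha> t) (x o\<^sub>L cayley_factor x ?s t 0)
        \<le> norm (blinfun_inverse (\<alpha> t)) * hs_norm (x o\<^sub>L cayley_factor x ?s t 0)"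
      unfolding left_metric_def by (intro hs_norm_compose_left hilbert_schmidt_compose_right x)
    also have "\<dots> \<le> (1 + 4 * norm x) * (hs_norm x * (4 + 8 * norm x))"
    proof (rule mult_mono)
      show "norm (blinfun_inverse (\<alpha> t)) \<le> 1 + 4 * norm x"
        using norm_Sp_inverse_le[of "\<alpha> t"] Sp2_D(1)[OF \<alpha>Sp[OF t]] n\<alpha> by simp
      show "hs_norm (x o\<^sub>L cayley_factor x ?s t 0) \<le> hs_norm x * (4 + 8 * norm x)"
        using hs_norm_compose_right[OF x, of "cayley_factor x ?s t 0"]
          mult_left_mono[OF nc hs_norm_nonneg[of x]] by simp
    qed simp_all
    finally show "left_metric (\<alpha> t) (x o\<^sub>L cayley_factor x ?s t 0)
        \<le> (1 + 4 * norm x) * (4 + 8 * norm x) * hs_norm x" by (simp add: mult_ac)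
  qed
  with join show thesis unfolding x_def by (rule that)
qed

end

section \<open>Connectedness of the restricted symplectic group\<close>

context complex_hilbert_space
begin

definition connected_to_id :: "('a \<Rightarrow>\<^sub>L 'a) \<Rightarrow> bool" where
  "connected_to_id g \<longleftrightarrow> (\<exists>L. joined id_blinfun g L)"

text \<open>A path from the identity to \<open>h\<close>, translated by \<open>g\<close> on the
  left, joins \<open>g\<close> to \<open>g o\<^sub>L h\<close>.\<close>

lemma connected_to_id_cancel_right:
  assumes "g \<in> Sp2 J" "connected_to_id h" "connected_to_id (g o\<^sub>L h)"
  shows "connected_to_id g"
proof -
  obtain L M where "joined id_blinfun h L" "joined id_blinfun (g o\<^sub>L h) M"
    using assms(2,3) unfolding connected_to_id_def by blast
  moreover from this have "joined (g o\<^sub>L id_blinfun) (g o\<^sub>L h) L"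
    using joined_compose_left assms(1) by blast
  moreover have "g o\<^sub>L id_blinfun = g" by (rule blinfun_eqI) simp
  ultimately show ?thesis
    unfolding connected_to_id_def using joined_trans joined_sym by metis
qed

lemma connected_to_id_cayley:
  assumes "g \<in> Sp2 J" "\<And>v. - (norm v)\<^sup>2 / 2 \<le> g v \<bullet> v"
  shows "connected_to_id g"
  using joined_cayley[OF assms] unfolding connected_to_id_def by blast

section \<open>Rotations and sign changes on complex lines\<close>

definition line_projection :: "'a \<Rightarrow> 'a \<Rightarrow>\<^sub>L 'a" where
  "line_projection v = Blinfun (\<lambda>x. (x \<bullet> v) *\<^sub>R v + (x \<bullet> J v) *\<^sub>R J v)"

text \<open>A right-angle rotation of the complex line through a unit vector \<open>v\<close>: its square is
  \<open>-1\<close> on that line, but its numerical range is nonnegative, as the Cayley path requires.\<close>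

definition line_rotation :: "'a \<Rightarrow> 'a \<Rightarrow>\<^sub>L 'a" where
  "line_rotation v = id_blinfun - line_projection v + (J o\<^sub>L line_projection v)"

lemma line_projection_apply [simp]:
  "line_projection v x = (x \<bullet> v) *\<^sub>R v + (x \<bullet> J v) *\<^sub>R J v"
  unfolding line_projection_def
  by (subst bounded_linear_Blinfun_apply) (auto intro!: bounded_linear_intros)

lemma line_projection_has_sum:
  assumes "norm v = 1"
  shows "((\<lambda>e. (norm (line_projection v e))\<^sup>2) has_sum 2) the_basis"
proof -
  have v: "v \<bullet> v = 1" using assms by (simp add: dot_square_norm)
  have "(norm (line_projection v e))\<^sup>2 = (v \<bullet> e)\<^sup>2 + (J v \<bullet> e)\<^sup>2" for e
    unfolding power2_norm_eq_inner
    by (simp add: inner_add_left inner_add_right v power2_eq_square inner_commute)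
  moreover have "((\<lambda>e. (v \<bullet> e)\<^sup>2 + (J v \<bullet> e)\<^sup>2) has_sum (norm v)\<^sup>2 + (norm (J v))\<^sup>2) the_basis"
    by (intro has_sum_add parseval)
  ultimately show ?thesis using assms by simp
qed

lemma line_projection_hilbert_schmidt: "norm v = 1 \<Longrightarrow> line_projection v \<in> hilbert_schmidt"
  unfolding hilbert_schmidt_iff using line_projection_has_sum summable_on_def by blast

lemma
  assumes "norm v = 1"
  shows line_rotation_Sp2: "line_rotation v \<in> Sp2 J"
    and line_rotation_connected: "connected_to_id (line_rotation v)"
    and line_rotation_twice: "line_rotation v (line_rotation v x) = x - 2 *\<^sub>R line_projection v x"
proof -
  let ?r = "line_rotation v" and ?q = "line_projection v"
  have v: "v \<bullet> v = 1" using assms by (simp add: dot_square_norm)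
  have r: "?r x = x - ((x \<bullet> v) *\<^sub>R v + (x \<bullet> J v) *\<^sub>R J v) + ((x \<bullet> v) *\<^sub>R J v - (x \<bullet> J v) *\<^sub>R v)" for x
    by (simp add: line_rotation_def blinfun.bilinear_simps)
  have rv: "?r x \<bullet> v = - (x \<bullet> J v)" "?r x \<bullet> J v = x \<bullet> v" for x
    by (simp_all add: r inner_add_left inner_diff_left v)
  show twice: "?r (?r x) = x - 2 *\<^sub>R ?q x" for x
    unfolding r[of "?r x"] rv scaleR_2 by (simp add: r algebra_simps)
  have iso: "?r x \<bullet> ?r y = x \<bullet> y" for x y
    unfolding r[of y] by (simp add: inner_add_right inner_diff_right rv)
      (simp add: r inner_add_left inner_diff_left inner_commute[of v] inner_commute[of "J v"])
  have comm: "J (?r x) = ?r (J x)" for x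
    by (simp add: r blinfun.bilinear_simps inner_J_left)
  \<comment> \<open>The rotated part \<open>J (?q x)\<close> is orthogonal to \<open>x\<close>, so
    only the squared norm of \<open>x - ?q x\<close> remains.\<close>
  have num: "0 \<le> ?r x \<bullet> x" for x
  proof -
    have "0 \<le> (norm (x - ?q x))\<^sup>2" by simp
    also have "(norm (x - ?q x))\<^sup>2 = ?r x \<bullet> x"
      unfolding power2_norm_eq_inner
      by (simp add: r inner_add_left inner_diff_left inner_add_right inner_diff_right v inner_commute)
    finally show ?thesis .
  qed
  \<comment> \<open>The fourth power is the identity, which makes the third power the right
    inverse.\<close>
  have "?r (?r (?r (?r x))) = x" for x
    unfolding twice by (simp add: blinfun.bilinear_simps inner_diff_left inner_add_left v scaleR_2)
  then have "?r \<in> Sp J"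
    by (intro Sp_I[where k="?r o\<^sub>L ?r o\<^sub>L ?r"]) (simp_all add: comm iso)
  moreover have "?r - id_blinfun \<in> hilbert_schmidt"
  proof -
    have "?r - id_blinfun = (J o\<^sub>L ?q) - ?q" by (simp add: line_rotation_def)
    then show ?thesis
      by (simp only: line_projection_hilbert_schmidt[OF assms] hilbert_schmidt_diff hilbert_schmidt_compose_left)
  qed
  ultimately show Sp2: "?r \<in> Sp2 J" by (rule Sp2_I)
  have "- (norm x)\<^sup>2 / 2 \<le> ?r x \<bullet> x" for x
    using num[of x] zero_le_power2[of "norm x"] by linarith
  then show "connected_to_id ?r" using Sp2 by (rule connected_to_id_cayley[rotated])
qed

text \<open>\<open>g + J g J\<close> is twice the antilinear part of \<open>g\<close>. While it is small, a vector violating the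
  hypothesis of the Cayley lemma can be removed by a sign change on its complex line, which
  lowers \<open>hs_norm (g - 1)\<^sup>2\<close> by at least 3.\<close>

lemma connected_to_id_if_almost_linear:
  assumes "g \<in> Sp2 J" "norm (g + (J o\<^sub>L g o\<^sub>L J)) \<le> 1 / 4"
    and "(hs_norm (g - id_blinfun))\<^sup>2 < 3 * real n"
  shows "connected_to_id g"
  using assms
proof (induction n arbitrary: g)
  case 0
  then show ?case by simp
next
  case (Suc n)
  let ?D = "g + (J o\<^sub>L g o\<^sub>L J)"
  show ?case
  proof (cases "\<forall>v. - (norm v)\<^sup>2 / 2 \<le> g v \<bullet> v")
    case True
    then show ?thesis using connected_to_id_cayley Suc.prems(1) by blast
  next
    case False
    then obtain w where w: "g w \<bullet> w < - (norm w)\<^sup>2 / 2" by (auto simp: not_le)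
    then have w0: "w \<noteq> 0" by auto
    define v where "v = w /\<^sub>R norm w"
    have v: "norm v = 1" using w0 by (simp add: v_def)
    have gv: "g v \<bullet> v < - 1 / 2"
    proof -
      have "g v \<bullet> v = (g w \<bullet> w) / (norm w)\<^sup>2"
        by (simp add: v_def blinfun.scaleR_right power2_eq_square divide_inverse mult_ac)
      also have "\<dots> < - 1 / 2" using w w0 by (simp add: divide_less_eq)
      finally show ?thesis .
    qed
    let ?r = "line_rotation v" and ?q = "line_projection v"
    \<comment> \<open>The sign change: \<open>-1\<close> on the line and \<open>1\<close> on its
      complement. The Cayley lemma does not apply to it, since \<open>h v \<bullet> v = -1\<close>;
      it enters as two rotations that are cancelled one at a time at the end.\<close>
    define h where "h = ?r o\<^sub>L ?r"
    have h: "h x = x - 2 *\<^sub>R ?q x" for x unfolding h_def using line_rotation_twice[OF v] by simp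
    have vv: "v \<bullet> v = 1" using v by (simp add: dot_square_norm)
    have hh: "h (h x) = x" for x
      unfolding h by (simp add: blinfun.bilinear_simps inner_diff_left inner_add_left vv scaleR_2)
    have hJ: "h (J x) = J (h x)" for x
      unfolding h by (simp add: blinfun.bilinear_simps inner_J_left)
    have nh: "norm (h x) = norm x" for x
    proof -
      have "h x \<bullet> h x = x \<bullet> x"
        unfolding h by (simp add: inner_diff_left inner_diff_right inner_add_left inner_add_right vv inner_commute)
      then show ?thesis by (simp add: norm_eq_sqrt_inner)
    qed
    have nh1: "norm h \<le> 1" by (rule norm_blinfun_bound) (simp_all add: nh)
    have gh: "g o\<^sub>L h \<in> Sp2 J"
      unfolding h_def by (intro Sp2_compose Suc.prems(1) line_rotation_Sp2 v)
    \<comment> \<open>As \<open>h\<close> commutes with \<open>J\<close>, the antilinear part is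
      merely multiplied by the isometry \<open>h\<close>, and the smallness assumption
      persists.\<close>
    have "(g o\<^sub>L h) + (J o\<^sub>L (g o\<^sub>L h) o\<^sub>L J) = ?D o\<^sub>L h"
      by (rule blinfun_eqI) (simp add: blinfun.bilinear_simps hJ)
    then have "norm ((g o\<^sub>L h) + (J o\<^sub>L (g o\<^sub>L h) o\<^sub>L J)) \<le> norm ?D * norm h"
      by (simp add: norm_blinfun_compose)
    also have "\<dots> \<le> norm ?D * 1" by (rule mult_left_mono[OF nh1]) simp
    finally have D: "norm ((g o\<^sub>L h) + (J o\<^sub>L (g o\<^sub>L h) o\<^sub>L J)) \<le> 1 / 4"
      using Suc.prems(2) by simp
    define a where "a = g - id_blinfun"
    have a: "a \<in> hilbert_schmidt" unfolding a_def using Suc.prems(1) by (rule Sp2_D)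
    \<comment> \<open>This is \<open>g - h\<close>. Since \<open>h\<close> is an involution,
      \<open>g h - 1 = (g - h) h\<close>.\<close>
    let ?c = "a + 2 *\<^sub>R ?q"
    have c: "?c \<in> hilbert_schmidt"
      by (intro hilbert_schmidt_add hilbert_schmidt_scaleR a line_projection_hilbert_schmidt v)
    \<comment> \<open>The mixed term is written in coefficients of \<open>v\<close>,
      \<open>J v\<close> and their images under the adjoint of \<open>a\<close>, so that Parseval
      sums it to the trace of \<open>a\<close> over the line.\<close>
    have "(norm (?c e))\<^sup>2 = (norm (a e))\<^sup>2 + 4 * ((v \<bullet> e) * (blinfun_adjoint a v \<bullet> e)
        + (J v \<bullet> e) * (blinfun_adjoint a (J v) \<bullet> e)) + 4 * (norm (?q e))\<^sup>2" for e
      unfolding power2_norm_eq_inner blinfun_adjoint_inner_left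
      by (simp add: blinfun.bilinear_simps inner_add_left inner_add_right inner_commute algebra_simps)
    moreover have "((\<lambda>e. (norm (a e))\<^sup>2 + 4 * ((v \<bullet> e) * (blinfun_adjoint a v \<bullet> e)
        + (J v \<bullet> e) * (blinfun_adjoint a (J v) \<bullet> e)) + 4 * (norm (?q e))\<^sup>2) has_sum
      ((hs_norm a)\<^sup>2 + 4 * (v \<bullet> blinfun_adjoint a v + J v \<bullet> blinfun_adjoint a (J v)) + 4 * 2)) the_basis"
      by (intro has_sum_add has_sum_cmult_right hs_norm_has_sum a parseval_inner line_projection_has_sum v)
    ultimately have "(hs_norm ?c)\<^sup>2 =
        (hs_norm a)\<^sup>2 + 4 * (v \<bullet> blinfun_adjoint a v + J v \<bullet> blinfun_adjoint a (J v)) + 4 * 2"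
      using has_sum_unique[OF hs_norm_has_sum[OF c]] by simp
    \<comment> \<open>With \<open>a = g - 1\<close> the identity contributes \<open>-8\<close>,
      which cancels the squared norm of \<open>2 *\<^sub>R ?q\<close>.\<close>
    also have "\<dots> = (hs_norm a)\<^sup>2 + 4 * (g v \<bullet> v + g (J v) \<bullet> J v)"
      by (simp add: blinfun_adjoint_inner_right a_def blinfun.bilinear_simps inner_diff_left vv)
    \<comment> \<open>The antilinear part measures how far \<open>g\<close> may differ at
      \<open>J v\<close> from its value at \<open>v\<close>.\<close>
    also have "g (J v) \<bullet> J v = g v \<bullet> v - ?D v \<bullet> v"
      by (simp add: blinfun.bilinear_simps inner_add_left inner_J_left)
    finally have eq: "(hs_norm ?c)\<^sup>2 = (hs_norm a)\<^sup>2 + 4 * (g v \<bullet> v + (g v \<bullet> v - ?D v \<bullet> v))" .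
    have "\<bar>?D v \<bullet> v\<bar> \<le> norm (?D v) * norm v" by (rule Cauchy_Schwarz_ineq2)
    also have "\<dots> \<le> norm ?D" using norm_blinfun[of ?D v] v by simp
    finally have "- (?D v \<bullet> v) \<le> 1 / 4" using Suc.prems(2) by linarith
    \<comment> \<open>The constant 3: twice a value below \<open>-1/2\<close>, plus at most
      \<open>1/4\<close>, is below \<open>-3/4\<close>.\<close>
    then have "4 * (g v \<bullet> v + (g v \<bullet> v - ?D v \<bullet> v)) < - 3" using gv by simp
    then have "(hs_norm ?c)\<^sup>2 < (hs_norm a)\<^sup>2 - 3" unfolding eq by simp
    moreover have "hs_norm ((g o\<^sub>L h) - id_blinfun) \<le> hs_norm ?c"
    proof -
      have "(g o\<^sub>L h) - id_blinfun = ?c o\<^sub>L h"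
      proof (rule blinfun_eqI)
        fix x
        have "?c (h x) = g (h x) - h x + 2 *\<^sub>R ?q (h x)"
          by (simp add: a_def blinfun.bilinear_simps)
        also have "2 *\<^sub>R ?q (h x) = h x - h (h x)" unfolding h[of "h x"] by simp
        finally show "((g o\<^sub>L h) - id_blinfun) x = (?c o\<^sub>L h) x"
          by (simp add: hh blinfun.bilinear_simps)
      qed
      then have "hs_norm ((g o\<^sub>L h) - id_blinfun) \<le> hs_norm ?c * norm h"
        using hs_norm_compose_right[OF c, of h] by simp
      also have "\<dots> \<le> hs_norm ?c * 1" by (rule mult_left_mono[OF nh1]) simp
      finally show ?thesis by simp
    qed
    then have "(hs_norm ((g o\<^sub>L h) - id_blinfun))\<^sup>2 \<le> (hs_norm ?c)\<^sup>2"
      by (rule power_mono) simp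
    ultimately have "(hs_norm ((g o\<^sub>L h) - id_blinfun))\<^sup>2 < 3 * real n"
      using Suc.prems(3) of_nat_Suc[of n, where 'a=real] unfolding a_def by argo
    from Suc.IH[OF gh D this] have "connected_to_id (g o\<^sub>L h)" .
    moreover have "g o\<^sub>L h = (g o\<^sub>L ?r) o\<^sub>L ?r"
      unfolding h_def by (rule blinfun_eqI) simp
    ultimately have "connected_to_id (g o\<^sub>L ?r)"
      using connected_to_id_cancel_right[of "g o\<^sub>L ?r" ?r] Suc.prems(1) Sp2_compose
        line_rotation_Sp2[OF v] line_rotation_connected[OF v] by simp
    then show ?thesis
      using connected_to_id_cancel_right[of g ?r] Suc.prems(1) line_rotation_connected[OF v] by simp
  qed
qed

section \<open>Polar decomposition by Halley's iteration\<close>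

lemma adjoint_Sp2:
  assumes g: "g \<in> Sp2 J"
  shows "blinfun_adjoint g \<in> Sp2 J"
proof (rule Sp2_I)
  have gS: "g \<in> Sp J" using g by (rule Sp2_D)
  \<comment> \<open>The adjoint is the inverse conjugated by \<open>J\<close>, and \<open>J\<close>
    preserves the form.\<close>
  have adj: "blinfun_adjoint g x = - J (blinfun_inverse g (J x))" for x
    by (simp add: Sp_inverse[OF gS] blinfun.bilinear_simps)
  show "blinfun_adjoint g \<in> Sp J"
  proof (rule Sp_I)
    fix x y
    show "J (blinfun_adjoint g x) \<bullet> blinfun_adjoint g y = J x \<bullet> y"
      using Sp_D(2)[OF Sp_inverse_closed[OF gS], of "J x" "J y"]
      by (simp add: adj blinfun.bilinear_simps)
        (simp add: inner_J_left)
  next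
    fix x
    show "blinfun_adjoint g (blinfun_adjoint (blinfun_inverse g) x) = x"
    proof (rule inner_eqI)
      fix z
      show "blinfun_adjoint g (blinfun_adjoint (blinfun_inverse g) x) \<bullet> z = x \<bullet> z"
        by (simp add: blinfun_adjoint_inner_left gS)
    qed
  qed
  have "blinfun_adjoint g - id_blinfun = blinfun_adjoint (g - id_blinfun)"
    by (rule blinfun_adjoint_unique[symmetric])
      (simp add: blinfun.bilinear_simps inner_diff_left inner_diff_right blinfun_adjoint_inner_right)
  then show "blinfun_adjoint g - id_blinfun \<in> hilbert_schmidt"
    using hilbert_schmidt_adjoint[OF Sp2_D(2)[OF g]] by simp
qed

text \<open>One Halley step for the polar decomposition: with \<open>p = g\<^sup>* g\<close>, right multiplication by
  \<open>(p + 3) (3 p + 1)\<^sup>-\<^sup>1\<close> reduces the antilinear part of \<open>g\<close> by a factor of 3.\<close>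

lemma halley_step:
  assumes g: "g \<in> Sp2 J"
  obtains w where "w \<in> Sp2 J" "connected_to_id w"
    "norm ((g o\<^sub>L w) + (J o\<^sub>L (g o\<^sub>L w) o\<^sub>L J)) \<le> norm (g + (J o\<^sub>L g o\<^sub>L J)) / 3"
proof -
  define p where "p = blinfun_adjoint g o\<^sub>L g"
  have gS: "g \<in> Sp J" using g by (rule Sp2_D)
  have p2: "p \<in> Sp2 J" unfolding p_def by (intro Sp2_compose adjoint_Sp2 g)
  then have pS: "p \<in> Sp J" by (rule Sp2_D)
  have psym: "p x \<bullet> y = x \<bullet> p y" for x y
    by (simp add: p_def blinfun_adjoint_inner_left blinfun_adjoint_inner_right)
  have ppos: "0 \<le> p x \<bullet> x" for x
    by (simp add: p_def blinfun_adjoint_inner_left)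
  \<comment> \<open>The quotient of \<open>A\<close> by \<open>B\<close> is a rational approximation
    to the inverse square root of \<open>p\<close>, namely the inverse of the midpoint of the Cayley
    path from the identity to \<open>p\<close>. Since \<open>p\<close> is positive, both operators
    are coercive.\<close>
  define A where "A = p + 3 *\<^sub>R id_blinfun"
  define B where "B = 3 *\<^sub>R p + id_blinfun"
  have A: "A x = p x + 3 *\<^sub>R x" and B: "B x = 3 *\<^sub>R p x + x" for x
    by (simp_all add: A_def B_def blinfun.bilinear_simps)
  have invA: "blinfun_invertible A"
    by (rule coercive_invertible[of 1]) (use ppos in \<open>auto simp: A inner_add_left power2_norm_eq_inner add_increasing\<close>)
  have invB: "blinfun_invertible B"
    by (rule coercive_invertible[of 1]) (use ppos in \<open>auto simp: B inner_add_left power2_norm_eq_inner\<close>)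
  let ?a = "blinfun_inverse A" and ?b = "blinfun_inverse B"
  note Aa = blinfun_inverse_apply[OF invA] and Bb = blinfun_inverse_apply[OF invB]
  define w where "w = A o\<^sub>L ?b"
  have AB: "A (B x) = B (A x)" for x
    by (simp add: A B blinfun.bilinear_simps algebra_simps)
  have wB: "w (B x) = A x" for x by (simp add: w_def Bb)
  have bA: "A (?b x) = ?b (A x)" for x
    using arg_cong[OF AB[of "?b x"], of ?b] by (simp add: Bb)
  \<comment> \<open>Interchanged coefficients again: both forms are 10 times
    \<open>J x \<bullet> y\<close> plus 3 times the mixed terms.\<close>
  have AJA: "J (A x) \<bullet> A y = J (B x) \<bullet> B y" for x y
    by (simp add: A B blinfun.bilinear_simps inner_add_left inner_add_right Sp_D(2)[OF pS])
  have "J (w x) \<bullet> w y = J x \<bullet> y" for x y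
    using AJA[of "?b x" "?b y"] by (simp add: w_def Bb)
  moreover have "w ((B o\<^sub>L ?a) x) = x" for x
    by (simp add: wB Aa)
  ultimately have wS: "w \<in> Sp J" by (rule Sp_I)
  have "w - id_blinfun = (-2) *\<^sub>R ((p - id_blinfun) o\<^sub>L ?b)"
  proof (rule blinfun_eqI)
    fix x
    have "w (B y) - B y = (-2) *\<^sub>R (p y - y)" for y
    proof -
      have "(3::real) *\<^sub>R u = u + 2 *\<^sub>R u" for u :: 'a
        using scaleR_left_distrib[of 1 2 u] by simp
      then show ?thesis unfolding wB unfolding A B by (simp add: scaleR_diff_right)
    qed
    from this[of "?b x"] show "(w - id_blinfun) x = ((-2) *\<^sub>R ((p - id_blinfun) o\<^sub>L ?b)) x"
      by (simp add: Bb blinfun.bilinear_simps)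
  qed
  then have "w - id_blinfun \<in> hilbert_schmidt"
    using Sp2_D(2)[OF p2] by (simp only: hilbert_schmidt_scaleR hilbert_schmidt_compose_right)
  with wS have w2: "w \<in> Sp2 J" by (rule Sp2_I)
  have "- (norm x)\<^sup>2 / 2 \<le> w x \<bullet> x" for x
  proof -
    let ?y = "?b x"
    have "w x \<bullet> x = A ?y \<bullet> B ?y" using wB[of ?y] by (simp add: Bb)
    also have "\<dots> = 3 * (p ?y \<bullet> p ?y) + 10 * (p ?y \<bullet> ?y) + 3 * (?y \<bullet> ?y)"
      by (simp add: A B inner_add_left inner_add_right inner_commute)
    finally have "0 \<le> w x \<bullet> x" using ppos[of ?y] by simp
    then show ?thesis using zero_le_power2[of "norm x"] by linarith
  qed
  then have conn: "connected_to_id w" using w2 by (rule connected_to_id_cayley[rotated])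
  let ?D = "g + (J o\<^sub>L g o\<^sub>L J)"
  \<comment> \<open>The formula for the inverse of \<open>g\<close>, read as
    \<open>J g J p = - g\<close>. It makes the antilinear part a multiple of
    \<open>p - 1\<close>.\<close>
  have gJ: "g x = - J (g (J (p x)))" for x
  proof -
    have "g (- J (blinfun_adjoint g (J z))) = z" for z
      using Sp_inverse_apply(1)[OF gS, of z] by (simp add: Sp_inverse[OF gS] blinfun.bilinear_simps)
    from this[of "- J (g x)"] have "g (- J (blinfun_adjoint g (g x))) = - J (g x)"
      by (simp add: blinfun.bilinear_simps)
    from arg_cong[OF this, of J] show ?thesis by (simp add: p_def blinfun.bilinear_simps)
  qed
  have D: "?D x = - J (g (J (p x - x)))" for x
    using gJ[of x] by (simp add: blinfun.bilinear_simps)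
  \<comment> \<open>Conjugation by \<open>J\<close> inverts \<open>w\<close>. This follows from
    \<open>AJA\<close> because \<open>A\<close> and \<open>B\<close> are symmetric.\<close>
  have wJ: "w (J (A x)) = J (B x)" for x
  proof -
    have "A (J (A x)) = B (J (B x))"
    proof (rule inner_eqI)
      fix z
      have "A u \<bullet> z = u \<bullet> A z" "B u \<bullet> z = u \<bullet> B z" for u
        by (simp_all add: A B inner_add_left inner_add_right psym)
      then show "A (J (A x)) \<bullet> z = B (J (B x)) \<bullet> z" using AJA by simp
    qed
    then show ?thesis by (simp add: w_def bA Bb)
  qed
  have "norm (((g o\<^sub>L w) + (J o\<^sub>L (g o\<^sub>L w) o\<^sub>L J)) x) \<le> norm ?D / 3 * norm x" for x
  proof -
    \<comment> \<open>With \<open>x = A (B y)\<close> both denominators disappear and only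
      polynomials in \<open>p\<close> remain.\<close>
    define y where "y = ?b (?a x)"
    have x: "x = A (B y)" by (simp add: y_def Bb Aa)
    have nine: "9 *\<^sub>R u = u + (2 *\<^sub>R u + (3 *\<^sub>R u + 3 *\<^sub>R u))" for u :: 'a
    proof -
      have "(1 + (2 + (3 + 3))) *\<^sub>R u = u + (2 *\<^sub>R u + (3 *\<^sub>R u + 3 *\<^sub>R u))"
        by (simp only: scaleR_left_distrib scaleR_one)
      then show ?thesis by simp
    qed
    define m where "m = p (p y - y) - (p y - y)"
    have "((g o\<^sub>L w) + (J o\<^sub>L (g o\<^sub>L w) o\<^sub>L J)) x = g (A (A y)) + J (g (J (B (B y))))"
      by (simp add: blinfun.bilinear_simps x wJ) (simp add: AB wB)
    also have "\<dots> = - J (g (J (p (A (A y)) - B (B y))))"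
      unfolding gJ[of "A (A y)"] by (simp add: blinfun.bilinear_simps)
    \<comment> \<open>The identity \<open>p (p + 3)^2 - (3 p + 1)^2 = (p - 1)^3\<close>, with
      \<open>m = (p - 1)^2 y\<close>. It reflects the cubic convergence of Halley's method.\<close>
    also have "p (A (A y)) - B (B y) = p m - m"
      by (simp add: nine A B m_def blinfun.bilinear_simps algebra_simps flip: scaleR_2)
    also have "- J (g (J (p m - m))) = ?D m" by (rule D[symmetric])
    finally have "norm (((g o\<^sub>L w) + (J o\<^sub>L (g o\<^sub>L w) o\<^sub>L J)) x) \<le> norm ?D * norm m"
      using norm_blinfun[of ?D m] by simp
    also have "norm m \<le> norm x / 3"
    proof -
      \<comment> \<open>The identity \<open>(p + 3) (3 p + 1) = 3 (p - 1)^2 + 16 p\<close> is the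
        source of the factor \<open>1/3\<close>: as \<open>p\<close> is positive, the two summands
        applied to \<open>y\<close> have nonnegative inner product, so \<open>x\<close> is at least
        as long as \<open>3 m\<close>.\<close>
      have xm: "x = 3 *\<^sub>R m + 16 *\<^sub>R p y"
        using scaleR_left_distrib[of 1 15 "p y"]
        by (simp add: x A B m_def blinfun.bilinear_simps algebra_simps flip: scaleR_add_left)
      have "m \<bullet> p y = p (p y - y) \<bullet> (p y - y)"
        by (simp add: m_def inner_diff_left inner_diff_right psym blinfun.bilinear_simps inner_commute)
      then have "0 \<le> m \<bullet> p y" using ppos by simp
      moreover have "(norm x)\<^sup>2 = 9 * (norm m)\<^sup>2 + 96 * (m \<bullet> p y) + 256 * (norm (p y))\<^sup>2"
        unfolding xm power2_norm_eq_inner by (simp add: inner_add_left inner_add_right inner_commute)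
      ultimately have "(3 * norm m)\<^sup>2 \<le> (norm x)\<^sup>2" by (simp add: power_mult_distrib)
      then have "3 * norm m \<le> norm x" by (rule power2_le_imp_le) simp
      then show ?thesis by simp
    qed
    finally show ?thesis by (simp add: mult_left_mono)
  qed
  then have "norm ((g o\<^sub>L w) + (J o\<^sub>L (g o\<^sub>L w) o\<^sub>L J)) \<le> norm ?D / 3"
    by (intro norm_blinfun_bound) simp_all
  with w2 conn show thesis by (rule that)
qed

text \<open>Each Halley step gains a factor 3 and multiplies \<open>g\<close> by an element already
  joined to the identity; after \<open>n\<close> steps the threshold \<open>1/4\<close> is
  reached.\<close>

lemma connected_to_id_if_antilinear_part_le:
  assumes "g \<in> Sp2 J" "norm (g + (J o\<^sub>L g o\<^sub>L J)) \<le> 3 ^ n / 4"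
  shows "connected_to_id g"
  using assms
proof (induction n arbitrary: g)
  case 0
  obtain n :: nat where "(hs_norm (g - id_blinfun))\<^sup>2 / 3 < real n"
    using reals_Archimedean2 by blast
  then show ?case using connected_to_id_if_almost_linear[of g n] 0 by simp
next
  case (Suc n)
  obtain w where w: "w \<in> Sp2 J" "connected_to_id w"
    "norm ((g o\<^sub>L w) + (J o\<^sub>L (g o\<^sub>L w) o\<^sub>L J)) \<le> norm (g + (J o\<^sub>L g o\<^sub>L J)) / 3"
    using halley_step[OF Suc.prems(1)] by blast
  have "norm ((g o\<^sub>L w) + (J o\<^sub>L (g o\<^sub>L w) o\<^sub>L J)) \<le> 3 ^ n / 4"
    using w(3) Suc.prems(2) by simp
  then have "connected_to_id (g o\<^sub>L w)"
    using Suc.IH[of "g o\<^sub>L w"] Sp2_compose[OF Suc.prems(1) w(1)] by simp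
  then show ?case using connected_to_id_cancel_right Suc.prems(1) w(2) by blast
qed

lemma Sp2_connected_to_id:
  assumes "g \<in> Sp2 J"
  shows "connected_to_id g"
proof -
  obtain n where "4 * norm (g + (J o\<^sub>L g o\<^sub>L J)) < 3 ^ n"
    using real_arch_pow[of 3 "4 * norm (g + (J o\<^sub>L g o\<^sub>L J))"] by auto
  then show ?thesis using connected_to_id_if_antilinear_part_le[OF assms, of n] by simp
qed

end

section \<open>The geodesic distance\<close>

context complex_hilbert_space
begin

lemma Sp2_joined:
  assumes "p \<in> Sp2 J" "q \<in> Sp2 J"
  shows "\<exists>L. joined p q L"
  using assms[THEN Sp2_connected_to_id] joined_sym joined_trans unfolding connected_to_id_def by metis

lemma geodesic_dist_eq:
  "p \<in> Sp2 J \<Longrightarrow> q \<in> Sp2 J \<Longrightarrow> geodesic_dist J p q = Inf {L. joined p q L}"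
  unfolding geodesic_dist_def curve_lengths_eq by simp

lemma bdd_below_joined: "bdd_below {L. joined p q L}"
  using joined_nonneg by (intro bdd_belowI[of _ 0]) auto

lemma geodesic_dist_le: "joined p q L \<Longrightarrow> geodesic_dist J p q \<le> L"
  using joined_Sp2[of p q L] by (auto simp: geodesic_dist_eq intro: cInf_lower bdd_below_joined)

text \<open>Connectedness enters the metric here: the infimum is over a nonempty set.\<close>

lemma geodesic_dist_greatest:
  assumes "p \<in> Sp2 J" "q \<in> Sp2 J" "\<And>L. joined p q L \<Longrightarrow> c \<le> L"
  shows "c \<le> geodesic_dist J p q"
  unfolding geodesic_dist_eq[OF assms(1,2)]
  by (rule cInf_greatest) (use Sp2_joined[OF assms(1,2)] assms(3) in auto)

text \<open>The infimum need not be attained, but a strict bound on it yields a curve shorter than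
  \<open>e\<close>.\<close>

lemma hs_norm_le_geodesic_dist:
  assumes "p \<in> Sp2 J" "q \<in> Sp2 J" "geodesic_dist J p q < e" "e \<le> 1/2"
  shows "hs_norm ((blinfun_inverse p o\<^sub>L q) - id_blinfun) \<le> 2 * e"
proof -
  obtain L where L: "joined p q L" "L < e"
    using geodesic_dist_greatest[OF assms(1,2), of e] assms(3) by (meson not_le)
  then have "hs_norm ((blinfun_inverse p o\<^sub>L q) - id_blinfun) \<le> 2 * L"
    using assms(4) by (intro joined_bound) auto
  then show ?thesis using L(2) by linarith
qed

text \<open>Near the identity the numerical range is at least \<open>1/2\<close>, so the Cayley path
  applies to the quotient of \<open>p\<close> and \<open>q\<close>; translated by \<open>p\<close>,
  it joins the two points.\<close>

lemma geodesic_dist_le_hs_norm: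
  assumes p: "p \<in> Sp2 J" and q: "q \<in> Sp2 J"
    and small: "hs_norm ((blinfun_inverse p o\<^sub>L q) - id_blinfun) \<le> 1/2"
  shows "geodesic_dist J p q \<le> 24 * hs_norm ((blinfun_inverse p o\<^sub>L q) - id_blinfun)"
proof -
  let ?g = "blinfun_inverse p o\<^sub>L q" and ?h = "hs_norm ((blinfun_inverse p o\<^sub>L q) - id_blinfun)"
  have g: "?g \<in> Sp2 J" by (intro Sp2_compose Sp2_inverse_closed p q)
  have n: "norm (?g - id_blinfun) \<le> 1/2"
    using norm_le_hs_norm[OF Sp2_D(2)[OF g]] small by linarith
  have "- (norm v)\<^sup>2 / 2 \<le> ?g v \<bullet> v" for v
    using inner_ge_half_if_close_to_id[OF n, of v] zero_le_power2[of "norm v"] by linarith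
  then obtain L where L: "joined id_blinfun ?g L"
    "L \<le> (1 + 4 * norm (?g - id_blinfun)) * (4 + 8 * norm (?g - id_blinfun)) * ?h"
    using joined_cayley[OF g] by blast
  \<comment> \<open>At operator norm \<open>1/2\<close> the two factors are 3 and 8, whence the
    constant 24.\<close>
  have "(1 + 4 * norm (?g - id_blinfun)) * (4 + 8 * norm (?g - id_blinfun)) \<le> 3 * 8"
    using n by (intro mult_mono) auto
  then have "L \<le> 24 * ?h"
    using L(2) mult_right_mono[OF _ hs_norm_nonneg, of _ 24 "?g - id_blinfun"] by fastforce
  moreover have "joined p q L"
  proof -
    have "p o\<^sub>L id_blinfun = p" "p o\<^sub>L ?g = q"
      using p Sp2_D by (auto intro!: blinfun_eqI)
    then show ?thesis using joined_compose_left[OF L(1) p] by simp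
  qed
  ultimately show ?thesis using geodesic_dist_le by fastforce
qed

lemma Metric_space_geodesic_dist: "Metric_space (Sp2 J) (geodesic_dist J)"
proof
  fix p q
  show nn: "0 \<le> geodesic_dist J p q" for p q
    using geodesic_dist_greatest[of p q 0] joined_nonneg
    by (cases "p \<in> Sp2 J \<and> q \<in> Sp2 J") (auto simp: geodesic_dist_def)
  have "joined p q = joined q p" using joined_sym by blast
  then show "geodesic_dist J p q = geodesic_dist J q p"
    by (cases "p \<in> Sp2 J \<and> q \<in> Sp2 J") (auto simp: geodesic_dist_def curve_lengths_eq)
next
  fix p q assume pq: "p \<in> Sp2 J" "q \<in> Sp2 J"
  show "geodesic_dist J p q = 0 \<longleftrightarrow> p = q"
  proof
    assume d: "geodesic_dist J p q = 0"
    let ?g = "blinfun_inverse p o\<^sub>L q"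
    have g: "?g \<in> Sp2 J" by (intro Sp2_compose Sp2_inverse_closed pq)
    have "norm (?g - id_blinfun) \<le> 0"
    proof (rule field_le_epsilon)
      fix e :: real assume "e > 0"
      \<comment> \<open>The cap \<open>1/2\<close> is the range in which the comparison holds; the
        bound is at most \<open>e\<close> in either case.\<close>
      then have "hs_norm (?g - id_blinfun) \<le> 2 * min (e/2) (1/2)"
        using d by (intro hs_norm_le_geodesic_dist pq) auto
      then show "norm (?g - id_blinfun) \<le> 0 + e"
        using norm_le_hs_norm[OF Sp2_D(2)[OF g]] by linarith
    qed
    then have "?g = id_blinfun" by simp
    then have "p (?g x) = p x" for x by simp
    then show "p = q"
      using Sp2_D(1)[OF pq(1)] by (intro blinfun_eqI) simp
  next
    assume "p = q"
    then show "geodesic_dist J p q = 0"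
      using geodesic_dist_le[OF joined_refl[OF pq(1)]] geodesic_dist_greatest[OF pq, of 0] joined_nonneg
      by fastforce
  qed
next
  fix p q r assume pqr: "p \<in> Sp2 J" "q \<in> Sp2 J" "r \<in> Sp2 J"
  \<comment> \<open>The infimum is taken over one leg at a time: over paths from \<open>p\<close> to
    \<open>q\<close> while the second leg has fixed length \<open>M\<close>, and afterwards over
    \<open>M\<close>.\<close>
  have "geodesic_dist J p r - M \<le> geodesic_dist J p q" if "joined q r M" for M
    using geodesic_dist_le[OF joined_trans[OF _ that]]
    by (intro geodesic_dist_greatest pqr) (simp add: algebra_simps)
  then have "geodesic_dist J p r - geodesic_dist J p q \<le> geodesic_dist J q r"
    by (intro geodesic_dist_greatest pqr) (simp add: algebra_simps)
  then show "geodesic_dist J p r \<le> geodesic_dist J p q + geodesic_dist J q r"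
    by simp
qed

text \<open>A Cauchy sequence for the geodesic distance, translated to the identity, is Cauchy for the
  Hilbert-Schmidt norm; the limit stays invertible since the tail is within 1/2 of the identity.\<close>

lemma mcomplete_geodesic_dist: "Metric_space.mcomplete (Sp2 J) (geodesic_dist J)"
proof -
  interpret Metric_space "Sp2 J" "geodesic_dist J" by (rule Metric_space_geodesic_dist)
  have "\<exists>x. limitin mtopology \<sigma> x sequentially" if "MCauchy \<sigma>" for \<sigma>
  proof -
    have \<sigma>: "\<sigma> n \<in> Sp2 J" for n using that unfolding MCauchy_def by (simp add: image_subset_iff)
    have cau: "\<exists>N. \<forall>m\<ge>N. \<forall>n\<ge>N. geodesic_dist J (\<sigma> m) (\<sigma> n) < e" if "e > 0" for e
    proof -
      obtain N where "\<forall>m n. N \<le> m \<longrightarrow> N \<le> n \<longrightarrow> geodesic_dist J (\<sigma> m) (\<sigma> n) < e"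
        using \<open>MCauchy \<sigma>\<close> \<open>e > 0\<close> unfolding MCauchy_def by metis
      then show ?thesis by (intro exI[of _ N]) simp
    qed
    \<comment> \<open>The comparison doubles \<open>1/4\<close> to \<open>1/2\<close>, which keeps
      the translated tail and its limit coercive.\<close>
    obtain N where N: "\<And>n. n \<ge> N \<Longrightarrow> geodesic_dist J (\<sigma> N) (\<sigma> n) < 1/4"
      using cau[of "1/4"] by auto
    define h where "h n = blinfun_inverse (\<sigma> N) o\<^sub>L \<sigma> (N + n)" for n
    have h: "h n \<in> Sp2 J" for n
      unfolding h_def by (intro Sp2_compose Sp2_inverse_closed \<sigma>)
    note hS = Sp2_D(1)[OF h] and hHS = Sp2_D(2)[OF h]
    have h1: "hs_norm (h n - id_blinfun) \<le> 1/2" for n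
      using hs_norm_le_geodesic_dist[OF \<sigma> \<sigma> N[of "N + n"]] unfolding h_def by simp
    have n2: "norm (h n) \<le> 2" for n
    proof -
      have "norm (h n) \<le> norm (id_blinfun :: 'a \<Rightarrow>\<^sub>L 'a) + norm (h n - id_blinfun)"
        using norm_triangle_ineq[of id_blinfun "h n - id_blinfun"] by simp
      then show ?thesis
        using norm_le_hs_norm[OF hHS[of n]] h1[of n] norm_blinfun_id_le[where 'a='a] by linarith
    qed
    \<comment> \<open>The translation cancels in quotients, so distance bounds for
      \<open>\<sigma>\<close> apply to \<open>h\<close>.\<close>
    have inv: "blinfun_inverse (h m) o\<^sub>L h n = blinfun_inverse (\<sigma> (N + m)) o\<^sub>L \<sigma> (N + n)" for m n
    proof -
      have "blinfun_inverse (blinfun_inverse (\<sigma> N)) = \<sigma> N"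
        by (rule blinfun_invertibleI) (simp_all add: Sp2_D(1)[OF \<sigma>])
      then show ?thesis
        unfolding h_def
        by (intro blinfun_eqI) (simp add: inverse_compose Sp_inverse_closed Sp2_D(1)[OF \<sigma>])
    qed
    have "Cauchy (\<lambda>n. Hs (h n - id_blinfun))"
    proof (rule CauchyI)
      fix e :: real assume e: "e > 0"
      \<comment> \<open>The bound \<open>1/2\<close> admits the comparison with the norm;
        \<open>e / 8\<close> absorbs a factor 2 from it and another from the norm of
        \<open>h m\<close>.\<close>
      define d where "d = min (1/2) (e / 8)"
      have d: "d > 0" "d \<le> 1/2" "4 * d < e" using e by (auto simp: d_def min_def)
      obtain M where M: "\<And>m n. m \<ge> M \<Longrightarrow> n \<ge> M \<Longrightarrow> geodesic_dist J (\<sigma> m) (\<sigma> n) < d"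
        using cau[OF d(1)] by blast
      have "norm (Hs (h n - id_blinfun) - Hs (h m - id_blinfun)) < e" if mn: "m \<ge> M" "n \<ge> M" for m n
      proof -
        let ?k = "blinfun_inverse (h m) o\<^sub>L h n"
        have k: "?k - id_blinfun \<in> hilbert_schmidt"
          by (intro Sp2_D(2) Sp2_compose Sp2_inverse_closed h)
        have "norm (Hs (h n - id_blinfun) - Hs (h m - id_blinfun)) = hs_norm (h n - h m)"
          using hilbert_schmidt_diff[OF hHS[of n] hHS[of m]] by (simp add: Hs_diff hHS norm_Hs)
        also have "h n - h m = h m o\<^sub>L (?k - id_blinfun)"
          by (rule blinfun_eqI) (simp add: blinfun.bilinear_simps hS)
        also have "hs_norm \<dots> \<le> norm (h m) * hs_norm (?k - id_blinfun)"
          by (rule hs_norm_compose_left[OF k])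
        also have "\<dots> \<le> 2 * (2 * d)"
          unfolding inv using n2 mn
          by (intro mult_mono hs_norm_le_geodesic_dist[OF \<sigma> \<sigma> M d(2)]) auto
        finally show ?thesis using d(3) by simp
      qed
      then show "\<exists>M. \<forall>m\<ge>M. \<forall>n\<ge>M. norm (Hs (h m - id_blinfun) - Hs (h n - id_blinfun)) < e" by blast
    qed
    then obtain Y where Y: "(\<lambda>n. Hs (h n - id_blinfun)) \<longlonglongrightarrow> Y"
      using convergent_eq_Cauchy by blast
    define k where "k = hs_op Y + id_blinfun"
    have kHS: "k - id_blinfun \<in> hilbert_schmidt" by (simp add: k_def hs_op)
    have kY: "Hs (k - id_blinfun) = Y" by (simp add: k_def hs_op_inverse)
    have hk: "h \<longlonglongrightarrow> k"
    proof -
      have "(\<lambda>n. hs_op (Hs (h n - id_blinfun)) + id_blinfun) \<longlonglongrightarrow> k"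
        unfolding k_def by (intro tendsto_intros bounded_linear.tendsto[OF bounded_linear_hs_op Y])
      then show ?thesis by (simp add: Hs_inverse hHS)
    qed
    have sym: "J (k x) \<bullet> k y = J x \<bullet> y" for x y
    proof (rule LIMSEQ_unique)
      show "(\<lambda>n. J (h n x) \<bullet> h n y) \<longlonglongrightarrow> J (k x) \<bullet> k y" by (intro tendsto_intros hk)
      show "(\<lambda>n. J (h n x) \<bullet> h n y) \<longlonglongrightarrow> J x \<bullet> y" by (simp add: Sp_D(2)[OF hS])
    qed
    have "hs_norm (k - id_blinfun) \<le> 1/2"
    proof -
      have "norm Y \<le> 1/2"
        by (rule LIMSEQ_le_const2[OF tendsto_norm[OF Y]]) (use h1 in \<open>simp add: norm_Hs hHS\<close>)
      then show ?thesis using norm_Hs[OF kHS] kY by simp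
    qed
    then have k1: "norm (k - id_blinfun) \<le> 1/2" using norm_le_hs_norm[OF kHS] by linarith
    have "blinfun_invertible k"
      by (rule coercive_invertible[of "1/2"]) (simp, rule inner_ge_half_if_close_to_id[OF k1])
    then have "k \<in> Sp J" unfolding Sp_iff using sym by blast
    then have k: "k \<in> Sp2 J" using kHS by (rule Sp2_I)
    define g where "g = \<sigma> N o\<^sub>L k"
    have g: "g \<in> Sp2 J" unfolding g_def by (intro Sp2_compose \<sigma> k)
    have lim: "(\<lambda>n. 2 * hs_norm (k - h n)) \<longlonglongrightarrow> 0"
    proof -
      have "(\<lambda>n. 2 * norm (Y - Hs (h n - id_blinfun))) \<longlonglongrightarrow> 2 * norm (Y - Y)"
        by (intro tendsto_intros Y)
      moreover have "norm (Y - Hs (h n - id_blinfun)) = hs_norm (k - h n)" for n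
        using hilbert_schmidt_diff[OF kHS hHS[of n]] unfolding kY[symmetric]
        by (simp add: Hs_diff hHS kHS norm_Hs)
      ultimately show ?thesis by simp
    qed
    \<comment> \<open>The quotient minus the identity is the inverse of \<open>h n\<close> times
      \<open>k - h n\<close>, and that inverse has norm at most 2 because \<open>h n\<close>
      has.\<close>
    have le: "hs_norm ((blinfun_inverse (\<sigma> (N + n)) o\<^sub>L g) - id_blinfun) \<le> 2 * hs_norm (k - h n)" for n
    proof -
      have kh: "k - h n \<in> hilbert_schmidt" using hilbert_schmidt_diff[OF kHS hHS[of n]] by simp
      have eq: "blinfun_inverse (\<sigma> (N + n)) o\<^sub>L \<sigma> N = blinfun_inverse (h n)"
      proof -
        have "blinfun_inverse (blinfun_inverse (\<sigma> N)) = \<sigma> N"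
          by (rule blinfun_invertibleI) (simp_all add: Sp2_D(1)[OF \<sigma>])
        then show ?thesis
          unfolding h_def by (simp add: inverse_compose Sp_inverse_closed Sp2_D(1)[OF \<sigma>])
      qed
      have eq': "blinfun_inverse (\<sigma> (N + n)) (\<sigma> N y) = blinfun_inverse (h n) y" for y
        using arg_cong[OF eq, of "\<lambda>f. blinfun_apply f y"] by simp
      have "(blinfun_inverse (\<sigma> (N + n)) o\<^sub>L g) - id_blinfun = blinfun_inverse (h n) o\<^sub>L (k - h n)"
        by (intro blinfun_eqI) (simp add: g_def eq' blinfun.bilinear_simps hS)
      then have "hs_norm ((blinfun_inverse (\<sigma> (N + n)) o\<^sub>L g) - id_blinfun)
          \<le> norm (blinfun_inverse (h n)) * hs_norm (k - h n)"
        using hs_norm_compose_left[OF kh] by simp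
      also have "\<dots> \<le> 2 * hs_norm (k - h n)"
        using norm_Sp_inverse_le[OF hS[of n]] n2[of n] by (intro mult_right_mono) auto
      finally show ?thesis .
    qed
    have "(\<lambda>n. geodesic_dist J (\<sigma> (n + N)) g) \<longlonglongrightarrow> 0"
    proof (rule Lim_null_comparison)
      have "\<forall>\<^sub>F n in sequentially. 2 * hs_norm (k - h n) < 1/2"
        using lim by (rule order_tendstoD) simp
      then show "\<forall>\<^sub>F n in sequentially. norm (geodesic_dist J (\<sigma> (n + N)) g) \<le> 24 * (2 * hs_norm (k - h n))"
      proof eventually_elim
        case (elim n)
        have "geodesic_dist J (\<sigma> (N + n)) g \<le> 24 * hs_norm ((blinfun_inverse (\<sigma> (N + n)) o\<^sub>L g) - id_blinfun)"
          using le[of n] elim by (intro geodesic_dist_le_hs_norm \<sigma> g) linarith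
        then show ?case using le[of n] nonneg by (simp add: add.commute)
      qed
      show "(\<lambda>n. 24 * (2 * hs_norm (k - h n))) \<longlonglongrightarrow> 0"
        using lim by (rule tendsto_mult_right_zero)
    qed
    then have "(\<lambda>n. geodesic_dist J (\<sigma> n) g) \<longlonglongrightarrow> 0" by (rule LIMSEQ_offset)
    then have "limitin mtopology \<sigma> g sequentially"
      unfolding limitin_metric_dist_null using g \<sigma> by simp
    then show ?thesis by blast
  qed
  then show ?thesis unfolding mcomplete_def by blast
qed

end

theorem theorem7p2:
  fixes J :: "'a::{real_inner,banach} \<Rightarrow>\<^sub>L 'a"
  assumes "\<not> (\<exists>S::'a set. finite S \<and> span S = UNIV)"
    and "complex_structure J"
  shows "Metric_space (Sp2 J) (geodesic_dist J) \<and>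
    Metric_space.mcomplete (Sp2 J) (geodesic_dist J)"
proof -
  interpret complex_hilbert_space J by standard fact
  show ?thesis using Metric_space_geodesic_dist mcomplete_geodesic_dist ..
qed

end
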